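(* Let $\Bbbk$ be an algebraically closed field of characteristic $0$. Let $X=(|X|,\mathcal{O})$ be a smooth integral affine supervariety over $\Bbbk$, that is, $X=\underline{\mathrm{Spec}}(A)$ is smooth, where $A=\Gamma(X,\mathcal{O})$ is a finitely generated integral superdomain over $\Bbbk$. Let $\dim X=r|s$ and suppose $r|s\ge 1|0$ (i.e. $r\ge 1$ and $s\ge 0$). Then $\mathcal{V}=\mathrm{Der}(\Gamma(X,\mathcal{O}))=\mathrm{Der}(A)$ is a simple Lie superalgebra.
   Context: All superalgebras $A=A_{\overline 0}\oplus A_{\overline 1}$ are $\mathbb{Z}_2$-graded, associative, unital and supercommutative over $\Bbbk$; $|a|$ denotes the parity of a homogeneous element and $(A_{\overline 1})$ the ideal generated by the odd elements. $A$ is an integral superdomain if $A\setminus (A_{\overline 1})$ is nonempty and contains no zero divisors of $A$; then $(A_{\overline 1})$ is prime and $A$ embeds in its localizations at prime ideals. $\underline{\mathrm{Spec}}(A)=(|X|,\mathcal{O})$ is the affine superscheme of $A$, with local superalgebra $\mathcal{O}_p$ and maximal ideal $\mathfrak{m}_p$ at a closed point $p$. Regularity: for a superalgebra $B$, an even element $x$ is $B$-regular if multiplication by $x$ on $B$ is injective; an odd element $\xi$ is $B$-regular if $B\xrightarrow{\xi}B\xrightarrow{\xi}B$ is exact. A sequence of homogeneous elements $a_1,\dots,a_n$ of $B$ is regular if each $a_i$ is $B/(a_1,\dots,a_{i-1})$-regular. A closed point $p$ is smooth, of dimension $r|s$, if $\mathfrak{m}_p$ is generated by a regular sequence in $\mathcal{O}_p$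 consisting of $r$ even and $s$ odd elements. $X$ is smooth of dimension $r|s$ if all its closed points are smooth of dimension $r|s$. $\mathrm{Der}(A)=\mathrm{Der}(A)_{\overline 0}\oplus\mathrm{Der}(A)_{\overline 1}$ is the Lie superalgebra of $\Bbbk$-linear superderivations: homogeneous $D$ satisfies $D(ab)=D(a)b+(-1)^{|D||a|}aD(b)$ for homogeneous $a\in A$ and all $b\in A$, and $[D,D']=DD'-(-1)^{|D||D'|}D'D$. A Lie superalgebra is simple if it is not abelian and has no $\mathbb{Z}_2$-graded ideals other than $0$ and itself. *)

theory Defs
  imports
    "HOL-Library.Z2"
    "HOL-Library.Function_Algebras"
    "HOL-Algebra.QuotRing"
    "HOL-Algebra.Algebraic_Closure_Type"
    "HOL-Computational_Algebra.Fundamental_Theorem_Algebra"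
begin

text \<open>
  A \<open>\<int>\<^sub>2\<close>-grading is a family \<open>G :: bit \<Rightarrow> _ set\<close>, with \<open>G 0\<close> the even and \<open>G 1\<close> the odd part;
  \<^typ>\<open>bit\<close> is the field with two elements, so parities are added and multiplied in it.
\<close>

text \<open>\<open>koszul (i * j)\<close> is the sign \<open>(-1)\<^sup>i\<^sup>j\<close>.\<close>

definition koszul :: "bit \<Rightarrow> 'r::ring_1" where
  "koszul i = (if i = 0 then 1 else - 1)"

definition graded_sum :: "(bit \<Rightarrow> 'v::ab_group_add set) \<Rightarrow> 'v set" where
  "graded_sum G = {x + y |x y. x \<in> G 0 \<and> y \<in> G 1}"

definition graded_subset :: "(bit \<Rightarrow> 'v::ab_group_add set) \<Rightarrow> 'v set \<Rightarrow> bool" where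
  "graded_subset G W \<longleftrightarrow> (\<forall>w\<in>W. \<exists>x \<in> W \<inter> G 0. \<exists>y \<in> W \<inter> G 1. w = x + y)"

text \<open>Only meaningful for \<open>x \<in> graded_sum G\<close>, and when the sum \<open>G 0 + G 1\<close> is direct.\<close>

definition component :: "(bit \<Rightarrow> 'v::ab_group_add set) \<Rightarrow> bit \<Rightarrow> 'v \<Rightarrow> 'v" where
  "component G i x = (THE y. y \<in> G i \<and> x - y \<in> G (i + 1))"

locale superalgebra = vector_space scale
  for scale :: "'k::field \<Rightarrow> 'a::ring_1 \<Rightarrow> 'a" +
  fixes gr :: "bit \<Rightarrow> 'a set"
  assumes scale_mult_left: "scale c a * b = scale c (a * b)"
    and scale_mult_right: "a * scale c b = scale c (a * b)"
    and subspace_gr: "subspace (gr i)"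
    and gr_sum: "graded_sum gr = UNIV"
    and gr_direct: "gr 0 \<inter> gr 1 = {0}"
    and one_gr: "1 \<in> gr 0"
    and mult_gr: "a \<in> gr i \<Longrightarrow> b \<in> gr j \<Longrightarrow> a * b \<in> gr (i + j)"
    and supercommutative: "a \<in> gr i \<Longrightarrow> b \<in> gr j \<Longrightarrow> a * b = koszul (i * j) * (b * a)"

definition subalgebra :: "('k::field \<Rightarrow> 'a::ring_1 \<Rightarrow> 'a) \<Rightarrow> 'a set \<Rightarrow> bool" where
  "subalgebra scale B \<longleftrightarrow>
     module.subspace scale B \<and> 1 \<in> B \<and> (\<forall>a\<in>B. \<forall>b\<in>B. a * b \<in> B)"

definition finitely_generated_superalgebra ::
    "('k::field \<Rightarrow> 'a::ring_1 \<Rightarrow> 'a) \<Rightarrow> (bit \<Rightarrow> 'a set) \<Rightarrow> bool" where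
  "finitely_generated_superalgebra scale gr \<longleftrightarrow>
     (\<exists>F. finite F \<and> F \<subseteq> gr 0 \<union> gr 1 \<and> (\<forall>B. subalgebra scale B \<and> F \<subseteq> B \<longrightarrow> B = UNIV))"

definition odd_ideal :: "(bit \<Rightarrow> 'a::ring_1 set) \<Rightarrow> 'a set" where
  "odd_ideal gr = Idl\<^bsub>ring_of_type_algebra\<^esub> (gr 1)"

definition zero_divisor :: "'a::ring_1 \<Rightarrow> bool" where
  "zero_divisor a \<longleftrightarrow> (\<exists>b. b \<noteq> 0 \<and> (a * b = 0 \<or> b * a = 0))"

definition integral_superdomain :: "(bit \<Rightarrow> 'a::ring_1 set) \<Rightarrow> bool" where
  "integral_superdomain gr \<longleftrightarrow>
     UNIV - odd_ideal gr \<noteq> {} \<and> (\<forall>a \<in> UNIV - odd_ideal gr. \<not> zero_divisor a)"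

definition superideal :: "(bit \<Rightarrow> 'a::ring_1 set) \<Rightarrow> 'a set \<Rightarrow> bool" where
  "superideal gr I \<longleftrightarrow> ideal I ring_of_type_algebra \<and> graded_subset gr I"

definition Spec :: "(bit \<Rightarrow> 'a::ring_1 set) \<Rightarrow> 'a set set" where
  "Spec gr = {p. superideal gr p \<and> p \<noteq> UNIV \<and> (\<forall>a b. a * b \<in> p \<longrightarrow> a \<in> p \<or> b \<in> p)}"

definition zariski_closed :: "(bit \<Rightarrow> 'a::ring_1 set) \<Rightarrow> 'a set set \<Rightarrow> bool" where
  "zariski_closed gr Z \<longleftrightarrow> (\<exists>I. superideal gr I \<and> Z = {p \<in> Spec gr. I \<subseteq> p})"

definition closed_point :: "(bit \<Rightarrow> 'a::ring_1 set) \<Rightarrow> 'a set \<Rightarrow> bool" where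
  "closed_point gr p \<longleftrightarrow> p \<in> Spec gr \<and> zariski_closed gr {p}"

text \<open>
  Fractions \<open>a/s\<close> with denominators in a multiplicative set \<open>S\<close> of central elements,
  as classes of pairs \<open>(a, s)\<close>.
\<close>

definition frac_rel :: "'a::ring_1 set \<Rightarrow> (('a \<times> 'a) \<times> ('a \<times> 'a)) set" where
  "frac_rel S = {((a, s), (b, t)). s \<in> S \<and> t \<in> S \<and> (\<exists>u\<in>S. u * (t * a - s * b) = 0)}"

definition fraction :: "'a::ring_1 set \<Rightarrow> 'a \<Rightarrow> 'a \<Rightarrow> ('a \<times> 'a) set" where
  "fraction S a s = frac_rel S `` {(a, s)}"

record 'b superring = "'b ring" +
  part :: "bit \<Rightarrow> 'b set"

definition localization ::
    "(bit \<Rightarrow> 'a::ring_1 set) \<Rightarrow> 'a set \<Rightarrow> ('a \<times> 'a) set superring" where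
  "localization gr S =
     \<lparr>carrier = (UNIV \<times> S) // frac_rel S,
      monoid.mult = (\<lambda>P Q. \<Union>x\<in>P. \<Union>y\<in>Q. fraction S (fst x * fst y) (snd x * snd y)),
      one = fraction S 1 1,
      zero = fraction S 0 1,
      add = (\<lambda>P Q. \<Union>x\<in>P. \<Union>y\<in>Q.
                fraction S (snd y * fst x + snd x * fst y) (snd x * snd y)),
      part = (\<lambda>i. {fraction S a s |a s. a \<in> gr i \<and> s \<in> S})\<rparr>"

text \<open>
  The stalk at a prime \<open>p\<close> inverts the even elements outside \<open>p\<close>.  Its scalar multiplication
  is not recorded, since smoothness does not refer to it.
\<close>

definition stalk :: "(bit \<Rightarrow> 'a::ring_1 set) \<Rightarrow> 'a set \<Rightarrow> ('a \<times> 'a) set superring" where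
  "stalk gr p = localization gr (gr 0 - p)"

definition stalk_maximal_ideal ::
    "(bit \<Rightarrow> 'a::ring_1 set) \<Rightarrow> 'a set \<Rightarrow> ('a \<times> 'a) set set" where
  "stalk_maximal_ideal gr p = {fraction (gr 0 - p) a s |a s. a \<in> p \<and> s \<in> gr 0 - p}"

definition even_regular :: "('b, 'm) ring_scheme \<Rightarrow> 'b \<Rightarrow> bool" where
  "even_regular B x \<longleftrightarrow> inj_on (\<lambda>b. x \<otimes>\<^bsub>B\<^esub> b) (carrier B)"

definition odd_regular :: "('b, 'm) ring_scheme \<Rightarrow> 'b \<Rightarrow> bool" where
  "odd_regular B x \<longleftrightarrow>
     {b \<in> carrier B. x \<otimes>\<^bsub>B\<^esub> b = \<zero>\<^bsub>B\<^esub>} = (\<lambda>b. x \<otimes>\<^bsub>B\<^esub> b) ` carrier B"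

text \<open>
  The element \<open>0\<close> is both even and odd; for it the two conditions agree, each saying that the
  quotient is the zero ring.
\<close>

definition regular_sequence :: "'b superring \<Rightarrow> 'b list \<Rightarrow> bool" where
  "regular_sequence B as \<longleftrightarrow>
     (\<forall>n < length as.
        let I = Idl\<^bsub>B\<^esub> (set (take n as)); x = I +>\<^bsub>B\<^esub> (as ! n) in
          as ! n \<in> part B 0 \<and> even_regular (B Quot I) x
        \<or> as ! n \<in> part B 1 \<and> odd_regular (B Quot I) x)"

definition smooth_point :: "(bit \<Rightarrow> 'a::ring_1 set) \<Rightarrow> 'a set \<Rightarrow> nat \<Rightarrow> nat \<Rightarrow> bool" where
  "smooth_point gr p r s \<longleftrightarrow>
     (\<exists>as. regular_sequence (stalk gr p) as
         \<and> length as = r + s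
         \<and> length (filter (\<lambda>x. x \<in> part (stalk gr p) 0) as) = r
         \<and> length (filter (\<lambda>x. x \<in> part (stalk gr p) 1) as) = s
         \<and> stalk_maximal_ideal gr p = Idl\<^bsub>stalk gr p\<^esub> (set as))"

definition smooth_of_dim :: "(bit \<Rightarrow> 'a::ring_1 set) \<Rightarrow> nat \<Rightarrow> nat \<Rightarrow> bool" where
  "smooth_of_dim gr r s \<longleftrightarrow> (\<forall>p. closed_point gr p \<longrightarrow> smooth_point gr p r s)"

text \<open>
  The underlying space is \<open>graded_sum L\<close>, a subspace of the ambient space \<open>'v\<close>; the values of
  the bracket elsewhere are irrelevant.  Over a field of characteristic different from
  2 and 3 these axioms suffice.
\<close>

locale lie_superalgebra = vector_space scale
  for scale :: "'k::field \<Rightarrow> 'v::ab_group_add \<Rightarrow> 'v" +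
  fixes L :: "bit \<Rightarrow> 'v set"
    and br :: "'v \<Rightarrow> 'v \<Rightarrow> 'v"
  assumes subspace_L: "subspace (L i)"
    and L_direct: "L 0 \<inter> L 1 = {0}"
    and br_add_left:
      "x \<in> graded_sum L \<Longrightarrow> y \<in> graded_sum L \<Longrightarrow> z \<in> graded_sum L \<Longrightarrow>
       br (x + y) z = br x z + br y z"
    and br_add_right:
      "x \<in> graded_sum L \<Longrightarrow> y \<in> graded_sum L \<Longrightarrow> z \<in> graded_sum L \<Longrightarrow>
       br x (y + z) = br x y + br x z"
    and br_scale_left:
      "x \<in> graded_sum L \<Longrightarrow> y \<in> graded_sum L \<Longrightarrow> br (scale c x) y = scale c (br x y)"
    and br_scale_right:
      "x \<in> graded_sum L \<Longrightarrow> y \<in> graded_sum L \<Longrightarrow> br x (scale c y) = scale c (br x y)"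
    and br_graded: "x \<in> L i \<Longrightarrow> y \<in> L j \<Longrightarrow> br x y \<in> L (i + j)"
    and br_super_antisym:
      "x \<in> L i \<Longrightarrow> y \<in> L j \<Longrightarrow> br x y = - scale (koszul (i * j)) (br y x)"
    and br_super_jacobi:
      "x \<in> L i \<Longrightarrow> y \<in> L j \<Longrightarrow> z \<in> L k \<Longrightarrow>
       br x (br y z) = br (br x y) z + scale (koszul (i * j)) (br y (br x z))"

definition lie_superideal ::
    "('k::field \<Rightarrow> 'v::ab_group_add \<Rightarrow> 'v) \<Rightarrow> (bit \<Rightarrow> 'v set) \<Rightarrow> ('v \<Rightarrow> 'v \<Rightarrow> 'v) \<Rightarrow>
     'v set \<Rightarrow> bool" where
  "lie_superideal scale L br W \<longleftrightarrow>
     W \<subseteq> graded_sum L \<and> module.subspace scale W \<and> graded_subset L W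
     \<and> (\<forall>x \<in> graded_sum L. \<forall>w \<in> W. br x w \<in> W)"

definition simple_lie_superalgebra ::
    "('k::field \<Rightarrow> 'v::ab_group_add \<Rightarrow> 'v) \<Rightarrow> (bit \<Rightarrow> 'v set) \<Rightarrow> ('v \<Rightarrow> 'v \<Rightarrow> 'v) \<Rightarrow> bool" where
  "simple_lie_superalgebra scale L br \<longleftrightarrow>
     lie_superalgebra scale L br
     \<and> \<not> (\<forall>x \<in> graded_sum L. \<forall>y \<in> graded_sum L. br x y = 0)
     \<and> (\<forall>W. lie_superideal scale L br W \<longrightarrow> W = {0} \<or> W = graded_sum L)"

definition Der ::
    "('k::field \<Rightarrow> 'a::ring_1 \<Rightarrow> 'a) \<Rightarrow> (bit \<Rightarrow> 'a set) \<Rightarrow> bit \<Rightarrow> ('a \<Rightarrow> 'a) set" where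
  "Der scale gr i =
     {D. Vector_Spaces.linear scale scale D
       \<and> (\<forall>j. D ` gr j \<subseteq> gr (i + j))
       \<and> (\<forall>j. \<forall>a \<in> gr j. \<forall>b. D (a * b) = D a * b + koszul (i * j) * (a * D b))}"

text \<open>
  The supercommutator \<open>D E - (-1)\<^sup>|\<^sup>D\<^sup>|\<^sup>|\<^sup>E\<^sup>| E D\<close> of homogeneous derivations, extended
  biadditively through the homogeneous components.
\<close>

definition Der_bracket ::
    "('k::field \<Rightarrow> 'a::ring_1 \<Rightarrow> 'a) \<Rightarrow> (bit \<Rightarrow> 'a set) \<Rightarrow>
     ('a \<Rightarrow> 'a) \<Rightarrow> ('a \<Rightarrow> 'a) \<Rightarrow> ('a \<Rightarrow> 'a)" where
  "Der_bracket scale gr D E =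
     (\<Sum>i\<in>UNIV. \<Sum>j\<in>UNIV.
        let D' = component (Der scale gr) i D; E' = component (Der scale gr) j E
        in (\<lambda>a. D' (E' a) - koszul (i * j) * E' (D' a)))"

definition pointwise_scale :: "('k \<Rightarrow> 'a \<Rightarrow> 'a) \<Rightarrow> 'k \<Rightarrow> ('a \<Rightarrow> 'a) \<Rightarrow> ('a \<Rightarrow> 'a)" where
  "pointwise_scale scale c D = (\<lambda>a. scale c (D a))"

end

theory Submission
  imports Defs
begin

text \<open>
  Let \<open>L = Der A\<close> and let \<open>W\<close> be a nonzero graded ideal of \<open>L\<close>.  Simplicity is a formal
  consequence of two facts about the points of \<open>X\<close>.  (a) At a closed point \<open>p\<close>, a subset of
  \<open>p\<close> that all derivations map into itself has no nonzero element.  (b) At a closed point some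
  even derivation \<open>E\<close> and some even \<open>g\<close> satisfy \<open>E g \<notin> p\<close>; here \<open>r \<ge> 1\<close> enters.

  The formal part.  The additive span of all values \<open>D f\<close> with \<open>D \<in> W\<close> is stable under
  derivations and nonzero, so (a) gives a homogeneous \<open>D \<in> W\<close> with \<open>D f \<notin> p\<close>.  If \<open>D\<close> is odd,
  the bracket of \<open>D\<close> with \<open>f E\<close>, for \<open>E\<close> from (b) and \<open>f\<close> odd, is an even element of \<open>W\<close> with the
  same property (\<open>even_element_from_odd\<close>).  For even \<open>D\<close> and even \<open>f, h\<close>, a few commutators show
  that \<open>D (D h) * D f\<close> multiplies all of \<open>L\<close> into \<open>W\<close> (\<open>even_element_coefficient\<close>), and the choice
  \<open>h = f\<close> or \<open>h = f * f\<close> makes this coefficient nonzero because elements outside \<open>p\<close> are not zero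
  divisors.  The coefficients \<open>a\<close> with \<open>a L \<subseteq> W\<close> form an ideal of \<open>A\<close> that is stable under
  derivations, since \<open>D(a) E\<close> is \<open>[D, a E]\<close> minus a sign times \<open>a [D, E]\<close>.  If it were proper it
  would lie in some closed point, which (a) forbids; so it contains \<open>1\<close> and \<open>W = L\<close>.

  The geometric part.  The maximal ideal at \<open>p\<close> is generated, up to denominators, by a regular
  sequence \<open>b\<^sub>0, \<dots>, b\<^sub>m\<^sub>-\<^sub>1\<close>.  Everything rests on vector fields \<open>D\<^sub>i\<close> on \<open>X\<close> with
  \<open>D\<^sub>i b\<^sub>j \<equiv> \<delta>\<^sub>i\<^sub>j\<close> modulo \<open>p\<close> (\<open>dual_derivation\<close>), which also give (b).  Given them, (a) is
  Euler's formula: for \<open>f\<close> of order \<open>n\<close> at \<open>p\<close>, \<open>n f\<close> is \<open>\<Sum> b\<^sub>i D\<^sub>i f\<close> up to order \<open>n + 1\<close>, so a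
  stable subset of \<open>p\<close> has infinite order, and Krull's intersection theorem (\<open>krull\<close>) makes it zero.

  To find \<open>D\<^sub>i\<close>: a regular sequence is quasi-regular (\<open>regular_imp_quasi_regular\<close>), so modulo every
  power of \<open>p\<close> the algebra is a truncated polynomial superalgebra and has formal partial
  derivatives.  A derivation of \<open>A\<close> is a solution \<open>v\<close> of finitely many linear equations
  \<open>\<Sum> v\<^sub>k Y\<^sub>k = 0\<close>, where \<open>v\<^sub>k\<close> is the value on the \<open>k\<close>-th algebra generator and \<open>Y\<close> runs through the
  gradients of the relations between the generators.  The formal partial derivatives are
  approximate solutions to every order, congruent to each other modulo \<open>p\<close>, and \<open>krull\<close> replaces
  them by an exact solution that is congruent to them modulo \<open>p\<close>.

  The commutative algebra behind this is proved in the form in which it is used: Hilbert's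
  basis theorem for modules over skew-commuting operators (\<open>acc_on_skew_operators\<close>), and the
  Nullstellensatz by extending characters one generator at a time (\<open>separated_adjoin\<close>).
\<close>

section \<open>The ascending chain condition for skew-commuting operators\<close>

lemma linear_map_rules:
  assumes "Vector_Spaces.linear s1 s2 f"
  shows linear_map_add: "f (x + y) = f x + f y"
    and linear_map_scale: "f (s1 c x) = s2 c (f x)"
    and linear_map_zero: "f 0 = 0"
    and linear_map_sum: "f (sum g A) = (\<Sum>a\<in>A. f (g a))"
proof -
  interpret module_hom s1 s2 f using assms by (simp add: module_hom_iff_linear)
  show "f (x + y) = f x + f y" "f (s1 c x) = s2 c (f x)" "f 0 = 0" "f (sum g A) = (\<Sum>a\<in>A. f (g a))"
    by (rule add scale zero sum)+
qed

text \<open>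
  Modules are represented as subspaces stable under a set of operators, so that no ring acting on
  them has to be constructed.
\<close>

locale operator_space = vector_space
begin

definition op_stable :: "('b \<Rightarrow> 'b) set \<Rightarrow> 'b set \<Rightarrow> bool" where
  "op_stable Ts S \<longleftrightarrow> subspace S \<and> (\<forall>T\<in>Ts. T ` S \<subseteq> S)"

definition acc_on :: "('b \<Rightarrow> 'b) set \<Rightarrow> 'b set \<Rightarrow> bool" where
  "acc_on Ts M \<longleftrightarrow>
     (\<forall>S. (\<forall>n. op_stable Ts (S n) \<and> S n \<subseteq> M) \<and> incseq S \<longrightarrow> (\<exists>n. \<forall>k\<ge>n. S k = S n))"

lemma op_stable_Inter: "(\<And>S. S \<in> \<S> \<Longrightarrow> op_stable Ts S) \<Longrightarrow> op_stable Ts (\<Inter>\<S>)"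
  unfolding op_stable_def by (auto intro: subspace_Inter simp: image_subset_iff)

lemma op_stable_hull: "op_stable Ts (op_stable Ts hull G)"
  by (rule hull_in) (simp add: op_stable_Inter)

lemma op_stableD:
  assumes "op_stable Ts S"
  shows "subspace S" and "\<And>T x. T \<in> Ts \<Longrightarrow> x \<in> S \<Longrightarrow> T x \<in> S"
  using assms unfolding op_stable_def by auto

lemma acc_on_span_finite:
  assumes "finite G"
  shows "acc_on {} (span G)"
  using assms
proof (induction G)
  case empty
  have "S k = {0}" if "\<forall>n. op_stable {} (S n) \<and> S n \<subseteq> span {}" for S :: "nat \<Rightarrow> 'b set" and k
    using that subspace_0[of "S k"] by (auto simp: op_stable_def)
  then show ?case unfolding acc_on_def by metis
next
  case (insert g G)
  show ?case
    unfolding acc_on_def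
  proof safe
    fix S :: "nat \<Rightarrow> 'b set"
    assume S: "\<forall>n. op_stable {} (S n) \<and> S n \<subseteq> span (insert g G)" and inc: "incseq S"
    have sub: "subspace (S n)" for n using S by (auto simp: op_stable_def)
    have "\<exists>n. \<forall>k\<ge>n. S k \<inter> span G = S n \<inter> span G"
    proof (rule insert.IH[unfolded acc_on_def, rule_format])
      show "(\<forall>n. op_stable {} (S n \<inter> span G) \<and> S n \<inter> span G \<subseteq> span G) \<and> incseq (\<lambda>n. S n \<inter> span G)"
        using sub inc by (auto simp: op_stable_def incseq_def intro: subspace_inter)
    qed
    then obtain n1 where n1: "\<And>k. k \<ge> n1 \<Longrightarrow> S k \<inter> span G = S n1 \<inter> span G" by blast
    \<comment> \<open>whether \<open>S n\<close> contains an element with leading coefficient 1 at \<open>g\<close>\<close>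
    define good where "good n \<longleftrightarrow> (\<exists>h\<in>span G. g + h \<in> S n)" for n
    obtain n2 where n2: "\<And>k. good k \<Longrightarrow> good n2"
      by (metis (full_types))
    define n where "n = max n1 n2"
    have incn: "S n1 \<subseteq> S n" "S n2 \<subseteq> S n" using inc unfolding n_def incseq_def by (meson max.cobounded1 max.cobounded2)+
    have "S k \<subseteq> S n" if "k \<ge> n" for k
    proof
      fix y assume y: "y \<in> S k"
      then have "y \<in> span (insert g G)" using S by auto
      then obtain c where c: "y - scale c g \<in> span G" using span_breakdown_eq by auto
      show "y \<in> S n"
      proof (cases "c = 0")
        case True
        then have "y \<in> S k \<inter> span G" using c y by simp
        then have "y \<in> S n1" using n1[of k] that n_def by auto
        then show ?thesis using incn by blast
      next
        case False
        define h where "h = y - scale c g"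
        have "scale (1/c) y = g + scale (1/c) h"
          unfolding h_def using False by (simp add: scale_right_diff_distrib)
        moreover have "scale (1/c) y \<in> S k" using y sub subspace_scale by blast
        ultimately have "good k" unfolding good_def using c h_def span_scale by metis
        then have "good n2" using n2 by blast
        then obtain h' where h': "h' \<in> span G" "g + h' \<in> S n2" unfolding good_def by blast
        have gn: "g + h' \<in> S n" using h' incn by blast
        then have gk: "g + h' \<in> S k" using inc that by (auto simp: incseq_def)
        define z where "z = y - scale c (g + h')"
        have "z = h - scale c h'" unfolding z_def h_def by (simp add: scale_right_distrib)
        then have "z \<in> span G" using c h' h_def span_diff span_scale by metis
        moreover have "z \<in> S k" unfolding z_def using y gk sub subspace_diff subspace_scale by metis
        ultimately have "z \<in> S n1" using n1[of k] that n_def by auto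
        then have "z \<in> S n" using incn by blast
        then have "z + scale c (g + h') \<in> S n" using gn sub subspace_add subspace_scale by metis
        then show ?thesis unfolding z_def by simp
      qed
    qed
    moreover have "S n \<subseteq> S k" if "k \<ge> n" for k using inc that by (simp add: incseq_def)
    ultimately show "\<exists>n. \<forall>k\<ge>n. S k = S n" by blast
  qed
qed

text \<open>
  The step of Hilbert's basis theorem.  The new operator \<open>T\<close> plays the role of the indeterminate:
  every element is a sum of terms \<open>T\<^sup>i m\<^sub>i\<close> with \<open>m\<^sub>i\<close> in the old module \<open>M\<close>, and a submodule is
  determined, among those containing it, by its sets \<open>L n S\<close> of leading coefficients in each degree.
  Commutation up to a nonzero scalar suffices to make these sets submodules of \<open>M\<close>.
\<close>

lemma acc_on_add_operator:
  assumes linT: "Vector_Spaces.linear scale scale T"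
    and linTs: "\<And>T'. T' \<in> Ts \<Longrightarrow> Vector_Spaces.linear scale scale T'"
    and skew: "\<And>T'. T' \<in> Ts \<Longrightarrow> \<exists>\<epsilon>. \<epsilon> \<noteq> 0 \<and> (\<forall>x. T' (T x) = scale \<epsilon> (T (T' x)))"
    and acc: "acc_on Ts (op_stable Ts hull G)"
  shows "acc_on (insert T Ts) (op_stable (insert T Ts) hull G)"
proof -
  define M where "M = op_stable Ts hull G"
  have stM: "op_stable Ts M" unfolding M_def by (rule op_stable_hull)
  note sM = op_stableD(1)[OF stM]
  define U where "U n = {\<Sum>i<n. (T ^^ i) (m i) |m. \<forall>i. m i \<in> M}" for n :: nat
  have linpow: "Vector_Spaces.linear scale scale (T ^^ i)" for i
  proof (induction i)
    case 0 show ?case using linear_id by (simp add: id_def)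
  next
    case (Suc i) then show ?case using Vector_Spaces.linear_compose[OF Suc linT] by (simp add: comp_def)
  qed
  have skewpow: "\<exists>\<epsilon>. \<epsilon> \<noteq> 0 \<and> (\<forall>x. T' ((T ^^ i) x) = scale \<epsilon> ((T ^^ i) (T' x)))" if T': "T' \<in> Ts" for T' i
  proof (induction i)
    case 0 show ?case by (auto intro: exI[of _ 1])
  next
    case (Suc i)
    then obtain \<epsilon> where e0: "\<epsilon> \<noteq> 0" and e: "\<And>x. T' ((T ^^ i) x) = scale \<epsilon> ((T ^^ i) (T' x))" by blast
    obtain \<delta> where d0: "\<delta> \<noteq> 0" and d: "\<And>x. T' (T x) = scale \<delta> (T (T' x))" using skew[OF T'] by blast
    have "T' ((T ^^ Suc i) x) = scale (\<delta> * \<epsilon>) ((T ^^ Suc i) (T' x))" for x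
      using e[of x] d[of "(T ^^ i) x"] by (simp add: linear_map_scale[OF linT])
    then show ?case using e0 d0 by (intro exI[of _ "\<delta> * \<epsilon>"]) simp
  qed
  have UI: "(\<And>i. m i \<in> M) \<Longrightarrow> (\<Sum>i<n. (T ^^ i) (m i)) \<in> U n" for m n unfolding U_def by blast
  have subU: "subspace (U n)" for n
  proof (rule subspaceI)
    show "0 \<in> U n" using UI[of "\<lambda>_. 0" n] subspace_0[OF sM] linear_map_zero[OF linpow] by simp
  next
    fix x y assume "x \<in> U n" "y \<in> U n"
    then obtain m m' where "\<forall>i. m i \<in> M" "x = (\<Sum>i<n. (T ^^ i) (m i))"
      "\<forall>i. m' i \<in> M" "y = (\<Sum>i<n. (T ^^ i) (m' i))" unfolding U_def by blast
    then show "x + y \<in> U n"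
      using UI[of "\<lambda>i. m i + m' i" n] subspace_add[OF sM]
      by (simp add: linear_map_add[OF linpow] sum.distrib)
  next
    fix c x assume "x \<in> U n"
    then obtain m where "\<forall>i. m i \<in> M" "x = (\<Sum>i<n. (T ^^ i) (m i))" unfolding U_def by blast
    then show "scale c x \<in> U n"
      using UI[of "\<lambda>i. scale c (m i)" n] subspace_scale[OF sM]
      by (simp add: linear_map_scale[OF linpow] scale_sum_right)
  qed
  have stU: "T' x \<in> U n" if T': "T' \<in> Ts" and x: "x \<in> U n" for T' x n
  proof -
    obtain m where m: "\<forall>i. m i \<in> M" "x = (\<Sum>i<n. (T ^^ i) (m i))" using x unfolding U_def by blast
    obtain \<epsilon> where e: "\<And>i x. T' ((T ^^ i) x) = scale (\<epsilon> i) ((T ^^ i) (T' x))"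
      using skewpow[OF T'] by metis
    have "T' x = (\<Sum>i<n. (T ^^ i) (scale (\<epsilon> i) (T' (m i))))"
      using m by (simp add: linear_map_sum[OF linTs[OF T']] e linear_map_scale[OF linpow])
    moreover have "scale (\<epsilon> i) (T' (m i)) \<in> M" for i
      using m stM T' op_stableD subspace_scale[OF sM] by metis
    ultimately show ?thesis using UI by metis
  qed
  have USuc: "U (Suc n) = {u + (T ^^ n) m |u m. u \<in> U n \<and> m \<in> M}" for n
  proof safe
    fix x assume "x \<in> U (Suc n)"
    then obtain m where "\<forall>i. m i \<in> M" "x = (\<Sum>i<Suc n. (T ^^ i) (m i))" unfolding U_def by blast
    then have "x = (\<Sum>i<n. (T ^^ i) (m i)) + (T ^^ n) (m n)" "(\<Sum>i<n. (T ^^ i) (m i)) \<in> U n" "m n \<in> M"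
      using UI by simp_all
    then show "\<exists>u ma. x = u + (T ^^ n) ma \<and> u \<in> U n \<and> ma \<in> M" by blast
  next
    fix u m assume "u \<in> U n" "m \<in> M"
    then obtain m' where m': "\<forall>i. m' i \<in> M" "u = (\<Sum>i<n. (T ^^ i) (m' i))" unfolding U_def by blast
    then show "u + (T ^^ n) m \<in> U (Suc n)"
      using UI[of "m'(n := m)" "Suc n"] \<open>m \<in> M\<close> by simp
  qed
  have Uinc: "U n \<subseteq> U (Suc n)" for n
    using USuc[of n] subspace_0[OF sM] linear_map_zero[OF linpow] by (smt (verit) add.right_neutral mem_Collect_eq subsetI)
  have Uinc': "n \<le> k \<Longrightarrow> U n \<subseteq> U k" for n k using Uinc by (rule lift_Suc_mono_le)
  have TU: "T x \<in> U (Suc n)" if "x \<in> U n" for x n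
    using that
  proof (induction n arbitrary: x)
    case 0 then have "x = 0" by (simp add: U_def)
    then show ?case using linear_map_zero[OF linT] subspace_0[OF subU] by simp
  next
    case (Suc n)
    then obtain u m where "x = u + (T ^^ n) m" "u \<in> U n" "m \<in> M" using USuc by blast
    then show ?case using Suc.IH USuc[of "Suc n"] by (auto simp: linear_map_add[OF linT])
  qed
  have "op_stable (insert T Ts) (\<Union>n. U n)"
    unfolding op_stable_def
  proof safe
    show "subspace (\<Union>n. U n)"
    proof (rule subspaceI)
      show "0 \<in> (\<Union>n. U n)" using subspace_0[OF subU] by blast
      fix x y assume "x \<in> (\<Union>n. U n)" "y \<in> (\<Union>n. U n)"
      then obtain n k where "x \<in> U n" "y \<in> U k" by blast
      then have "x \<in> U (max n k)" "y \<in> U (max n k)" using Uinc' by (meson max.cobounded1 max.cobounded2 subsetD)+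
      then show "x + y \<in> (\<Union>n. U n)" using subspace_add[OF subU] by blast
    next
      fix c x assume "x \<in> (\<Union>n. U n)" then show "scale c x \<in> (\<Union>n. U n)" using subspace_scale[OF subU] by blast
    qed
    show "T x \<in> (\<Union>n. U n)" if "x \<in> U n" for x n using TU that by blast
    show "T' x \<in> (\<Union>n. U n)" if "x \<in> U n" "T' \<in> Ts" for x n T' using stU that by blast
  qed
  moreover have "G \<subseteq> (\<Union>n. U n)"
  proof
    fix g assume "g \<in> G"
    then have "g \<in> M" unfolding M_def by (simp add: hull_inc)
    then show "g \<in> (\<Union>n. U n)" using UI[of "\<lambda>_. g" 1] by auto
  qed
  ultimately have cover: "op_stable (insert T Ts) hull G \<subseteq> (\<Union>n. U n)" by (intro hull_minimal)
  define L where "L n S = {m \<in> M. \<exists>u\<in>U n. u + (T ^^ n) m \<in> S}" for n S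
  have LM: "L n S \<subseteq> M" for n S unfolding L_def by blast
  have stL: "op_stable Ts (L n S)" if S: "op_stable (insert T Ts) S" for n S
    unfolding op_stable_def
  proof safe
    note sS = op_stableD(1)[OF S]
    show "subspace (L n S)"
    proof (rule subspaceI)
      show "0 \<in> L n S" unfolding L_def using subspace_0[OF sM] subspace_0[OF sS] subspace_0[OF subU] linear_map_zero[OF linpow]
        by force
    next
      fix x y assume "x \<in> L n S" "y \<in> L n S"
      then obtain u v where "x \<in> M" "u \<in> U n" "u + (T ^^ n) x \<in> S" "y \<in> M" "v \<in> U n" "v + (T ^^ n) y \<in> S"
        unfolding L_def by blast
      moreover have "(u + v) + (T ^^ n) (x + y) = (u + (T ^^ n) x) + (v + (T ^^ n) y)"
        by (simp add: linear_map_add[OF linpow])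
      ultimately show "x + y \<in> L n S" unfolding L_def
        using subspace_add[OF sS] subspace_add[OF sM] subspace_add[OF subU] by (smt (verit) mem_Collect_eq)
    next
      fix c x assume "x \<in> L n S"
      then obtain u where "x \<in> M" "u \<in> U n" "u + (T ^^ n) x \<in> S" unfolding L_def by blast
      moreover have "scale c u + (T ^^ n) (scale c x) = scale c (u + (T ^^ n) x)"
        by (simp add: linear_map_scale[OF linpow] scale_right_distrib)
      ultimately show "scale c x \<in> L n S" unfolding L_def
        using subspace_scale[OF sS] subspace_scale[OF sM] subspace_scale[OF subU] by (smt (verit) mem_Collect_eq)
    qed
    fix T' x assume T': "T' \<in> Ts" and "x \<in> L n S"
    then obtain u where x: "x \<in> M" "u \<in> U n" "u + (T ^^ n) x \<in> S" unfolding L_def by blast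
    obtain \<epsilon> where e0: "\<epsilon> \<noteq> 0" and e: "\<And>x. T' ((T ^^ n) x) = scale \<epsilon> ((T ^^ n) (T' x))"
      using skewpow[OF T'] by metis
    have "T' (u + (T ^^ n) x) \<in> S" using S T' x op_stableD by blast
    then have "T' u + scale \<epsilon> ((T ^^ n) (T' x)) \<in> S" by (simp add: linear_map_add[OF linTs[OF T']] e)
    then have "scale (1/\<epsilon>) (T' u + scale \<epsilon> ((T ^^ n) (T' x))) \<in> S" using subspace_scale[OF sS] by blast
    then have "scale (1/\<epsilon>) (T' u) + (T ^^ n) (T' x) \<in> S" using e0 by (simp add: scale_right_distrib)
    moreover have "scale (1/\<epsilon>) (T' u) \<in> U n" using stU[OF T' x(2)] subspace_scale[OF subU] by blast
    moreover have "T' x \<in> M" using stM T' x op_stableD by blast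
    ultimately show "T' x \<in> L n S" unfolding L_def by blast
  qed
  have Lmono: "L n S \<subseteq> L n S'" if "S \<subseteq> S'" for n S S' using that unfolding L_def by blast
  have Linc: "L n S \<subseteq> L (Suc n) S" if S: "op_stable (insert T Ts) S" for n S
  proof
    fix m assume "m \<in> L n S"
    then obtain u where u: "m \<in> M" "u \<in> U n" "u + (T ^^ n) m \<in> S" unfolding L_def by blast
    then have "T (u + (T ^^ n) m) \<in> S" using S op_stableD by blast
    then have "T u + (T ^^ Suc n) m \<in> S" by (simp add: linear_map_add[OF linT])
    then show "m \<in> L (Suc n) S" using u TU unfolding L_def by blast
  qed
  have Lcompare: "S' \<inter> U n \<subseteq> S"
    if "op_stable (insert T Ts) S" "op_stable (insert T Ts) S'" "S \<subseteq> S'" "\<And>n. L n S' \<subseteq> L n S" for S S' n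
  proof (induction n)
    case 0 show ?case using subspace_0[OF op_stableD(1)[OF that(1)]] by (auto simp: U_def)
  next
    case (Suc n)
    note s = subspace_diff[OF op_stableD(1)[OF that(2)]] subspace_diff[OF subU]
      subspace_add[OF op_stableD(1)[OF that(1)]]
    show ?case
    proof safe
      fix x assume "x \<in> S'" "x \<in> U (Suc n)"
      then obtain u m where x: "x = u + (T ^^ n) m" "u \<in> U n" "m \<in> M" using USuc by blast
      then have "m \<in> L n S'" using \<open>x \<in> S'\<close> unfolding L_def by blast
      then have "m \<in> L n S" using that by blast
      then obtain v where v: "v \<in> U n" "v + (T ^^ n) m \<in> S" unfolding L_def by blast
      have "u - v = x - (v + (T ^^ n) m)" using x by simp
      then have "u - v \<in> S' \<inter> U n" using s x v that \<open>x \<in> S'\<close> by (metis IntI subsetD)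
      then have "u - v \<in> S" using Suc by blast
      then have "(u - v) + (v + (T ^^ n) m) \<in> S" using s v by blast
      then show "x \<in> S" using x by simp
    qed
  qed
  show ?thesis
    unfolding acc_on_def
  proof safe
    fix S :: "nat \<Rightarrow> 'b set"
    assume S: "\<forall>n. op_stable (insert T Ts) (S n) \<and> S n \<subseteq> op_stable (insert T Ts) hull G" and inc: "incseq S"
    have accM: "\<exists>n. \<forall>k\<ge>n. F k = F n"
      if "\<And>n. op_stable Ts (F n)" "\<And>n. F n \<subseteq> M" "incseq F" for F :: "nat \<Rightarrow> 'b set"
      using acc that unfolding acc_on_def M_def by blast
    have Lall: "L n (S j) \<subseteq> L n' (S j')" if "n \<le> n'" "j \<le> j'" for n n' j j'
    proof -
      have "L n (S j) \<subseteq> L n' (S j)"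
        using lift_Suc_mono_le[of "\<lambda>n. L n (S j)", OF _ that(1)] Linc S by blast
      also have "\<dots> \<subseteq> L n' (S j')" using Lmono inc that by (simp add: incseq_def)
      finally show ?thesis .
    qed
    \<comment> \<open>the diagonal settles all large degrees at once, leaving finitely many small degrees\<close>
    have "\<exists>n. \<forall>k\<ge>n. L k (S k) = L n (S n)"
      by (rule accM[of "\<lambda>n. L n (S n)"]) (use stL S LM Lall in \<open>auto simp: incseq_def\<close>)
    then obtain d where d: "\<And>k. k \<ge> d \<Longrightarrow> L k (S k) = L d (S d)" by blast
    have "\<exists>j. \<forall>k\<ge>j. L n (S k) = L n (S j)" for n
      by (rule accM[of "\<lambda>j. L n (S j)"]) (use stL S LM Lall in \<open>auto simp: incseq_def\<close>)
    then obtain j where j: "\<And>n k. k \<ge> j n \<Longrightarrow> L n (S k) = L n (S (j n))" by metis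
    define N where "N = Max (insert d (j ` {..<d}))"
    have N: "N \<ge> d" "\<And>n. n < d \<Longrightarrow> N \<ge> j n" unfolding N_def by auto
    have "S k = S N" if "k \<ge> N" for k
    proof -
      have "L n (S k) \<subseteq> L n (S N)" for n
      proof (cases "n < d")
        case True
        then have "L n (S k) = L n (S (j n))" "L n (S N) = L n (S (j n))"
          by (rule_tac j; use N that True in fastforce)+
        then show ?thesis by simp
      next
        case False
        have "L n (S k) \<subseteq> L (max n k) (S (max n k))" by (rule Lall) auto
        also have "\<dots> = L d (S d)" by (rule d) (use False in simp)
        also have "\<dots> \<subseteq> L n (S N)" by (rule Lall) (use False N in auto)
        finally show ?thesis .
      qed
      moreover have "S N \<subseteq> S k" using inc that by (simp add: incseq_def)
      ultimately have "S k \<inter> U n \<subseteq> S N" for n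
        by (intro Lcompare) (use S in auto)
      moreover have "S k \<subseteq> (\<Union>n. U n)" using S cover by blast
      ultimately have "S k \<subseteq> S N" by blast
      then show ?thesis using \<open>S N \<subseteq> S k\<close> by simp
    qed
    then show "\<exists>n. \<forall>k\<ge>n. S k = S n" by blast
  qed
qed

text \<open>
  Hilbert's basis theorem without polynomial rings.  The operators will be multiplications by the
  generators of a superalgebra, which commute only up to sign.
\<close>

theorem acc_on_skew_operators:
  assumes "finite Ts" and "finite G"
    and "\<And>T. T \<in> Ts \<Longrightarrow> Vector_Spaces.linear scale scale T"
    and "\<And>T T'. T \<in> Ts \<Longrightarrow> T' \<in> Ts \<Longrightarrow> \<exists>\<epsilon>. \<epsilon> \<noteq> 0 \<and> (\<forall>x. T' (T x) = scale \<epsilon> (T (T' x)))"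
  shows "acc_on Ts (op_stable Ts hull G)"
  using assms(1,3,4)
proof (induction Ts)
  case empty
  have "op_stable {} hull G = span G" by (simp add: op_stable_def[abs_def] span_def)
  then show ?case using acc_on_span_finite[OF assms(2)] by simp
next
  case (insert T Ts)
  show ?case by (rule acc_on_add_operator) (use insert in auto)
qed

lemma acc_on_maximal:
  assumes acc: "acc_on Ts M" and S0: "op_stable Ts S0" "S0 \<subseteq> M" "P S0"
  obtains S where "op_stable Ts S" "S0 \<subseteq> S" "S \<subseteq> M" "P S"
    "\<And>S'. op_stable Ts S' \<Longrightarrow> S \<subseteq> S' \<Longrightarrow> S' \<subseteq> M \<Longrightarrow> P S' \<Longrightarrow> S' = S"
proof (rule ccontr)
  assume no: "\<not> thesis"
  note maximal = that
  define Q where "Q S \<longleftrightarrow> op_stable Ts S \<and> S0 \<subseteq> S \<and> S \<subseteq> M \<and> P S" for S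
  have "\<exists>S'. Q S' \<and> S \<subset> S'" if "Q S" for S
  proof (rule ccontr)
    assume stop: "\<not> (\<exists>S'. Q S' \<and> S \<subset> S')"
    show False
    proof (rule no[THEN notE], rule maximal[of S])
      fix S' assume S': "op_stable Ts S'" "S \<subseteq> S'" "S' \<subseteq> M" "P S'"
      then have "Q S'" using \<open>Q S\<close> unfolding Q_def by blast
      then show "S' = S" using stop S'(2) by blast
    qed (use \<open>Q S\<close> in \<open>auto simp: Q_def\<close>)
  qed
  then obtain f where f: "\<And>S. Q S \<Longrightarrow> Q (f S) \<and> S \<subset> f S" by metis
  define F where "F n = (f ^^ n) S0" for n
  have "Q S0" using S0 by (simp add: Q_def)
  then have Q: "Q (F n)" for n by (induction n) (simp_all add: F_def f)
  then have str: "F n \<subset> F (Suc n)" for n using f[OF Q, of n] by (simp add: F_def)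
  then have "incseq F" by (intro incseq_SucI) blast
  then obtain n where "\<forall>k\<ge>n. F k = F n" using acc Q unfolding acc_on_def Q_def by blast
  then show False using str[of n] by (metis le_Suc_eq order_refl psubsetE)
qed

lemma acc_on_finite_subset:
  assumes acc: "acc_on Ts M" and M: "op_stable Ts M" and Z: "Z \<subseteq> M"
  obtains Y where "finite Y" "Y \<subseteq> Z" "Z \<subseteq> op_stable Ts hull Y"
proof -
  define P where "P S \<longleftrightarrow> (\<exists>Y. finite Y \<and> Y \<subseteq> Z \<and> S = op_stable Ts hull Y)" for S
  have hM: "op_stable Ts hull Y \<subseteq> M" if "Y \<subseteq> Z" for Y using that Z M by (intro hull_minimal) auto
  obtain S where S: "P S" "\<And>S'. op_stable Ts S' \<Longrightarrow> S \<subseteq> S' \<Longrightarrow> S' \<subseteq> M \<Longrightarrow> P S' \<Longrightarrow> S' = S"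
    by (rule acc_on_maximal[OF acc, of "op_stable Ts hull {}" P])
      (use hM op_stable_hull in \<open>auto simp: P_def\<close>)
  then obtain Y where Y: "finite Y" "Y \<subseteq> Z" "S = op_stable Ts hull Y" unfolding P_def by blast
  have "x \<in> S" if "x \<in> Z" for x
  proof -
    have "op_stable Ts hull (insert x Y) = S"
    proof (rule S(2))
      show "op_stable Ts (op_stable Ts hull insert x Y)" by (rule op_stable_hull)
      show "S \<subseteq> op_stable Ts hull insert x Y" unfolding Y by (rule hull_mono) blast
      show "op_stable Ts hull insert x Y \<subseteq> M" using hM Y(2) that by simp
      show "P (op_stable Ts hull insert x Y)" unfolding P_def using Y that by (metis finite_insert insert_subset)
    qed
    then show ?thesis using hull_inc[of x "insert x Y"] by auto
  qed
  then show thesis using that Y by blast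
qed

end

section \<open>Parity and the twist automorphism\<close>

text \<open>
  A statement about families of subgroups, so that it serves both for the grading of the algebra
  and for the grading of its derivations.
\<close>

lemma component_eqI:
  assumes diff: "\<And>i x y. x \<in> G i \<Longrightarrow> y \<in> G i \<Longrightarrow> x - y \<in> G i"
    and direct: "G 0 \<inter> G 1 = {0}"
    and x: "x \<in> G i" and y: "y \<in> G (i + 1)"
  shows "component G i (x + y) = x"
  unfolding component_def
proof (rule the_equality)
  show "x \<in> G i \<and> x + y - x \<in> G (i + 1)" using x y by simp
  fix z assume z: "z \<in> G i \<and> x + y - z \<in> G (i + 1)"
  then have "x - z \<in> G i" using diff x by blast
  moreover have "(x + y - z) - y \<in> G (i + 1)" using diff z y by blast
  then have "x - z \<in> G (i + 1)" by simp
  ultimately have "x - z \<in> G 0 \<inter> G 1" by (cases i) auto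
  then show "z = x" using direct by simp
qed

locale char0_superalgebra = superalgebra scale gr
  for scale :: "'k::field_char_0 \<Rightarrow> 'a::ring_1 \<Rightarrow> 'a" and gr :: "bit \<Rightarrow> 'a set"
begin

lemma gr_add: "x \<in> gr i \<Longrightarrow> y \<in> gr i \<Longrightarrow> x + y \<in> gr i"
  and gr_diff: "x \<in> gr i \<Longrightarrow> y \<in> gr i \<Longrightarrow> x - y \<in> gr i"
  and gr_minus: "x \<in> gr i \<Longrightarrow> - x \<in> gr i"
  and gr_zero: "0 \<in> gr i"
  and gr_scale: "x \<in> gr i \<Longrightarrow> scale c x \<in> gr i"
  by (rule subspace_add[OF subspace_gr] subspace_diff[OF subspace_gr] subspace_neg[OF subspace_gr]
      subspace_0[OF subspace_gr] subspace_scale[OF subspace_gr]; assumption)+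

lemma gr_sum_mem: "(\<And>x. x \<in> A \<Longrightarrow> f x \<in> gr i) \<Longrightarrow> sum f A \<in> gr i"
  by (rule subspace_sum[OF subspace_gr])

definition part_of :: "bit \<Rightarrow> 'a \<Rightarrow> 'a" where
  "part_of i a = component gr i a"

text \<open>
  For \<open>i = 1\<close> this is the parity automorphism \<open>a\<^sub>0 + a\<^sub>1 \<mapsto> a\<^sub>0 - a\<^sub>1\<close>.  Indexing it by a parity turns
  the sign rule into an identity for all elements: \<open>x * a = twist i a * x\<close> for \<open>x\<close> of
  parity \<open>i\<close>, homogeneous \<open>a\<close> or not.
\<close>

definition twist :: "bit \<Rightarrow> 'a \<Rightarrow> 'a" where
  "twist i a = (if i = 0 then a else part_of 0 a - part_of 1 a)"

lemma part_of_add_eq: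
  assumes "x \<in> gr 0" "y \<in> gr 1"
  shows "part_of 0 (x + y) = x" and "part_of 1 (x + y) = y"
  using component_eqI[of gr x 0 y] component_eqI[of gr y 1 x] assms gr_diff gr_direct
  by (auto simp: part_of_def add.commute)

lemma obtain_parts:
  obtains x y where "x \<in> gr 0" "y \<in> gr 1" "a = x + y"
proof -
  have "a \<in> graded_sum gr" using gr_sum by simp
  then show thesis using that unfolding graded_sum_def by blast
qed

lemma part_of_homogeneous: "a \<in> gr i \<Longrightarrow> part_of j a = (if j = i then a else 0)"
  using part_of_add_eq[of a 0] part_of_add_eq[of 0 a] gr_zero[of 0] gr_zero[of 1]
  by (cases i; cases j) auto

lemma twist_0 [simp]: "twist 0 a = a"
  by (simp add: twist_def)

lemma twist_homogeneous: "a \<in> gr j \<Longrightarrow> twist i a = koszul (i * j) * a"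
  by (cases i; cases j) (auto simp: twist_def part_of_homogeneous koszul_def)

lemma twist_parts: "x \<in> gr 0 \<Longrightarrow> y \<in> gr 1 \<Longrightarrow> twist 1 (x + y) = x - y"
  by (simp add: twist_def part_of_add_eq)

lemma twist_add: "twist i (a + b) = twist i a + twist i b"
proof -
  obtain x y where a: "x \<in> gr 0" "y \<in> gr 1" "a = x + y" by (rule obtain_parts)
  obtain u v where b: "u \<in> gr 0" "v \<in> gr 1" "b = u + v" by (rule obtain_parts)
  have "a + b = (x + u) + (y + v)" using a b by simp
  then have "twist 1 (a + b) = (x + u) - (y + v)" using twist_parts gr_add a b by metis
  then show ?thesis using a b by (cases i) (auto simp: twist_parts)
qed

lemma twist_scale: "twist i (scale c a) = scale c (twist i a)"
proof -
  obtain x y where a: "x \<in> gr 0" "y \<in> gr 1" "a = x + y" by (rule obtain_parts)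
  have "twist 1 (scale c a) = scale c x - scale c y"
    using a twist_parts gr_scale by (metis scale_right_distrib)
  then show ?thesis using a by (cases i) (auto simp: twist_parts scale_right_diff_distrib)
qed

lemma twist_mult: "twist i (a * b) = twist i a * twist i b"
proof -
  obtain x y where a: "x \<in> gr 0" "y \<in> gr 1" "a = x + y" by (rule obtain_parts)
  obtain u v where b: "u \<in> gr 0" "v \<in> gr 1" "b = u + v" by (rule obtain_parts)
  have "a * b = (x * u + y * v) + (x * v + y * u)" using a b by (simp add: algebra_simps)
  moreover have "x * u + y * v \<in> gr 0" "x * v + y * u \<in> gr 1"
    using mult_gr[of x 0 u 0] mult_gr[of y 1 v 1] mult_gr[of x 0 v 1] mult_gr[of y 1 u 0] a b gr_add by auto
  ultimately have "twist 1 (a * b) = (x * u + y * v) - (x * v + y * u)" using twist_parts by metis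
  then show ?thesis using a b by (cases i) (auto simp: twist_parts algebra_simps)
qed

lemma twist_zero [simp]: "twist i 0 = 0"
  using twist_homogeneous[OF gr_zero] by simp

lemma twist_one [simp]: "twist i 1 = 1"
  using twist_homogeneous[OF one_gr, of i] by (simp add: koszul_def)

lemma twist_minus: "twist i (- a) = - twist i a"
  using twist_add[of i a "- a"] by (simp add: eq_neg_iff_add_eq_0 add.commute)

lemma twist_diff: "twist i (a - b) = twist i a - twist i b"
  using twist_add[of i a "- b"] by (simp add: twist_minus)

lemma twist_sum: "twist i (sum f A) = (\<Sum>x\<in>A. twist i (f x))"
  by (induction A rule: infinite_finite_induct) (auto simp: twist_add)

lemma twist_twist: "twist i (twist i a) = a"
proof -
  obtain x y where a: "x \<in> gr 0" "y \<in> gr 1" "a = x + y" by (rule obtain_parts)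
  have "twist 1 (x - y) = x + y" using twist_parts[of x "- y"] a gr_minus by simp
  then show ?thesis using a by (cases i) (auto simp: twist_parts)
qed

lemma koszul_scale: "scale (koszul i) a = koszul i * a"
  by (simp add: koszul_def)

lemma koszul_square: "koszul i * (koszul i * a) = a" for a :: 'a
  by (simp add: koszul_def)

lemma twist_koszul: "twist i (koszul j * a) = koszul j * twist i a"
  by (simp add: koszul_def twist_minus)

lemma double_eq_zero: "a + a = 0 \<Longrightarrow> a = (0::'a)"
proof -
  assume "a + a = 0"
  then have "scale (2::'k) a = 0"
    using scale_left_distrib[of 1 1 a] by (simp only: one_add_one scale_one)
  then show "a = 0" by simp
qed

lemma of_nat_mult_scale: "of_nat n * a = scale (of_nat n) a"
  by (induction n) (auto simp: algebra_simps scale_left_distrib)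

lemma of_nat_mult_cancel: "of_nat (Suc n) * a = (0::'a) \<Longrightarrow> a = 0"
  using of_nat_mult_scale[of "Suc n" a] by (simp del: of_nat_Suc)

lemma gr_twistI:
  assumes "twist 1 a = koszul i * a"
  shows "a \<in> gr i"
proof -
  obtain x y where a: "x \<in> gr 0" "y \<in> gr 1" "a = x + y" by (rule obtain_parts)
  have "x - y = koszul i * (x + y)" using assms twist_parts[OF a(1,2)] a(3) by simp
  show ?thesis
  proof (cases i)
    case zero
    have "x - y = x + y" using \<open>x - y = _\<close> zero by (simp add: koszul_def)
    moreover have "y + y = (x + y) - (x - y)" by simp
    ultimately have "y + y = 0" by (simp only: diff_self)
    then have "y = 0" by (rule double_eq_zero)
    then show ?thesis using a zero by simp
  next
    case one
    have "x - y = - (x + y)" using \<open>x - y = _\<close> one by (simp add: koszul_def)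
    moreover have "x + x = (x - y) - (- (x + y))" by simp
    ultimately have "x + x = 0" by (simp only: diff_self)
    then have "x = 0" by (rule double_eq_zero)
    then show ?thesis using a one by simp
  qed
qed

lemma commute_left: "x \<in> gr i \<Longrightarrow> x * a = twist i a * x"
proof -
  assume x: "x \<in> gr i"
  obtain u v where a: "u \<in> gr 0" "v \<in> gr 1" "a = u + v" by (rule obtain_parts)
  have "x * u = u * x" "x * v = koszul i * (v * x)"
    using supercommutative[OF x a(1)] supercommutative[OF x a(2)] by (auto simp: koszul_def)
  then show ?thesis using a by (cases i) (auto simp: twist_parts koszul_def algebra_simps)
qed

lemma commute_right: "x \<in> gr i \<Longrightarrow> a * x = x * twist i a"
  using commute_left[of x i "twist i a"] by (simp add: twist_twist)

lemma even_central: "x \<in> gr 0 \<Longrightarrow> x * a = a * x"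
  using commute_left[of x 0 a] by simp

lemma odd_square: "x \<in> gr 1 \<Longrightarrow> x * x = 0"
proof -
  assume "x \<in> gr 1"
  then have "x * x = - (x * x)" using supercommutative[of x 1 x 1] by (simp add: koszul_def)
  then have "x * x + x * x = 0" by (metis add.right_inverse)
  then show "x * x = 0" by (rule double_eq_zero)
qed

end

text \<open>
  A family of homogeneous elements in which polynomials are written.  It is used twice: for the
  generators of the algebra and for a regular sequence at a point.
\<close>

locale letters = char0_superalgebra scale gr
  for scale :: "'k::field_char_0 \<Rightarrow> 'a::ring_1 \<Rightarrow> 'a" and gr :: "bit \<Rightarrow> 'a set" +
  fixes b :: "nat \<Rightarrow> 'a" and par :: "nat \<Rightarrow> bit"
  assumes b_gr: "b i \<in> gr (par i)"
begin

text \<open>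
  \<open>jet C m d y Y\<close> says that \<open>y\<close> is the value of some form of degree \<open>d\<close> in the first \<open>m\<close> letters, with
  coefficients from \<open>C\<close> written on the right, and that \<open>Y i\<close> is the value of the left partial
  derivative of that form by the \<open>i\<close>-th letter.  Recording values instead of the form itself avoids
  monomials and their signs: the only sign is \<open>twist (par i) (b j)\<close>, from moving the
  derivative past a letter.  Different forms may have the same value, so \<open>Y\<close> is not a function
  of \<open>y\<close>; how far it is determined by \<open>y\<close> is the content of quasi-regularity.
\<close>

inductive jet :: "'a set \<Rightarrow> nat \<Rightarrow> nat \<Rightarrow> 'a \<Rightarrow> (nat \<Rightarrow> 'a) \<Rightarrow> bool" for C m where
  jet_const: "c \<in> C \<Longrightarrow> jet C m 0 c (\<lambda>i. 0)"
| jet_zero: "jet C m d 0 (\<lambda>i. 0)"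
| jet_add: "jet C m d y Y \<Longrightarrow> jet C m d z Z \<Longrightarrow> jet C m d (y + z) (\<lambda>i. Y i + Z i)"
| jet_letter: "jet C m d y Y \<Longrightarrow> j < m \<Longrightarrow>
    jet C m (Suc d) (b j * y) (\<lambda>i. (if i = j then y else 0) + twist (par i) (b j) * Y i)"

lemma jet_mono: "jet C m d y Y \<Longrightarrow> C \<subseteq> C' \<Longrightarrow> m \<le> m' \<Longrightarrow> jet C' m' d y Y"
  by (induction rule: jet.induct) (auto intro: jet.intros)

lemma jet_cong:
  assumes "jet C m d y Y" "y = z" "\<And>i. Y i = Z i"
  shows "jet C m d z Z"
proof -
  have "Y = Z" using assms(3) by (rule ext)
  then show ?thesis using assms(1,2) by simp
qed

lemma jet_mult_right:
  assumes "jet C m d y Y" "\<And>c. c \<in> C \<Longrightarrow> c * a \<in> C"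
  shows "jet C m d (y * a) (\<lambda>i. Y i * a)"
  using assms(1)
proof (induction rule: jet.induct)
  case (jet_letter d y Y j)
  show ?case
    by (rule jet_cong[OF jet.jet_letter[OF jet_letter.IH jet_letter.hyps(2)]])
      (auto simp: distrib_right mult.assoc)
next
  case (jet_add d y Y z Z)
  show ?case by (rule jet_cong[OF jet.jet_add[OF jet_add.IH]]) (auto simp: distrib_right)
next
  case (jet_const c)
  show ?case by (rule jet_cong[OF jet.jet_const[OF assms(2)[OF jet_const]]]) auto
next
  case (jet_zero d)
  show ?case by (rule jet_cong[OF jet.jet_zero]) auto
qed

end

section \<open>Forms in homogeneous letters and their formal derivatives\<close>

context letters
begin

text \<open>
  The closure conditions that let jets be multiplied by scalars and twisted.  They hold for
  arbitrary coefficients and for scalar ones.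
\<close>

definition coeffs :: "'a set \<Rightarrow> bool" where
  "coeffs C \<longleftrightarrow> (\<forall>c\<in>C. twist 1 c \<in> C \<and> (\<forall>t. scale t c \<in> C))"

lemma coeffs_UNIV: "coeffs UNIV" by (simp add: coeffs_def)

lemma coeffs_scalars: "coeffs (range (\<lambda>c. scale c 1))"
  unfolding coeffs_def by (auto simp: twist_scale)

lemma jet_scale:
  assumes "coeffs C" "jet C m d y Y"
  shows "jet C m d (scale t y) (\<lambda>i. scale t (Y i))"
  using assms(2)
proof (induction rule: jet.induct)
  case (jet_const c)
  show ?case by (rule jet_cong[OF jet.jet_const[of "scale t c"]]) (use jet_const assms in \<open>auto simp: coeffs_def\<close>)
next
  case (jet_zero d)
  show ?case by (rule jet_cong[OF jet.jet_zero]) auto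
next
  case (jet_add d y Y z Z)
  show ?case by (rule jet_cong[OF jet.jet_add[OF jet_add.IH]]) (auto simp: scale_right_distrib)
next
  case (jet_letter d y Y j)
  show ?case
    by (rule jet_cong[OF jet.jet_letter[OF jet_letter.IH jet_letter.hyps(2)]])
      (auto simp: scale_right_distrib scale_mult_right)
qed

lemma jet_koszul:
  "coeffs C \<Longrightarrow> jet C m d y Y \<Longrightarrow> jet C m d (koszul i * y) (\<lambda>k. koszul i * Y k)"
  using jet_scale[of C m d y Y "koszul i"] by (simp add: koszul_scale)

lemma jet_diff:
  assumes "coeffs C" "jet C m d y Y" "jet C m d z Z"
  shows "jet C m d (y - z) (\<lambda>i. Y i - Z i)"
  by (rule jet_cong[OF jet_add[OF assms(2) jet_scale[OF assms(1,3), of "- 1"]]]) auto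

lemma twist_b: "twist i (b j) = koszul (i * par j) * b j"
  by (rule twist_homogeneous[OF b_gr])

lemma twist_b_commute: "twist (par i) (b j) * (b i * a) = b i * (b j * a)"
  using commute_left[OF b_gr, of i "b j"] by (metis mult.assoc)

lemma jet_twist:
  assumes "coeffs C" "jet C m d y Y"
  shows "jet C m d (twist e y) (\<lambda>i. koszul (e * par i) * twist e (Y i))"
  using assms(2)
proof (induction rule: jet.induct)
  case (jet_const c)
  have "twist e c \<in> C" using jet_const assms(1) by (cases e) (auto simp: coeffs_def)
  then show ?case by (intro jet_cong[OF jet.jet_const[of "twist e c"]]) auto
next
  case (jet_zero d)
  show ?case by (rule jet_cong[OF jet.jet_zero]) auto
next
  case (jet_add d y Y z Z)
  show ?case by (rule jet_cong[OF jet.jet_add[OF jet_add.IH]]) (auto simp: twist_add distrib_left)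
next
  case (jet_letter d y Y j)
  show ?case
    by (rule jet_cong[OF jet_koszul[OF assms(1) jet.jet_letter[OF jet_letter.IH jet_letter.hyps(2)], of "e * par j"]])
      (auto simp: twist_add twist_mult distrib_left twist_b twist_koszul mult.assoc koszul_def twist_minus)
qed

lemma jet_support: "jet C m d y Y \<Longrightarrow> i \<ge> m \<Longrightarrow> Y i = 0"
  by (induction rule: jet.induct) auto

lemma jet_euler: "jet C m d y Y \<Longrightarrow> (\<Sum>i<m. b i * Y i) = of_nat d * y"
proof (induction rule: jet.induct)
  case (jet_letter d y Y j)
  have "(\<Sum>i<m. b i * ((if i = j then y else 0) + twist (par i) (b j) * Y i)) =
    (\<Sum>i<m. if i = j then b j * y else 0) + (\<Sum>i<m. b j * (b i * Y i))"
    unfolding sum.distrib[symmetric]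
  proof (rule sum.cong[OF refl])
    fix i
    have "b i * (twist (par i) (b j) * Y i) = b j * (b i * Y i)"
      using commute_right[OF b_gr, of "b j" i] by (metis mult.assoc)
    then show "b i * ((if i = j then y else 0) + twist (par i) (b j) * Y i) =
         (if i = j then b j * y else 0) + b j * (b i * Y i)" by (auto simp: distrib_left)
  qed
  also have "\<dots> = b j * y + b j * (of_nat d * y)"
    using jet_letter by (simp add: sum_distrib_left[symmetric])
  finally show ?case by (simp add: algebra_simps of_nat_mult_scale scale_mult_right)
qed (auto simp: sum.distrib algebra_simps)

lemma jet_derivative:
  assumes "coeffs C" "jet C m (Suc d) y Y"
  shows "\<exists>Z. jet C m d (Y i) Z"
  using assms(2)
proof (induction "Suc d" y Y arbitrary: d rule: jet.induct)
  case (jet_letter d y Y j)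
  show ?case
  proof (cases d)
    case 0
    have Y: "Y i = 0" using \<open>jet C m d y Y\<close> 0
      by (induction d y Y rule: jet.induct) auto
    show ?thesis using jet_letter 0 Y by (auto intro: jet_zero)
  next
    case (Suc d')
    then obtain Z where "jet C m d' (Y i) Z" using jet_letter by blast
    then have "\<exists>Z. jet C m d (koszul (par i * par j) * (b j * Y i)) Z"
      using jet_koszul[OF assms(1)] jet.jet_letter[OF _ jet_letter(3)] Suc by blast
    moreover have "\<exists>Z. jet C m d (if i = j then y else 0) Z"
      using jet_letter(1) by (auto intro: jet_zero)
    ultimately show ?thesis using jet_add by (metis twist_b mult.assoc)
  qed
qed (auto intro: jet_zero jet_add)

text \<open>
  The \<open>d\<close>-th power of the ideal generated by the first \<open>m\<close> letters.
\<close>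

definition V :: "nat \<Rightarrow> nat \<Rightarrow> 'a set" where
  "V m d = {y. \<exists>Y. jet UNIV m d y Y}"

lemma VI: "jet UNIV m d y Y \<Longrightarrow> y \<in> V m d" unfolding V_def by blast

lemma V_zero: "0 \<in> V m d" by (rule VI[OF jet_zero])

lemma V_0 [simp]: "V m 0 = UNIV" unfolding V_def by (auto intro: jet_const)

lemma V_add: "x \<in> V m d \<Longrightarrow> y \<in> V m d \<Longrightarrow> x + y \<in> V m d"
  unfolding V_def by (auto intro: jet_add)

lemma V_scale: "x \<in> V m d \<Longrightarrow> scale t x \<in> V m d"
  unfolding V_def using jet_scale[OF coeffs_UNIV] by blast

lemma V_minus: "x \<in> V m d \<Longrightarrow> - x \<in> V m d"
  using V_scale[of x m d "-1"] by simp

lemma V_diff: "x \<in> V m d \<Longrightarrow> y \<in> V m d \<Longrightarrow> x - y \<in> V m d"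
  using V_add[of x m d "- y"] V_minus by simp

lemma V_mult_right: "x \<in> V m d \<Longrightarrow> x * a \<in> V m d"
  unfolding V_def using jet_mult_right[where C = UNIV] by blast

lemma V_twist: "x \<in> V m d \<Longrightarrow> twist e x \<in> V m d"
  unfolding V_def using jet_twist[OF coeffs_UNIV] by blast

lemma V_letter: "x \<in> V m d \<Longrightarrow> j < m \<Longrightarrow> b j * x \<in> V m (Suc d)"
  unfolding V_def by (auto intro: jet_letter)

lemma V_mono: "m \<le> m' \<Longrightarrow> V m d \<subseteq> V m' d"
  unfolding V_def using jet_mono[where C = UNIV and C' = UNIV] by blast

lemma V_mult:
  assumes "x \<in> V m d" "y \<in> V m e"
  shows "x * y \<in> V m (d + e)"
proof -
  obtain Z where "jet UNIV m d x Z" using assms(1) unfolding V_def by blast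
  then show ?thesis
  proof (induction rule: jet.induct)
    case (jet_const c)
    obtain Y where "jet UNIV m e y Y" using assms(2) unfolding V_def by blast
    then have "c * y \<in> V m e"
    proof (induction arbitrary: c rule: jet.induct)
      case (jet_letter d y Y j)
      have "c * (b j * y) = b j * (twist (par j) c * y)"
        using commute_right[OF b_gr] by (metis mult.assoc)
      then show ?case using V_letter jet_letter by metis
    qed (auto simp: V_zero distrib_left intro: V_add)
    then show ?case by simp
  qed (auto simp: V_zero distrib_right mult.assoc intro: V_add V_letter)
qed

lemma V_mult_left: "x \<in> V m d \<Longrightarrow> a * x \<in> V m d"
  using V_mult[of a m 0 x d] by simp

text \<open>
  A form of degree \<open>d + 1\<close> is a form of degree \<open>d\<close> whose coefficients lie in the ideal of the
  letters; then its derivatives lie one power higher than those of a general form of degree \<open>d\<close>.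
\<close>

lemma jet_lower:
  assumes "z \<in> V m (Suc d)"
  shows "\<exists>Z. jet UNIV m d z Z \<and> (\<forall>i. Z i \<in> V m d)"
proof -
  obtain Z where "jet UNIV m (Suc d) z Z" using assms unfolding V_def by blast
  then show ?thesis
  proof (induction "Suc d" z Z arbitrary: d rule: jet.induct)
    case jet_zero show ?case by (auto intro!: exI[of _ "\<lambda>_. 0"] jet.jet_zero V_zero)
  next
    case (jet_add y Y z Z) then show ?case using jet.jet_add V_add by meson
  next
    case (jet_letter d y Y j)
    show ?case
    proof (cases d)
      case 0 then show ?thesis by (auto intro!: exI[of _ "\<lambda>_. 0"] jet.jet_const)
    next
      case (Suc d')
      then obtain Z where Z: "jet UNIV m d' y Z" "\<And>i. Z i \<in> V m d'" using jet_letter by blast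
      have y: "y \<in> V m d" using jet_letter(1) by (rule VI)
      have "b j * Z i \<in> V m d" for i using Z(2) V_letter jet_letter(3) Suc by blast
      then have "twist (par i) (b j) * Z i \<in> V m d" for i
        using V_mult_left by (metis twist_b mult.assoc)
      then have "(if i = j then y else 0) + twist (par i) (b j) * Z i \<in> V m d" for i
        using y V_add V_zero by simp
      then show ?thesis using jet.jet_letter[OF Z(1) jet_letter(3)] Suc by blast
    qed
  qed
qed

lemma V_Suc_subset: "V m (Suc d) \<subseteq> V m d"
  using jet_lower VI by blast

lemma V_antimono: "d \<le> e \<Longrightarrow> V m e \<subseteq> V m d"
  using V_Suc_subset by (rule lift_Suc_antimono_le)

text \<open>
  Moving all occurrences of the last letter to the front.  If that letter is odd its square
  vanishes, so that the cofactor \<open>h\<close> can be chosen free of it.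
\<close>

lemma jet_split:
  assumes "jet UNIV (Suc m) d y Y"
  shows "\<exists>g G h H. jet UNIV m d g G \<and> jet UNIV (if par m = 0 then Suc m else m) (d - 1) h H \<and>
    (d = 0 \<longrightarrow> h = 0 \<and> (\<forall>i. H i = 0)) \<and> y = g + b m * h \<and>
    (\<forall>i. Y i = G i + ((if i = m then h else 0) + twist (par i) (b m) * H i))"
  using assms
proof (induction rule: jet.induct)
  case (jet_const c)
  then show ?case by (intro exI[of _ c] exI[of _ "\<lambda>_. 0"] exI[of _ 0]) (auto intro: jet.intros)
next
  case (jet_zero d)
  then show ?case by (intro exI[of _ "\<lambda>_. 0"] exI[of _ 0]) (auto intro: jet.intros)
next
  case (jet_add d y Y y' Y')
  obtain g G h H where 1: "jet UNIV m d g G" "jet UNIV (if par m = 0 then Suc m else m) (d - 1) h H"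
    "d = 0 \<Longrightarrow> h = 0 \<and> (\<forall>i. H i = 0)" "y = g + b m * h"
    "\<And>i. Y i = G i + ((if i = m then h else 0) + twist (par i) (b m) * H i)" using jet_add.IH(1) by blast
  obtain g' G' h' H' where 2: "jet UNIV m d g' G'" "jet UNIV (if par m = 0 then Suc m else m) (d - 1) h' H'"
    "d = 0 \<Longrightarrow> h' = 0 \<and> (\<forall>i. H' i = 0)" "y' = g' + b m * h'"
    "\<And>i. Y' i = G' i + ((if i = m then h' else 0) + twist (par i) (b m) * H' i)" using jet_add.IH(2) by blast
  show ?case
  proof (rule exI, rule exI, rule exI, rule exI, intro conjI)
    show "jet UNIV m d (g + g') (\<lambda>i. G i + G' i)" by (rule jet.jet_add[OF 1(1) 2(1)])
    show "jet UNIV (if par m = 0 then Suc m else m) (d - 1) (h + h') (\<lambda>i. H i + H' i)"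
      by (rule jet.jet_add[OF 1(2) 2(2)])
  qed (use 1(3,4,5) 2(3,4,5) in \<open>auto simp: distrib_left\<close>)
next
  case (jet_letter d y Y j)
  obtain g G h H where 1: "jet UNIV m d g G" "jet UNIV (if par m = 0 then Suc m else m) (d - 1) h H"
    "d = 0 \<Longrightarrow> h = 0 \<and> (\<forall>i. H i = 0)" "y = g + b m * h"
    "\<And>i. Y i = G i + ((if i = m then h else 0) + twist (par i) (b m) * H i)" using jet_letter.IH by blast
  show ?case
  proof (cases "j = m")
    case False
    then have jm: "j < m" using jet_letter by simp
    let ?e = "koszul (par m * par j)"
    let ?M = "if par m = 0 then Suc m else m"
    have h': "jet UNIV ?M d (?e * (b j * h)) (\<lambda>i. ?e * ((if i = j then h else 0) + twist (par i) (b j) * H i))"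
    proof (cases d)
      case 0
      then show ?thesis using 1(3) by (auto intro!: jet_cong[OF jet.jet_zero])
    next
      case (Suc d')
      have "j < ?M" using jm by auto
      from jet_koszul[OF coeffs_UNIV jet.jet_letter[OF 1(2) this]] show ?thesis using Suc by simp
    qed
    have comm: "b j * (b m * a) = b m * (?e * (b j * a))" for a
    proof -
      have "?e * (b j * (b m * a)) = b m * (b j * a)"
        using twist_b_commute[of m j a] by (simp add: twist_b mult.assoc)
      then have "b j * (b m * a) = ?e * (b m * (b j * a))" by (metis koszul_square)
      then show ?thesis by (simp add: koszul_def)
    qed
    show ?thesis
    proof (rule exI, rule exI, rule exI, rule exI, intro conjI)
      show "jet UNIV m (Suc d) (b j * g) (\<lambda>i. (if i = j then g else 0) + twist (par i) (b j) * G i)"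
        by (rule jet.jet_letter[OF 1(1) jm])
      show "jet UNIV ?M (Suc d - 1) (?e * (b j * h)) (\<lambda>i. ?e * ((if i = j then h else 0) + twist (par i) (b j) * H i))"
        using h' by simp
      show "b j * y = b j * g + b m * (?e * (b j * h))" using 1(4) comm by (simp add: distrib_left)
      show "\<forall>i. (if i = j then y else 0) + twist (par i) (b j) * Y i =
        (if i = j then g else 0) + twist (par i) (b j) * G i +
          ((if i = m then ?e * (b j * h) else 0) +
           twist (par i) (b m) * (?e * ((if i = j then h else 0) + twist (par i) (b j) * H i)))"
      proof
        fix i
        have t: "twist (par i) (b j) * (twist (par i) (b m) * H i) = twist (par i) (b m) * (?e * (twist (par i) (b j) * H i))"
          using arg_cong[OF comm[of "twist (par i) (H i)"], of "twist (par i)"]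
          using twist_koszul[of "par i" _ 1] by (simp add: twist_mult twist_twist)
        show "(if i = j then y else 0) + twist (par i) (b j) * Y i =
        (if i = j then g else 0) + twist (par i) (b j) * G i +
          ((if i = m then ?e * (b j * h) else 0) +
           twist (par i) (b m) * (?e * ((if i = j then h else 0) + twist (par i) (b j) * H i)))"
          unfolding 1(4,5)
          using jm t by (auto simp: distrib_left add.assoc twist_b mult.assoc koszul_def algebra_simps)
      qed
    qed simp
  next
    case True
    show ?thesis
    proof (cases "par m = 0")
      case p0: True
      show ?thesis
        by (rule exI[of _ 0], rule exI[of _ "\<lambda>_. 0"], rule exI[of _ y], rule exI[of _ Y])
          (use True p0 jet_letter(1) in \<open>auto intro: jet.jet_zero\<close>)
    next
      case p1: False
      then have pm: "par m = 1" by (cases "par m") auto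
      have bb: "b m * (b m * a) = 0" for a
        using odd_square[of "b m"] b_gr[of m] pm by (metis mult.assoc mult_zero_left)
      have tt: "twist i (b m) * (twist i (b m) * a) = 0" for i a
        unfolding twist_b using bb by (simp add: mult.assoc koszul_def)
      show ?thesis
        by (rule exI[of _ 0], rule exI[of _ "\<lambda>_. 0"], rule exI[of _ g], rule exI[of _ G])
          (use True p1 1(1) in \<open>auto intro: jet.jet_zero simp: 1(4,5) distrib_left bb tt, auto simp: twist_b pm koszul_def\<close>)
    qed
  qed
qed

end

section \<open>Saturation, and quasi-regularity of regular sequences\<close>

context char0_superalgebra
begin

text \<open>
  Two-sided graded ideals, with the grading expressed by stability under the twist.
\<close>

definition twist_ideal :: "'a set \<Rightarrow> bool" where
  "twist_ideal I \<longleftrightarrow> 0 \<in> I \<and> (\<forall>x\<in>I. \<forall>y\<in>I. x + y \<in> I) \<and>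
     (\<forall>x\<in>I. \<forall>a. a * x \<in> I \<and> x * a \<in> I) \<and> (\<forall>x\<in>I. \<forall>i. twist i x \<in> I)"

lemma twist_idealD:
  assumes "twist_ideal I"
  shows "0 \<in> I" and "\<And>x y. x \<in> I \<Longrightarrow> y \<in> I \<Longrightarrow> x + y \<in> I"
    and "\<And>x a. x \<in> I \<Longrightarrow> a * x \<in> I" and "\<And>x a. x \<in> I \<Longrightarrow> x * a \<in> I"
    and "\<And>x i. x \<in> I \<Longrightarrow> twist i x \<in> I"
  using assms unfolding twist_ideal_def by auto

lemma twist_ideal_minus: "twist_ideal I \<Longrightarrow> x \<in> I \<Longrightarrow> - x \<in> I"
  using twist_idealD(3)[of I x "- 1"] by simp

lemma twist_ideal_diff: "twist_ideal I \<Longrightarrow> x \<in> I \<Longrightarrow> y \<in> I \<Longrightarrow> x - y \<in> I"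
  using twist_idealD(2)[of I x "- y"] twist_ideal_minus by simp

lemma twist_ideal_scale: "twist_ideal I \<Longrightarrow> x \<in> I \<Longrightarrow> scale c x \<in> I"
  using twist_idealD(3)[of I x "scale c 1"] by (simp add: scale_mult_left)

lemma twist_ideal_sum: "twist_ideal I \<Longrightarrow> (\<And>i. i \<in> A \<Longrightarrow> f i \<in> I) \<Longrightarrow> sum f A \<in> I"
  by (induction A rule: infinite_finite_induct) (auto dest: twist_idealD)

lemma twist_ideal_of_nat:
  assumes "twist_ideal I" "of_nat (Suc n) * x \<in> I" shows "x \<in> I"
proof -
  have "scale (1 / of_nat (Suc n)) (of_nat (Suc n) * x) = x"
    unfolding of_nat_mult_scale by (simp del: of_nat_Suc)
  then show ?thesis using twist_ideal_scale[OF assms] by metis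
qed

end

text \<open>
  Denominators are even, hence central, as in the stalk of a superscheme.
\<close>

locale even_denominators = char0_superalgebra scale gr
  for scale :: "'k::field_char_0 \<Rightarrow> 'a::ring_1 \<Rightarrow> 'a" and gr :: "bit \<Rightarrow> 'a set" +
  fixes S :: "'a set"
  assumes S_even: "S \<subseteq> gr 0" and one_S: "1 \<in> S" and mult_S: "s \<in> S \<Longrightarrow> t \<in> S \<Longrightarrow> s * t \<in> S"

locale localized_letters = letters scale gr b par + even_denominators scale gr S
  for scale :: "'k::field_char_0 \<Rightarrow> 'a::ring_1 \<Rightarrow> 'a" and gr :: "bit \<Rightarrow> 'a set"
    and b :: "nat \<Rightarrow> 'a" and par :: "nat \<Rightarrow> bit" and S :: "'a set"
begin

lemma S_central: "s \<in> S \<Longrightarrow> s * a = a * s"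
  using S_even even_central by blast

text \<open>
  The saturation of \<open>I\<close>, that is, the preimage of the extension of \<open>I\<close> to the fractions with
  denominators in \<open>S\<close>.  All local arguments are carried out with saturated ideals of the algebra itself.
\<close>

definition sat :: "'a set \<Rightarrow> 'a set" where
  "sat I = {y. \<exists>s\<in>S. s * y \<in> I}"

lemma satI: "s \<in> S \<Longrightarrow> s * y \<in> I \<Longrightarrow> y \<in> sat I" unfolding sat_def by blast

lemma satE: assumes "y \<in> sat I" obtains s where "s \<in> S" "s * y \<in> I"
  using assms unfolding sat_def by blast

lemma subset_sat: "I \<subseteq> sat I" using one_S unfolding sat_def by force

lemma sat_mono: "I \<subseteq> I' \<Longrightarrow> sat I \<subseteq> sat I'" unfolding sat_def by blast

lemma sat_sat: "s \<in> S \<Longrightarrow> s * y \<in> sat I \<Longrightarrow> y \<in> sat I"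
  unfolding sat_def using mult_S by (auto simp: mult.assoc[symmetric])

lemma twist_ideal_sat:
  assumes I: "twist_ideal I"
  shows "twist_ideal (sat I)"
  unfolding twist_ideal_def
proof (intro conjI ballI allI)
  note rules = twist_idealD[OF I]
  show "0 \<in> sat I" using subset_sat rules by blast
  fix x assume "x \<in> sat I"
  then obtain s where s: "s \<in> S" "s * x \<in> I" by (rule satE)
  show "x + y \<in> sat I" if y: "y \<in> sat I" for y
  proof -
    obtain t where t: "t \<in> S" "t * y \<in> I" using y by (rule satE)
    have "(s * t) * (x + y) = t * (s * x) + s * (t * y)"
      using S_central[OF s(1), of t] by (simp add: distrib_left mult.assoc[symmetric])
    then have "(s * t) * (x + y) \<in> I" using rules s t by simp
    then show ?thesis by (rule satI[OF mult_S[OF s(1) t(1)]])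
  qed
  fix a i
  have "s * (a * x) = a * (s * x)" using S_central[OF s(1), of a] by (simp add: mult.assoc[symmetric])
  then show "a * x \<in> sat I" using satI[OF s(1), of "a * x"] rules s by simp
  show "x * a \<in> sat I" using satI[OF s(1), of "x * a"] rules(4)[OF s(2)] by (simp add: mult.assoc)
  have "twist i (s * x) = s * twist i x"
    using s(1) S_even by (simp add: twist_mult twist_homogeneous[of s 0] subset_iff koszul_def)
  then show "twist i x \<in> sat I" using satI[OF s(1), of "twist i x"] rules(5)[OF s(2), of i] by simp
qed

lemma twist_ideal_V: "twist_ideal (V m d)"
  unfolding twist_ideal_def by (intro conjI ballI allI V_zero V_add V_mult_left V_mult_right V_twist)

text \<open>
  For \<open>m\<close> letters generating a maximal ideal locally, \<open>P m d\<close> is the set of elements vanishing to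
  order \<open>d\<close> at the point.
\<close>

definition P :: "nat \<Rightarrow> nat \<Rightarrow> 'a set" where "P m d = sat (V m d)"

lemma twist_ideal_P: "twist_ideal (P m d)"
  unfolding P_def by (rule twist_ideal_sat[OF twist_ideal_V])

lemma P_0 [simp]: "P m 0 = UNIV"
  unfolding P_def using subset_sat[of UNIV] by auto

lemma V_subset_P: "V m d \<subseteq> P m d" unfolding P_def by (rule subset_sat)

lemma P_antimono: "d \<le> e \<Longrightarrow> P m e \<subseteq> P m d"
  unfolding P_def by (intro sat_mono V_antimono)

lemma P_mono: "m \<le> m' \<Longrightarrow> P m d \<subseteq> P m' d"
  unfolding P_def by (intro sat_mono V_mono)

lemma P_cancel: "s \<in> S \<Longrightarrow> s * y \<in> P m d \<Longrightarrow> y \<in> P m d"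
  unfolding P_def by (rule sat_sat)

lemma P_mult: assumes "x \<in> P m d" "y \<in> P m e" shows "x * y \<in> P m (d + e)"
proof -
  obtain s t where st: "s \<in> S" "s * x \<in> V m d" "t \<in> S" "t * y \<in> V m e"
    using assms unfolding P_def sat_def by blast
  have "(s * t) * (x * y) = (s * x) * (t * y)"
    using S_central[OF st(3), of x] by (metis mult.assoc)
  then have "(s * t) * (x * y) \<in> V m (d + e)" using V_mult[OF st(2,4)] by simp
  then show ?thesis unfolding P_def by (rule satI[OF mult_S[OF st(1,3)]])
qed

lemma P_letter: "x \<in> P m d \<Longrightarrow> j < m \<Longrightarrow> b j * x \<in> P m (Suc d)"
  using P_mult[of "b j" m 1 x d] V_subset_P V_letter[of 1 m 0 j] by auto

text \<open>
  Regularity of the letter \<open>b m\<close> modulo the preceding ones, in terms of saturated ideals.  For an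
  odd letter, exactness says that an annihilated element is a multiple of the letter, that is, it
  lies in the ideal with \<open>b m\<close> added.
\<close>

definition regular_letter :: "nat \<Rightarrow> bool" where
  "regular_letter m \<longleftrightarrow>
     (par m = 0 \<and> (\<forall>y. b m * y \<in> P m 1 \<longrightarrow> y \<in> P m 1)) \<or>
     (par m = 1 \<and> (\<forall>y. b m * y \<in> P m 1 \<longrightarrow> y \<in> P (Suc m) 1))"

text \<open>
  Quasi-regularity in terms of derivatives.  Applied repeatedly, it says that a form of degree
  \<open>d\<close> whose value has order \<open>d + 1\<close> has coefficients in the ideal; in this form the induction
  needs no normal form for monomials.
\<close>

definition quasi_regular :: "nat \<Rightarrow> nat \<Rightarrow> bool" where
  "quasi_regular m d \<longleftrightarrow>
     (\<forall>y Y. jet UNIV m d y Y \<longrightarrow> y \<in> P m (Suc d) \<longrightarrow> (\<forall>i. Y i \<in> P m d))"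

lemma quasi_regularD:
  "quasi_regular m d \<Longrightarrow> jet UNIV m d y Y \<Longrightarrow> y \<in> P m (Suc d) \<Longrightarrow> Y i \<in> P m d"
  unfolding quasi_regular_def by blast

text \<open>
  Only forms with value \<open>0\<close> need to be considered: by \<open>jet_lower\<close> the value of order \<open>d + 1\<close> can be
  subtracted without changing the derivatives modulo order \<open>d\<close>.
\<close>

lemma quasi_regularI:
  assumes "\<And>Y i. jet UNIV m d 0 Y \<Longrightarrow> Y i \<in> P m d"
  shows "quasi_regular m d"
  unfolding quasi_regular_def
proof (intro allI impI)
  fix y Y i assume y: "jet UNIV m d y Y" "y \<in> P m (Suc d)"
  then obtain s where s: "s \<in> S" "s * y \<in> V m (Suc d)" unfolding P_def by (blast elim: satE)
  then obtain Z where Z: "jet UNIV m d (s * y) Z" "\<And>i. Z i \<in> V m d" using jet_lower by blast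
  have "jet UNIV m d (y * s - s * y) (\<lambda>i. Y i * s - Z i)"
    by (rule jet_diff[OF coeffs_UNIV jet_mult_right[OF y(1)] Z(1)]) simp
  then have "Y i * s - Z i \<in> P m d" using assms S_central[OF s(1), of y] by simp
  then have "(Y i * s - Z i) + Z i \<in> P m d"
    using Z(2) V_subset_P twist_idealD(2)[OF twist_ideal_P] by blast
  then have "s * Y i \<in> P m d" using S_central[OF s(1)] by simp
  then show "Y i \<in> P m d" by (rule P_cancel[OF s(1)])
qed

text \<open>
  If \<open>b m * y\<close> has order \<open>j + 1\<close> then, by quasi-regularity, the derivatives of \<open>b m * y\<close> have order \<open>j\<close>;
  these are multiples of \<open>b m\<close>, so by induction the derivatives of \<open>y\<close> have order \<open>j\<close>, and Euler's
  formula recovers \<open>y\<close>.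
\<close>

lemma even_regular_powers:
  assumes qr: "\<And>d. quasi_regular m d" and reg: "\<And>y. b m * y \<in> P m 1 \<Longrightarrow> y \<in> P m 1"
    and even: "par m = 0"
  shows "b m * y \<in> P m j \<Longrightarrow> y \<in> P m j"
proof (induction j arbitrary: y)
  case (Suc j)
  show ?case
  proof (cases j)
    case 0 then show ?thesis using Suc reg by simp
  next
    case (Suc j')
    have "y \<in> P m j" using Suc.IH Suc.prems P_antimono[of j "Suc j" m] by auto
    then obtain s where s: "s \<in> S" "s * y \<in> V m j" unfolding P_def by (blast elim: satE)
    then obtain Y where Y: "jet UNIV m j (s * y) Y" unfolding V_def by blast
    have c: "b m * a = a * b m" for a using even_central b_gr[of m] even by metis
    have "s * y * b m = s * (b m * y)" by (simp add: c mult.assoc)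
    then have "s * y * b m \<in> P m (Suc j)" using twist_idealD(3)[OF twist_ideal_P Suc.prems] by simp
    then have "Y i * b m \<in> P m j" for i
      using quasi_regularD[OF qr jet_mult_right[OF Y]] by blast
    then have "Y i \<in> P m j" for i using Suc.IH c by metis
    then have "(\<Sum>i<m. b i * Y i) \<in> P m (Suc j)"
      by (intro twist_ideal_sum[OF twist_ideal_P] P_letter) auto
    then have "of_nat (Suc j') * (s * y) \<in> P m (Suc j)" using jet_euler[OF Y] Suc by simp
    then have "s * y \<in> P m (Suc j)" by (rule twist_ideal_of_nat[OF twist_ideal_P])
    then show ?thesis by (rule P_cancel[OF s(1)])
  qed
qed simp

definition V_with :: "nat \<Rightarrow> nat \<Rightarrow> 'a set" where
  "V_with m d = {v + b m * z |v z. v \<in> V m d}"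

lemma V_with_iff: "x \<in> V_with m d \<longleftrightarrow> (\<exists>z. x - b m * z \<in> V m d)"
proof
  assume "x \<in> V_with m d"
  then obtain v z where "x = v + b m * z" "v \<in> V m d" unfolding V_with_def by blast
  then have "x - b m * z \<in> V m d" by simp
  then show "\<exists>z. x - b m * z \<in> V m d" ..
next
  assume "\<exists>z. x - b m * z \<in> V m d"
  then obtain z where z: "x - b m * z \<in> V m d" ..
  have "x = (x - b m * z) + b m * z" by simp
  then show "x \<in> V_with m d" unfolding V_with_def using z by blast
qed

lemma twist_ideal_V_with: "twist_ideal (V_with m d)"
  unfolding twist_ideal_def
proof (intro conjI ballI allI)
  show "0 \<in> V_with m d" unfolding V_with_iff by (intro exI[of _ 0]) (simp add: V_zero)
  fix x assume "x \<in> V_with m d"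
  then obtain z where z: "x - b m * z \<in> V m d" unfolding V_with_iff by blast
  show "x + y \<in> V_with m d" if y: "y \<in> V_with m d" for y
  proof -
    obtain w where w: "y - b m * w \<in> V m d" using y unfolding V_with_iff by blast
    have "(x + y) - b m * (z + w) \<in> V m d" using V_add[OF z w] by (simp add: algebra_simps)
    then show ?thesis unfolding V_with_iff by blast
  qed
  fix a i
  have "a * x - b m * (twist (par m) a * z) = a * (x - b m * z)"
    using commute_right[OF b_gr, of a m] by (simp add: right_diff_distrib mult.assoc[symmetric])
  then show "a * x \<in> V_with m d" unfolding V_with_iff using V_mult_left[OF z] by metis
  have "x * a - b m * (z * a) \<in> V m d" using V_mult_right[OF z, of a] by (simp add: algebra_simps)
  then show "x * a \<in> V_with m d" unfolding V_with_iff by blast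
  have "twist i x - b m * (koszul (i * par m) * twist i z) = twist i (x - b m * z)"
    by (simp add: twist_diff twist_mult twist_b koszul_def)
  then show "twist i x \<in> V_with m d" unfolding V_with_iff using V_twist[OF z] by metis
qed

lemma sat_V_with_0 [simp]: "sat (V_with m 0) = UNIV"
proof -
  have "V_with m 0 = UNIV" by (auto simp: V_with_iff)
  then show ?thesis using subset_sat by blast
qed

lemma V_Suc_subset_V_with: "V (Suc m) 1 \<subseteq> V_with m 1"
proof
  fix y assume "y \<in> V (Suc m) 1"
  then obtain Y where "jet UNIV (Suc m) 1 y Y" unfolding V_def by blast
  then obtain g G h where "jet UNIV m 1 g G" "y = g + b m * h" using jet_split by blast
  then show "y \<in> V_with m 1" unfolding V_with_def using VI by blast
qed

text \<open>
  The argument of \<open>even_regular_powers\<close>, with \<open>0\<close> replaced by the multiples of the odd letter.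
\<close>

lemma odd_regular_powers:
  assumes qr: "\<And>d. quasi_regular m d" and reg: "\<And>y. b m * y \<in> P m 1 \<Longrightarrow> y \<in> P (Suc m) 1"
    and odd: "par m = 1"
  shows "b m * y \<in> P m j \<Longrightarrow> y \<in> sat (V_with m j)"
proof (induction j arbitrary: y)
  case (Suc j)
  note ideal = twist_ideal_sat[OF twist_ideal_V_with]
  have bb: "b m * (b m * a) = 0" for a
    using odd_square[of "b m"] b_gr[of m] odd by (metis mult.assoc mult_zero_left)
  have c: "b m * a = twist 1 a * b m" for a using commute_left[OF b_gr, of m] odd by simp
  have "y \<in> sat (V_with m j)" using Suc.IH Suc.prems P_antimono[of j "Suc j" m] by auto
  then obtain s where s: "s \<in> S" "s * y \<in> V_with m j" by (rule satE)
  then obtain z where z: "s * y - b m * z \<in> V m j" unfolding V_with_iff by blast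
  define y' where "y' = s * y - b m * z"
  have "b m * y' = s * (b m * y)"
    unfolding y'_def using S_central[OF s(1), of "b m"] bb by (simp add: right_diff_distrib mult.assoc[symmetric])
  then have by': "b m * y' \<in> P m (Suc j)" using twist_idealD(3)[OF twist_ideal_P Suc.prems] by simp
  have "y' \<in> sat (V_with m (Suc j))"
  proof (cases j)
    case 0
    then have "y' \<in> P (Suc m) 1" using by' reg by simp
    then show ?thesis unfolding P_def using sat_mono[OF V_Suc_subset_V_with] 0 by auto
  next
    case (Suc j')
    obtain Y where Y: "jet UNIV m j y' Y" using z unfolding y'_def V_def by blast
    have "twist 1 (b m * y') = - (y' * b m)"
      using odd by (simp add: twist_mult twist_b koszul_def c twist_twist)
    then have "y' * b m \<in> P m (Suc j)"
      using twist_idealD(5)[OF twist_ideal_P by', of 1] twist_ideal_minus[OF twist_ideal_P] by fastforce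
    then have "Y i * b m \<in> P m j" for i
      using quasi_regularD[OF qr jet_mult_right[OF Y]] by blast
    then have "b m * twist 1 (Y i) \<in> P m j" for i by (simp add: c twist_twist)
    then have "twist 1 (Y i) \<in> sat (V_with m j)" for i using Suc.IH by blast
    then have Yi: "Y i \<in> sat (V_with m j)" for i
      using twist_idealD(5)[OF ideal] by (metis twist_twist)
    have "b i * Y i \<in> sat (V_with m (Suc j))" if i: "i < m" for i
    proof -
      obtain t where t: "t \<in> S" "t * Y i \<in> V_with m j" using Yi by (rule satE)
      then obtain w where w: "t * Y i - b m * w \<in> V m j" unfolding V_with_iff by blast
      have "b i * (b m * w) = b m * (twist (par m) (b i) * w)"
        using commute_right[OF b_gr, of "b i" m] by (metis mult.assoc)
      then have "t * (b i * Y i) - b m * (twist (par m) (b i) * w) = b i * (t * Y i - b m * w)"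
        using S_central[OF t(1), of "b i"] by (simp add: right_diff_distrib mult.assoc[symmetric])
      then have "t * (b i * Y i) \<in> V_with m (Suc j)"
        unfolding V_with_iff using V_letter[OF w i] by metis
      then show ?thesis by (rule satI[OF t(1)])
    qed
    then have "(\<Sum>i<m. b i * Y i) \<in> sat (V_with m (Suc j))"
      by (intro twist_ideal_sum[OF ideal]) auto
    then have "of_nat (Suc j') * y' \<in> sat (V_with m (Suc j))" using jet_euler[OF Y] Suc by simp
    then show ?thesis by (rule twist_ideal_of_nat[OF ideal])
  qed
  moreover have "b m * z \<in> sat (V_with m (Suc j))"
    by (rule subsetD[OF subset_sat], unfold V_with_iff) (auto intro: exI[of _ z] simp: V_zero)
  ultimately have "y' + b m * z \<in> sat (V_with m (Suc j))" by (rule twist_idealD(2)[OF ideal])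
  then show ?case using sat_sat[OF s(1)] unfolding y'_def by simp
qed simp

text \<open>
  Write a form with value \<open>0\<close> as \<open>g + b m * h\<close>.  Then \<open>b m * h\<close> has order \<open>d + 1\<close> already in the
  preceding letters.  Regularity of \<open>b m\<close> modulo powers replaces \<open>h\<close>, up to a denominator, by an
  \<open>h'\<close> of order \<open>d + 1\<close> in the preceding letters with \<open>b m * h' = b m * h\<close>.  The derivatives of \<open>h\<close>
  are controlled by induction on \<open>d\<close>, and those of \<open>g\<close> by quasi-regularity of the preceding
  letters applied to \<open>g + b m * h'\<close>, a form in these letters with value \<open>0\<close>.
\<close>

lemma quasi_regular_Suc:
  assumes qr: "\<And>d. quasi_regular m d" and reg: "regular_letter m"
  shows "quasi_regular (Suc m) d"
proof (induction d)
  case 0 show ?case by (simp add: quasi_regular_def)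
next
  case (Suc d)
  note rules = twist_idealD[OF twist_ideal_P]
  show ?case
  proof (rule quasi_regularI)
    fix Y i assume "jet UNIV (Suc m) (Suc d) 0 Y"
    from jet_split[OF this] obtain g G h H where
      g: "jet UNIV m (Suc d) g G" and h: "jet UNIV (if par m = 0 then Suc m else m) d h H"
      and gh: "0 = g + b m * h"
      and Y: "\<And>i. Y i = G i + ((if i = m then h else 0) + twist (par i) (b m) * H i)"
      by auto
    have "b m * h = - g" using gh by (metis add.commute eq_neg_iff_add_eq_0)
    then have bh: "b m * h \<in> V m (Suc d)" using g VI V_minus by simp
    \<comment> \<open>for an odd letter, apply exactness twice: to \<open>h\<close>, and to the cofactor \<open>z\<close> of the letter in \<open>s * h\<close>\<close>
    have "\<exists>s\<in>S. \<exists>h'\<in>V m (Suc d). s * h \<in> V (Suc m) (Suc d) \<and> b m * (s * h) = b m * h'"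
    proof (cases "par m = 0")
      case True
      then have "h \<in> P m (Suc d)"
        using even_regular_powers[OF qr, where y = h and j = "Suc d"] reg bh V_subset_P True
        unfolding regular_letter_def by auto
      then show ?thesis unfolding P_def using V_mono[of m "Suc m"] by (auto elim!: satE)
    next
      case False
      then have pm: "par m = 1" by (cases "par m") auto
      have bb: "b m * (b m * a) = 0" for a
        using odd_square[of "b m"] b_gr[of m] pm by (metis mult.assoc mult_zero_left)
      have odd: "b m * a \<in> V m j \<Longrightarrow> a \<in> sat (V_with m j)" for a j
        using odd_regular_powers[OF qr, where y = a and j = j] reg pm V_subset_P
        unfolding regular_letter_def by auto
      have hV: "h \<in> V m d" using h False VI by auto
      obtain s where s: "s \<in> S" "s * h \<in> V_with m (Suc d)" using odd[OF bh] by (rule satE)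
      then obtain z where z: "s * h - b m * z \<in> V m (Suc d)" unfolding V_with_iff by blast
      have "b m * z = s * h - (s * h - b m * z)" by simp
      then have "b m * z \<in> V m d" using V_diff V_mult_left[OF hV] z V_Suc_subset by (metis subsetD)
      then obtain t where t: "t \<in> S" "t * z \<in> V_with m d" using odd by (blast elim: satE)
      then obtain w where w: "t * z - b m * w \<in> V m d" unfolding V_with_iff by blast
      let ?h' = "t * (s * h - b m * z)"
      have h': "?h' \<in> V m (Suc d)" using z by (rule V_mult_left)
      have tb: "t * (b m * a) = b m * (t * a)" for a using S_central[OF t(1), of "b m"] by (metis mult.assoc)
      have "t * s * h = ?h' + b m * (t * z - b m * w)"
        by (simp add: right_diff_distrib tb bb mult.assoc)
      moreover have "b m * (t * z - b m * w) \<in> V (Suc m) (Suc d)"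
        by (rule V_letter) (use w V_mono[of m "Suc m" d] in auto)
      ultimately have "t * s * h \<in> V (Suc m) (Suc d)"
        using V_add h' V_mono[of m "Suc m" "Suc d"] by auto
      moreover have "b m * (t * s * h) = b m * ?h'"
        by (simp add: right_diff_distrib tb bb mult.assoc)
      ultimately show ?thesis using h' mult_S[OF t(1) s(1)] by blast
    qed
    then obtain s h' where s: "s \<in> S" and h': "h' \<in> V m (Suc d)"
      and sh: "s * h \<in> V (Suc m) (Suc d)" and bsh: "b m * (s * h) = b m * h'" by blast
    have hP: "h \<in> P (Suc m) (Suc d)" unfolding P_def by (rule satI[OF s sh])
    have "jet UNIV (Suc m) d h H" by (rule jet_mono[OF h]) auto
    then have HP: "H i \<in> P (Suc m) d" using quasi_regularD[OF Suc] hP by blast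
    obtain H' where H': "jet UNIV m (Suc d) h' H'" using h' unfolding V_def by blast
    let ?t = "twist (par m)"
    have J: "jet UNIV m (Suc d) (g * s + ?t h' * b m)
      (\<lambda>i. G i * s + koszul (par m * par i) * ?t (H' i) * b m)"
      by (rule jet_add[OF jet_mult_right[OF g] jet_mult_right[OF jet_twist[OF coeffs_UNIV H']]]) auto
    have J0: "g * s + ?t h' * b m = 0"
    proof -
      have "g * s + ?t h' * b m = s * g + b m * (s * h)"
        using S_central[OF s] commute_left[OF b_gr, of m h'] bsh by simp
      also have "\<dots> = s * (g + b m * h)"
        using S_central[OF s, of "b m"] by (simp add: distrib_left mult.assoc[symmetric])
      finally show ?thesis using gh by simp
    qed
    have "G i * s + koszul (par m * par i) * ?t (H' i) * b m \<in> P m (Suc d)"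
      using quasi_regularD[OF qr J, of i] J0 rules(1) by simp
    then have 1: "G i * s + koszul (par m * par i) * ?t (H' i) * b m \<in> P (Suc m) (Suc d)"
      by (rule subsetD[OF P_mono, rotated]) simp
    have "H' i \<in> V m d" using jet_derivative[OF coeffs_UNIV H'] VI by blast
    then have "twist (par m) (koszul (par m * par i) * ?t (H' i)) \<in> P (Suc m) d"
      using V_subset_P P_mono[of m "Suc m"] rules(3,5) by (meson lessI less_imp_le subsetD)
    then have "b m * twist (par m) (koszul (par m * par i) * ?t (H' i)) \<in> P (Suc m) (Suc d)"
      by (rule P_letter) simp
    then have "koszul (par m * par i) * ?t (H' i) * b m \<in> P (Suc m) (Suc d)"
      using commute_right[OF b_gr, of "koszul (par m * par i) * ?t (H' i)" m] by simp
    then have "G i * s \<in> P (Suc m) (Suc d)"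
      using twist_ideal_diff[OF twist_ideal_P 1] by (metis add_diff_cancel_right')
    then have "G i \<in> P (Suc m) (Suc d)" using S_central[OF s] P_cancel[OF s] by metis
    moreover have "b m * H i \<in> P (Suc m) (Suc d)" using HP by (rule P_letter) simp
    then have "twist (par i) (b m) * H i \<in> P (Suc m) (Suc d)"
      unfolding twist_b mult.assoc by (rule rules(3))
    ultimately show "Y i \<in> P (Suc m) (Suc d)" unfolding Y using hP rules(1,2) by simp
  qed
qed

theorem regular_imp_quasi_regular:
  assumes "\<And>j. j < m \<Longrightarrow> regular_letter j"
  shows "quasi_regular m d"
  using assms
proof (induction m arbitrary: d)
  case 0
  have "Y i \<in> P 0 d" if "jet UNIV 0 d y Y" for y Y i d
    using jet_support[OF that, of i] twist_idealD(1)[OF twist_ideal_P] by simp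
  then show ?case unfolding quasi_regular_def by auto
next
  case (Suc m)
  show ?case by (rule quasi_regular_Suc) (use Suc in auto)
qed

end

section \<open>Polynomial jets at a point\<close>

context letters
begin

text \<open>
  The inhomogeneous analogue of \<open>jet\<close> with scalar coefficients: values of polynomials in the
  letters together with the values of their left partial derivatives.
\<close>

inductive pjet :: "nat \<Rightarrow> 'a \<Rightarrow> (nat \<Rightarrow> 'a) \<Rightarrow> bool" for m where
  pjet_const: "pjet m (scale c 1) (\<lambda>i. 0)"
| pjet_add: "pjet m y Y \<Longrightarrow> pjet m z Z \<Longrightarrow> pjet m (y + z) (\<lambda>i. Y i + Z i)"
| pjet_letter: "pjet m y Y \<Longrightarrow> j < m \<Longrightarrow>
    pjet m (b j * y) (\<lambda>i. (if i = j then y else 0) + twist (par i) (b j) * Y i)"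

lemma pjet_cong: "pjet m y Y \<Longrightarrow> y = z \<Longrightarrow> (\<And>i. Y i = Z i) \<Longrightarrow> pjet m z Z"
  by (subgoal_tac "Y = Z") auto

lemma pjet_zero: "pjet m 0 (\<lambda>i. 0)"
  by (rule pjet_cong[OF pjet_const[of m 0]]) auto

lemma pjet_scale: "pjet m y Y \<Longrightarrow> pjet m (scale t y) (\<lambda>i. scale t (Y i))"
proof (induction rule: pjet.induct)
  case (pjet_const c)
  show ?case by (rule pjet_cong[OF pjet.pjet_const[of m "t * c"]]) auto
next
  case (pjet_add y Y z Z)
  show ?case by (rule pjet_cong[OF pjet.pjet_add[OF pjet_add.IH]]) (auto simp: scale_right_distrib)
next
  case (pjet_letter y Y j)
  show ?case
    by (rule pjet_cong[OF pjet.pjet_letter[OF pjet_letter.IH pjet_letter.hyps(2)]])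
      (auto simp: scale_right_distrib scale_mult_right)
qed

lemma pjet_koszul: "pjet m y Y \<Longrightarrow> pjet m (koszul i * y) (\<lambda>k. koszul i * Y k)"
  using pjet_scale[of m y Y "koszul i"] by (simp add: koszul_scale)

lemma pjet_diff: "pjet m y Y \<Longrightarrow> pjet m z Z \<Longrightarrow> pjet m (y - z) (\<lambda>i. Y i - Z i)"
  by (drule pjet_scale[of m z Z "- 1"], drule pjet_add, assumption, erule pjet_cong) auto

lemma pjet_twist: "pjet m y Y \<Longrightarrow> pjet m (twist e y) (\<lambda>i. koszul (e * par i) * twist e (Y i))"
proof (induction rule: pjet.induct)
  case (pjet_const c)
  show ?case by (rule pjet_cong[OF pjet.pjet_const[of m c]]) (auto simp: twist_scale)
next
  case (pjet_add y Y z Z)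
  show ?case by (rule pjet_cong[OF pjet.pjet_add[OF pjet_add.IH]]) (auto simp: twist_add distrib_left)
next
  case (pjet_letter y Y j)
  show ?case
    by (rule pjet_cong[OF pjet_koszul[OF pjet.pjet_letter[OF pjet_letter.IH pjet_letter.hyps(2)], of "e * par j"]])
      (auto simp: twist_add twist_mult distrib_left twist_b twist_koszul mult.assoc koszul_def twist_minus)
qed

lemma pjet_mult:
  assumes "pjet m y Y" "pjet m z Z"
  shows "pjet m (y * z) (\<lambda>i. Y i * z + twist (par i) y * Z i)"
  using assms(1)
proof (induction rule: pjet.induct)
  case (pjet_const c)
  show ?case
    by (rule pjet_cong[OF pjet_scale[OF assms(2), of c]]) (auto simp: scale_mult_left twist_scale)
next
  case (pjet_add y Y y' Y')
  show ?case by (rule pjet_cong[OF pjet.pjet_add[OF pjet_add.IH]]) (auto simp: twist_add algebra_simps)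
next
  case (pjet_letter y Y j)
  show ?case
    by (rule pjet_cong[OF pjet.pjet_letter[OF pjet_letter.IH pjet_letter.hyps(2)]])
      (auto simp: twist_mult algebra_simps)
qed

lemma pjet_b: "j < m \<Longrightarrow> pjet m (b j) (\<lambda>i. if i = j then 1 else 0)"
  by (rule pjet_cong[OF pjet_letter[OF pjet_const[of m 1]]]) auto

lemma pjet_support: "pjet m y Y \<Longrightarrow> i \<ge> m \<Longrightarrow> Y i = 0"
  by (induction rule: pjet.induct) auto

text \<open>
  The map \<open>h k\<close> is the projection to the part of parity \<open>k\<close>, written through the twist.
\<close>

lemma pjet_homogeneous_part:
  assumes "pjet m y Y"
  defines "h \<equiv> \<lambda>k x. scale (1/2) (x + koszul k * twist 1 x)"
  shows "pjet m (h k y) (\<lambda>i. h (k + par i) (Y i))" and "h k x \<in> gr k"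
proof -
  show "pjet m (h k y) (\<lambda>i. h (k + par i) (Y i))"
    unfolding h_def
    by (rule pjet_cong[OF pjet_scale[OF pjet_add[OF assms(1) pjet_koszul[OF pjet_twist[OF assms(1), of 1]]]]])
      (auto simp: koszul_def)
  show "h k x \<in> gr k"
    unfolding h_def
    by (rule gr_twistI)
      (auto simp: twist_scale twist_add twist_koszul twist_twist koszul_def scale_right_distrib add.commute
        scale_minus_right scale_right_diff_distrib twist_minus)
qed

lemma homogeneous_part_id:
  assumes "x \<in> gr k" shows "scale (1/2) (x + koszul k * twist 1 x) = x"
proof -
  have "koszul k * twist 1 x = x" using assms by (simp add: twist_homogeneous koszul_def)
  then have "scale (1/2) (x + koszul k * twist 1 x) = scale (1/2 + 1/2) x"
    by (simp only: scale_left_distrib scale_right_distrib)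
  then show ?thesis by simp
qed

text \<open>
  Polynomials without terms of degree below \<open>d\<close>.  Peeling off their lowest degree (\<open>jet_ge_peel\<close>)
  replaces a decomposition into homogeneous components.
\<close>

inductive jet_ge :: "nat \<Rightarrow> nat \<Rightarrow> 'a \<Rightarrow> (nat \<Rightarrow> 'a) \<Rightarrow> bool" for m where
  jet_ge_jet: "jet (range (\<lambda>c. scale c 1)) m d y Y \<Longrightarrow> jet_ge m d y Y"
| jet_ge_lower: "jet_ge m (Suc d) y Y \<Longrightarrow> jet_ge m d y Y"
| jet_ge_add: "jet_ge m d y Y \<Longrightarrow> jet_ge m d z Z \<Longrightarrow> jet_ge m d (y + z) (\<lambda>i. Y i + Z i)"

lemma jet_ge_letter:
  "jet_ge m d y Y \<Longrightarrow> j < m \<Longrightarrow>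
    jet_ge m (Suc d) (b j * y) (\<lambda>i. (if i = j then y else 0) + twist (par i) (b j) * Y i)"
proof (induction rule: jet_ge.induct)
  case (jet_ge_jet d y Y)
  then show ?case by (intro jet_ge.jet_ge_jet jet_letter)
next
  case (jet_ge_lower d y Y)
  show ?case by (rule jet_ge.jet_ge_lower[OF jet_ge_lower.IH[OF jet_ge_lower.prems]])
next
  case (jet_ge_add d y Y z Z)
  have eq: "(\<lambda>i. ((if i = j then y else 0) + twist (par i) (b j) * Y i) +
      ((if i = j then z else 0) + twist (par i) (b j) * Z i)) =
    (\<lambda>i. (if i = j then y + z else 0) + twist (par i) (b j) * (Y i + Z i))"
    by (auto simp: algebra_simps)
  show ?case
    using jet_ge.jet_ge_add[OF jet_ge_add.IH(1)[OF jet_ge_add.prems] jet_ge_add.IH(2)[OF jet_ge_add.prems]]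
    unfolding eq by (simp add: distrib_left)
qed

lemma pjet_jet_ge: "pjet m y Y \<Longrightarrow> jet_ge m 0 y Y"
proof (induction rule: pjet.induct)
  case (pjet_letter y Y j)
  show ?case by (rule jet_ge_lower[OF jet_ge_letter[OF pjet_letter.IH pjet_letter.hyps(2)]])
qed (auto intro: jet_ge_jet jet_const jet_ge_add)

lemma jet_ge_V: "jet_ge m d y Y \<Longrightarrow> y \<in> V m d"
proof (induction rule: jet_ge.induct)
  case (jet_ge_jet d y Y)
  have "jet UNIV m d y Y" by (rule jet_mono[OF jet_ge_jet]) auto
  then show ?case by (rule VI)
next
  case (jet_ge_lower d y Y) then show ?case using V_Suc_subset by blast
next
  case (jet_ge_add d y Y z Z) then show ?case by (intro V_add)
qed

lemma jet_ge_derivative_V: "jet_ge m d y Y \<Longrightarrow> d = Suc n \<Longrightarrow> Y i \<in> V m n"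
proof (induction arbitrary: n rule: jet_ge.induct)
  case (jet_ge_jet d y Y)
  have "jet UNIV m (Suc n) y Y" by (rule jet_mono[OF jet_ge_jet(1)[unfolded jet_ge_jet(2)]]) auto
  then show ?case using jet_derivative[OF coeffs_UNIV] VI by blast
next
  case (jet_ge_lower d y Y) then show ?case using V_Suc_subset by blast
next
  case (jet_ge_add d y Y z Z) then show ?case by (auto intro: V_add)
qed

lemma jet_ge_peel:
  "jet_ge m d y Y \<Longrightarrow> \<exists>z Z w W. jet (range (\<lambda>c. scale c 1)) m d z Z \<and> jet_ge m (Suc d) w W \<and>
     y = z + w \<and> Y = (\<lambda>i. Z i + W i)"
proof (induction rule: jet_ge.induct)
  case (jet_ge_jet d y Y)
  then show ?case
    by (intro exI[of _ y] exI[of _ Y] exI[of _ 0] exI[of _ "\<lambda>_. 0"]) (auto intro: jet_ge.jet_ge_jet jet_zero)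
next
  case (jet_ge_lower d y Y)
  then show ?case
    by (intro exI[of _ 0] exI[of _ "\<lambda>_. 0"] exI[of _ y] exI[of _ Y]) (auto intro: jet_zero)
next
  case (jet_ge_add d y Y y' Y')
  from jet_ge_add.IH obtain z Z w W where 1: "jet (range (\<lambda>c. scale c 1)) m d z Z" "jet_ge m (Suc d) w W"
     "y = z + w" "Y = (\<lambda>i. Z i + W i)" by blast
  from jet_ge_add.IH obtain z' Z' w' W' where 2: "jet (range (\<lambda>c. scale c 1)) m d z' Z'" "jet_ge m (Suc d) w' W'"
     "y' = z' + w'" "Y' = (\<lambda>i. Z' i + W' i)" by blast
  show ?case
    by (intro exI conjI, rule jet_add[OF 1(1) 2(1)], rule jet_ge.jet_ge_add[OF 1(2) 2(2)])
      (auto simp: 1 2 algebra_simps)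
qed

end

text \<open>
  A point whose ideal \<open>P m 1\<close> is generated locally by a regular sequence and has the ground
  field as residue field.
\<close>

locale regular_point = localized_letters scale gr b par S
  for scale :: "'k::field_char_0 \<Rightarrow> 'a::ring_1 \<Rightarrow> 'a" and gr :: "bit \<Rightarrow> 'a set"
    and b :: "nat \<Rightarrow> 'a" and par :: "nat \<Rightarrow> bit" and S :: "'a set" +
  fixes m :: nat
  assumes regular: "j < m \<Longrightarrow> regular_letter j"
    and residue: "\<exists>c. a - scale c 1 \<in> P m 1"
    and proper: "1 \<notin> P m 1"
begin

lemmas P_ideal = twist_idealD[OF twist_ideal_P] twist_ideal_diff[OF twist_ideal_P]
  twist_ideal_minus[OF twist_ideal_P] twist_ideal_scale[OF twist_ideal_P]

lemma scalar_in_P: "scale c 1 \<in> P m 1 \<Longrightarrow> c = 0"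
proof (rule ccontr)
  assume "scale c 1 \<in> P m 1" "c \<noteq> 0"
  then have "scale (1/c) (scale c 1) \<in> P m 1" using P_ideal(8) by blast
  then show False using \<open>c \<noteq> 0\<close> proper by simp
qed

text \<open>
  Monomials in a regular sequence are linearly independent modulo higher order: by
  quasi-regularity the derivatives have order \<open>d\<close>, so they vanish by induction, and Euler's
  formula gives the form back.
\<close>

lemma scalar_form_zero:
  "jet (range (\<lambda>c. scale c 1)) m d y Y \<Longrightarrow> y \<in> P m (Suc d) \<Longrightarrow> y = 0 \<and> (\<forall>i. Y i = 0)"
proof (induction d arbitrary: y Y)
  case 0
  have "(\<exists>c. y = scale c 1) \<and> (\<forall>i. Y i = 0)" using 0(1)
  proof (induction "0::nat" y Y rule: jet.induct)
    case (jet_add y Y z Z)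
    then obtain c c' where "y = scale c 1" "z = scale c' 1" "\<forall>i. Y i = 0" "\<forall>i. Z i = 0" by blast
    then show ?case by (auto simp: scale_left_distrib intro!: exI[of _ "c + c'"])
  qed (auto intro: exI[of _ 0])
  then show ?case using scalar_in_P 0(2) by auto
next
  case (Suc d)
  have J: "jet UNIV m (Suc d) y Y" by (rule jet_mono[OF Suc.prems(1)]) auto
  have "Y i = 0" for i
  proof -
    have "Y i \<in> P m (Suc d)"
      by (rule quasi_regularD[OF regular_imp_quasi_regular J Suc.prems(2)]) (rule regular)
    moreover obtain Z where "jet (range (\<lambda>c. scale c 1)) m d (Y i) Z"
      using jet_derivative[OF coeffs_scalars Suc.prems(1)] by blast
    ultimately show ?thesis using Suc.IH by blast
  qed
  moreover from this have "of_nat (Suc d) * y = 0" using jet_euler[OF J] by simp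
  then have "y = 0" by (rule of_nat_mult_cancel)
  ultimately show ?case by simp
qed

text \<open>
  The formal partial derivatives induce derivations from the algebra modulo order \<open>n + 1\<close> to the
  algebra modulo order \<open>n\<close>.
\<close>

lemma pjet_welldefined:
  assumes "pjet m y Y" "y \<in> P m (Suc n)"
  shows "Y i \<in> P m n"
proof -
  have "d \<le> Suc n \<Longrightarrow> jet_ge m d y Y" for d
  proof (induction d)
    case 0 then show ?case using pjet_jet_ge[OF assms(1)] by simp
  next
    case (Suc d)
    then have "jet_ge m d y Y" by simp
    then obtain z Z w W where z: "jet (range (\<lambda>c. scale c 1)) m d z Z" and w: "jet_ge m (Suc d) w W"
      and eq: "y = z + w" "Y = (\<lambda>i. Z i + W i)" using jet_ge_peel by blast
    have "w \<in> P m (Suc d)" using jet_ge_V[OF w] V_subset_P by blast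
    moreover have "y \<in> P m (Suc d)" using assms(2) P_antimono[OF Suc.prems] by blast
    ultimately have "y - w \<in> P m (Suc d)" using P_ideal(6) by blast
    then have "z \<in> P m (Suc d)" using eq by simp
    then have "z = 0" "\<And>i. Z i = 0" using scalar_form_zero[OF z] by auto
    then show ?case using w eq by simp
  qed
  from jet_ge_derivative_V[OF this[OF order_refl] refl] show ?thesis using V_subset_P by blast
qed

lemma jet_approx: "jet UNIV m n z Z \<Longrightarrow> \<exists>y Y. pjet m y Y \<and> z - y \<in> P m (Suc n)"
proof (induction rule: jet.induct)
  case (jet_const c)
  obtain t where "c - scale t 1 \<in> P m 1" using residue by blast
  then show ?case using pjet_const by auto
next
  case (jet_zero d)
  then show ?case using pjet_zero P_ideal(1) by (intro exI[of _ 0] exI[of _ "\<lambda>_. 0"]) auto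
next
  case (jet_add d y Y z Z)
  obtain y' Y' z' Z' where *: "pjet m y' Y'" "y - y' \<in> P m (Suc d)" "pjet m z' Z'" "z - z' \<in> P m (Suc d)"
    using jet_add.IH by blast
  have "(y + z) - (y' + z') \<in> P m (Suc d)" using P_ideal(2)[OF *(2,4)] by (simp add: algebra_simps)
  then show ?case using pjet_add[OF *(1,3)] by blast
next
  case (jet_letter d y Y j)
  obtain y' Y' where *: "pjet m y' Y'" "y - y' \<in> P m (Suc d)" using jet_letter.IH by blast
  have "b j * y - b j * y' \<in> P m (Suc (Suc d))"
    using P_letter[OF *(2) jet_letter.hyps(2)] by (simp add: right_diff_distrib)
  then show ?case using pjet_letter[OF *(1) jet_letter.hyps(2)] by blast
qed

text \<open>
  A denominator is a nonzero scalar up to an element of the point, so it can be divided out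
  modulo higher order.
\<close>

lemma P_approx:
  assumes "z \<in> P m n"
  shows "\<exists>y Y. pjet m y Y \<and> z - y \<in> P m (Suc n)"
proof -
  obtain s where s: "s \<in> S" "s * z \<in> V m n" using assms unfolding P_def by (rule satE)
  obtain c where c: "s - scale c 1 \<in> P m 1" using residue by blast
  have "c \<noteq> 0"
  proof
    assume "c = 0"
    then have "s * 1 \<in> P m 1" using c by simp
    then show False using P_cancel[OF s(1)] proper by blast
  qed
  obtain Z where "jet UNIV m n (s * z) Z" using s unfolding V_def by blast
  then obtain y Y where y: "pjet m y Y" "s * z - y \<in> P m (Suc n)" using jet_approx by blast
  have "(s - scale c 1) * z \<in> P m (Suc n)" using P_mult[OF c assms] by simp
  then have "(s * z - y) - (s - scale c 1) * z \<in> P m (Suc n)" using P_ideal(6) y(2) by blast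
  then have "scale c z - y \<in> P m (Suc n)" by (simp add: left_diff_distrib scale_mult_left)
  then have "scale (1/c) (scale c z - y) \<in> P m (Suc n)" by (rule P_ideal(8))
  then have "z - scale (1/c) y \<in> P m (Suc n)" using \<open>c \<noteq> 0\<close> by (simp add: scale_right_diff_distrib)
  then show ?thesis using pjet_scale[OF y(1)] by blast
qed

lemma pjet_approx: "\<exists>y Y. pjet m y Y \<and> a - y \<in> P m n"
proof (induction n)
  case 0 then show ?case using pjet_zero by auto
next
  case (Suc n)
  then obtain y Y where y: "pjet m y Y" "a - y \<in> P m n" by blast
  obtain z Z where z: "pjet m z Z" "(a - y) - z \<in> P m (Suc n)" using P_approx[OF y(2)] by blast
  then have "a - (y + z) \<in> P m (Suc n)" by (simp add: diff_diff_eq)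
  then show ?case using pjet_add[OF y(1) z(1)] by blast
qed

lemma pjet_approx_homogeneous:
  assumes "a \<in> gr k"
  shows "\<exists>y Y. pjet m y Y \<and> a - y \<in> P m n \<and> y \<in> gr k \<and> (\<forall>i. Y i \<in> gr (k + par i))"
proof -
  obtain y Y where y: "pjet m y Y" "a - y \<in> P m n" using pjet_approx by blast
  let ?h = "\<lambda>k x. scale (1/2) (x + koszul k * twist 1 x)"
  have "?h k (a - y) \<in> P m n"
    by (rule P_ideal(8), rule P_ideal(2), rule y(2), rule P_ideal(3), rule P_ideal(5), rule y(2))
  moreover have "?h k (a - y) = ?h k a - ?h k y"
    by (simp add: twist_diff scale_right_distrib scale_right_diff_distrib right_diff_distrib)
  ultimately have "a - ?h k y \<in> P m n" using homogeneous_part_id[OF assms] by simp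
  then show ?thesis using pjet_homogeneous_part[OF y(1)] by blast
qed

end

section \<open>Modules of functions, and derivations with prescribed values on generators\<close>

lemma sum_function_apply: "sum F A i = (\<Sum>j\<in>A. F j i)"
  by (induction A rule: infinite_finite_induct) auto

context operator_space
begin

lemma acc_on_mono: "acc_on Ts M' \<Longrightarrow> M \<subseteq> M' \<Longrightarrow> acc_on Ts M"
  unfolding acc_on_def by (meson subset_trans)

end

lemma (in char0_superalgebra) operator_space_functions: "operator_space (\<lambda>c f i. scale c (f i :: 'a))"
  by unfold_locales (auto simp: fun_eq_iff scale_right_distrib scale_left_distrib)

text \<open>
  Finite generation says that every element is the value of a polynomial in the letters.
\<close>

locale generators = letters scale gr x xpar
  for scale :: "'k::field_char_0 \<Rightarrow> 'a::ring_1 \<Rightarrow> 'a" and gr :: "bit \<Rightarrow> 'a set"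
    and x :: "nat \<Rightarrow> 'a" and xpar :: "nat \<Rightarrow> bit" +
  fixes N :: nat
  assumes generates: "\<exists>Y. pjet N a Y"
begin

sublocale Fun: operator_space "\<lambda>c (f :: 'i \<Rightarrow> 'a) i. scale c (f i)"
  by (rule operator_space_functions)

definition left_ops :: "(('i \<Rightarrow> 'a) \<Rightarrow> 'i \<Rightarrow> 'a) set" where
  "left_ops = (\<lambda>k f i. x k * f i) ` {..<N}"

definition right_ops :: "(('i \<Rightarrow> 'a) \<Rightarrow> 'i \<Rightarrow> 'a) set" where
  "right_ops = (\<lambda>k f i. f i * x k) ` {..<N}"

lemma generators_induct:
  assumes "\<And>c. Q (scale c 1)" "\<And>y z. Q y \<Longrightarrow> Q z \<Longrightarrow> Q (y + z)"
    and "\<And>k y. k < N \<Longrightarrow> Q y \<Longrightarrow> Q (x k * y)"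
  shows "Q a"
proof -
  obtain Y where "pjet N a Y" using generates by blast
  then show ?thesis by (induction rule: pjet.induct) (auto intro: assms)
qed

lemma left_stable_iff:
  "Fun.op_stable left_ops S \<longleftrightarrow>
     0 \<in> S \<and> (\<forall>f\<in>S. \<forall>g\<in>S. f + g \<in> S) \<and> (\<forall>f\<in>S. \<forall>a. (\<lambda>i. a * f i) \<in> S)" (is "?L \<longleftrightarrow> ?R")
proof
  assume S: ?L
  note sub = Fun.op_stableD(1)[OF S]
  have op: "(\<lambda>i. x k * f i) \<in> S" if "f \<in> S" "k < N" for f k
    using Fun.op_stableD(2)[OF S, of "\<lambda>f i. x k * f i" f] that by (auto simp: left_ops_def)
  have "(\<lambda>i. a * f i) \<in> S" if f: "f \<in> S" for f a
  proof (rule generators_induct[where Q = "\<lambda>a. (\<lambda>i. a * f i) \<in> S"])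
    show "(\<lambda>i. scale c 1 * f i) \<in> S" for c
      using Fun.subspace_scale[OF sub f, of c] by (simp add: scale_mult_left)
    show "(\<lambda>i. (y + z) * f i) \<in> S" if "(\<lambda>i. y * f i) \<in> S" "(\<lambda>i. z * f i) \<in> S" for y z
      using Fun.subspace_add[OF sub that] by (simp add: plus_fun_def distrib_right)
    show "(\<lambda>i. x k * y * f i) \<in> S" if "k < N" "(\<lambda>i. y * f i) \<in> S" for k y
      using op[OF that(2,1)] by (simp add: mult.assoc)
  qed
  then show ?R using Fun.subspace_0[OF sub] Fun.subspace_add[OF sub] by blast
next
  assume R: ?R
  have "Fun.subspace S"
  proof (rule Fun.subspaceI)
    fix c f assume "f \<in> S"
    then have "(\<lambda>i. scale c 1 * f i) \<in> S" using R by blast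
    then show "(\<lambda>i. scale c (f i)) \<in> S" by (simp add: scale_mult_left)
  qed (use R in auto)
  then show ?L using R unfolding Fun.op_stable_def left_ops_def by auto
qed

lemma right_stable_mult:
  assumes S: "Fun.op_stable right_ops S" and f: "f \<in> S"
  shows "(\<lambda>i. f i * a) \<in> S"
proof -
  note sub = Fun.op_stableD(1)[OF S]
  have op: "(\<lambda>i. f i * x k) \<in> S" if "f \<in> S" "k < N" for f k
    using Fun.op_stableD(2)[OF S, of "\<lambda>f i. f i * x k" f] that by (auto simp: right_ops_def)
  have "\<forall>f\<in>S. (\<lambda>i. f i * a) \<in> S"
  proof (rule generators_induct[where Q = "\<lambda>a. \<forall>f\<in>S. (\<lambda>i. f i * a) \<in> S"])
    show "\<forall>f\<in>S. (\<lambda>i. f i * scale c 1) \<in> S" for c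
      using Fun.subspace_scale[OF sub] by (auto simp: scale_mult_right)
    show "\<forall>f\<in>S. (\<lambda>i. f i * (y + z)) \<in> S" if "\<forall>f\<in>S. (\<lambda>i. f i * y) \<in> S" "\<forall>f\<in>S. (\<lambda>i. f i * z) \<in> S" for y z
      using Fun.subspace_add[OF sub] that by (fastforce simp: plus_fun_def distrib_left)
    show "\<forall>f\<in>S. (\<lambda>i. f i * (x k * y)) \<in> S" if "k < N" "\<forall>f\<in>S. (\<lambda>i. f i * y) \<in> S" for k y
      using op that by (force simp: mult.assoc[symmetric])
  qed
  then show ?thesis using f by blast
qed

lemma linear_function_op:
  assumes "\<And>f g. T (f + g) = T f + T g" "\<And>c f. T (\<lambda>i. scale c (f i)) = (\<lambda>i. scale c (T f i))"
  shows "Vector_Spaces.linear (\<lambda>c (f :: 'i \<Rightarrow> 'a) i. scale c (f i)) (\<lambda>c f i. scale c (f i)) T"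
  using assms by (intro Vector_Spaces.linear.intro module_hom.intro)
     (unfold_locales, auto)

lemma x_skew: "\<exists>\<epsilon>. \<epsilon> \<noteq> 0 \<and> (\<forall>a. x k * (x l * a) = scale \<epsilon> (x l * (x k * a))) \<and>
    (\<forall>a. a * x l * x k = scale \<epsilon> (a * x k * x l))"
proof (intro exI conjI allI)
  let ?e = "koszul (xpar k * xpar l) :: 'k"
  show "?e \<noteq> 0" by (simp add: koszul_def)
  have kl: "x k * x l = koszul (xpar k * xpar l) * (x l * x k)" by (rule supercommutative[OF b_gr b_gr])
  then have lk: "x l * x k = koszul (xpar k * xpar l) * (x k * x l)" by (simp add: koszul_square)
  show "x k * (x l * a) = scale ?e (x l * (x k * a))" for a
    using kl by (simp add: mult.assoc[symmetric] koszul_scale)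
  have "a * (x l * x k) = scale ?e (a * (x k * x l))" for a
    unfolding lk koszul_scale by (simp add: koszul_def)
  then show "a * x l * x k = scale ?e (a * x k * x l)" for a by (simp add: mult.assoc)
qed

definition functions_on :: "'i set \<Rightarrow> ('i \<Rightarrow> 'a) set" where
  "functions_on I = {f. \<forall>i. i \<notin> I \<longrightarrow> f i = 0}"

definition unit_at :: "'i \<Rightarrow> 'i \<Rightarrow> 'a" where
  "unit_at j = (\<lambda>i. if i = j then 1 else 0)"

lemma function_expansion: "finite I \<Longrightarrow> f \<in> functions_on I \<Longrightarrow> f = (\<Sum>j\<in>I. (\<lambda>i. f j * unit_at j i))"
  by (auto simp: fun_eq_iff functions_on_def unit_at_def sum_function_apply if_distrib[of "\<lambda>z. _ * z"] cong: if_cong)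

lemma function_expansion': "finite I \<Longrightarrow> f \<in> functions_on I \<Longrightarrow> f = (\<Sum>j\<in>I. (\<lambda>i. unit_at j i * f j))"
  by (auto simp: fun_eq_iff functions_on_def unit_at_def sum_function_apply if_distrib[of "\<lambda>z. z * _"] cong: if_cong)

lemma acc_left:
  assumes "finite I"
  shows "Fun.acc_on left_ops (functions_on I)"
proof (rule Fun.acc_on_mono)
  show "Fun.acc_on left_ops (Fun.op_stable left_ops hull (unit_at ` I))"
  proof (rule Fun.acc_on_skew_operators)
    show "\<exists>\<epsilon>. \<epsilon> \<noteq> 0 \<and> (\<forall>f. T' (T f) = (\<lambda>i. scale \<epsilon> (T (T' f) i)))" if mem: "T \<in> left_ops" "T' \<in> left_ops" for T T'
    proof -
      obtain k l where T: "T = (\<lambda>f i. x k * f i)" "T' = (\<lambda>f i. x l * f i)"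
        using mem unfolding left_ops_def by blast
      obtain \<epsilon> where "\<epsilon> \<noteq> 0" "\<And>a. x l * (x k * a) = scale \<epsilon> (x k * (x l * a))" using x_skew[of l k] by blast
      then show ?thesis unfolding T by auto
    qed
  qed (use assms in \<open>auto simp: left_ops_def fun_eq_iff distrib_left scale_mult_right intro!: linear_function_op\<close>)
  note st = Fun.op_stable_hull[of left_ops "unit_at ` I"]
  show "functions_on I \<subseteq> Fun.op_stable left_ops hull (unit_at ` I)"
  proof
    fix f assume f: "f \<in> functions_on I"
    have "(\<lambda>i. f j * unit_at j i) \<in> Fun.op_stable left_ops hull (unit_at ` I)" if "j \<in> I" for j
      using st[THEN left_stable_iff[THEN iffD1]] hull_inc[of "unit_at j" "unit_at ` I"] that by blast
    then have "(\<Sum>j\<in>I. (\<lambda>i. f j * unit_at j i)) \<in> Fun.op_stable left_ops hull (unit_at ` I)"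
      by (rule Fun.subspace_sum[OF Fun.op_stableD(1)[OF st]])
    then show "f \<in> Fun.op_stable left_ops hull (unit_at ` I)" using function_expansion[OF assms f] by simp
  qed
qed

lemma acc_right:
  assumes "finite I"
  shows "Fun.acc_on right_ops (functions_on I)"
proof (rule Fun.acc_on_mono)
  show "Fun.acc_on right_ops (Fun.op_stable right_ops hull (unit_at ` I))"
  proof (rule Fun.acc_on_skew_operators)
    show "\<exists>\<epsilon>. \<epsilon> \<noteq> 0 \<and> (\<forall>f. T' (T f) = (\<lambda>i. scale \<epsilon> (T (T' f) i)))" if mem: "T \<in> right_ops" "T' \<in> right_ops" for T T'
    proof -
      obtain k l where T: "T = (\<lambda>f i. f i * x k)" "T' = (\<lambda>f i. f i * x l)"
        using mem unfolding right_ops_def by blast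
      obtain \<epsilon> where "\<epsilon> \<noteq> 0" "\<And>a. a * x k * x l = scale \<epsilon> (a * x l * x k)" using x_skew[of l k] by blast
      then show ?thesis unfolding T by auto
    qed
  qed (use assms in \<open>auto simp: right_ops_def fun_eq_iff distrib_right scale_mult_left intro!: linear_function_op\<close>)
  note st = Fun.op_stable_hull[of right_ops "unit_at ` I"]
  show "functions_on I \<subseteq> Fun.op_stable right_ops hull (unit_at ` I)"
  proof
    fix f assume f: "f \<in> functions_on I"
    have "(\<lambda>i. unit_at j i * f j) \<in> Fun.op_stable right_ops hull (unit_at ` I)" if "j \<in> I" for j
      using right_stable_mult[OF st] hull_inc[of "unit_at j" "unit_at ` I"] that by blast
    then have "(\<Sum>j\<in>I. (\<lambda>i. unit_at j i * f j)) \<in> Fun.op_stable right_ops hull (unit_at ` I)"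
      by (rule Fun.subspace_sum[OF Fun.op_stableD(1)[OF st]])
    then show "f \<in> Fun.op_stable right_ops hull (unit_at ` I)" using function_expansion'[OF assms f] by simp
  qed
qed

text \<open>
  Values \<open>u k\<close> on the generators extend to a derivation as soon as they kill the gradients of all
  relations.  Parity of \<open>u k\<close> makes the formula \<open>\<Sum> u k * Y k\<close> satisfy the graded Leibniz rule.
\<close>

lemma derivation_of_values:
  assumes u: "\<And>k. u k \<in> gr (\<pi> + xpar k)"
    and rel: "\<And>Y. pjet N 0 Y \<Longrightarrow> (\<Sum>k<N. u k * Y k) = 0"
  obtains D where "D \<in> Der scale gr \<pi>" "\<And>y Y. pjet N y Y \<Longrightarrow> D y = (\<Sum>k<N. u k * Y k)"
proof -
  define D where "D y = (\<Sum>k<N. u k * (SOME Y. pjet N y Y) k)" for y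
  have D: "D y = (\<Sum>k<N. u k * Y k)" if Y: "pjet N y Y" for y Y
  proof -
    have "pjet N y (SOME Y. pjet N y Y)" using Y by (rule someI[where P = "\<lambda>Y. pjet N y Y"])
    from pjet_diff[OF this Y] rel have "(\<Sum>k<N. u k * ((SOME Y. pjet N y Y) k - Y k)) = 0" by simp
    then show ?thesis unfolding D_def by (simp add: right_diff_distrib sum_subtractf)
  qed
  have add: "D (y + z) = D y + D z" for y z
  proof -
    obtain Y Z where Y: "pjet N y Y" and Z: "pjet N z Z" using generates by blast
    show ?thesis using D[OF pjet_add[OF Y Z]] by (simp add: D[OF Y] D[OF Z] distrib_left sum.distrib)
  qed
  have sc: "D (scale c y) = scale c (D y)" for c y
  proof -
    obtain Y where Y: "pjet N y Y" using generates by blast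
    show ?thesis using D[OF pjet_scale[OF Y]] by (simp add: D[OF Y] scale_mult_right scale_sum_right)
  qed
  have hom: "D y \<in> gr (\<pi> + j)" if "y \<in> gr j" for y j
  proof -
    let ?h = "\<lambda>k x. scale (1/2) (x + koszul k * twist 1 x)"
    obtain Y where Y: "pjet N y Y" using generates by blast
    have Dy: "D y = (\<Sum>k<N. u k * ?h (j + xpar k) (Y k))"
      using D[OF pjet_homogeneous_part(1)[OF Y, of j]] homogeneous_part_id[OF that] by simp
    have "u k * ?h (j + xpar k) (Y k) \<in> gr ((\<pi> + xpar k) + (j + xpar k))" for k
      by (intro mult_gr u pjet_homogeneous_part(2)[OF Y])
    moreover have "(\<pi> + xpar k) + (j + xpar k) = \<pi> + j" for k by (cases "xpar k") auto
    ultimately have "u k * ?h (j + xpar k) (Y k) \<in> gr (\<pi> + j)" for k by metis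
    then show ?thesis unfolding Dy by (rule gr_sum_mem)
  qed
  have leib: "D (y * z) = D y * z + koszul (\<pi> * j) * (y * D z)" if y: "y \<in> gr j" for y z j
  proof -
    obtain Y Z where Y: "pjet N y Y" and Z: "pjet N z Z" using generates by blast
    have c: "u k * (twist (xpar k) y * Z k) = koszul (\<pi> * j) * (y * (u k * Z k))" for k
    proof -
      have "u k * y = koszul ((\<pi> + xpar k) * j) * (y * u k)" by (rule supercommutative[OF u y])
      then have "u k * (twist (xpar k) y) = koszul (\<pi> * j) * (y * u k)"
        using twist_homogeneous[OF y, of "xpar k"] by (cases \<pi>; cases j; cases "xpar k") (auto simp: koszul_def)
      then show ?thesis by (simp add: mult.assoc[symmetric])
    qed
    have "D (y * z) = (\<Sum>k<N. u k * (Y k * z + twist (xpar k) y * Z k))" by (rule D[OF pjet_mult[OF Y Z]])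
    also have "\<dots> = (\<Sum>k<N. u k * Y k * z + koszul (\<pi> * j) * (y * (u k * Z k)))"
      by (simp only: distrib_left c mult.assoc)
    also have "\<dots> = D y * z + koszul (\<pi> * j) * (y * D z)"
      unfolding D[OF Y] D[OF Z] by (simp only: sum.distrib sum_distrib_left sum_distrib_right)
    finally show ?thesis .
  qed
  have "Vector_Spaces.linear scale scale D"
    by (intro Vector_Spaces.linear.intro module_hom.intro) (unfold_locales, auto simp: add sc)
  then have "D \<in> Der scale gr \<pi>"
    unfolding Der_def mem_Collect_eq using hom leib by (intro conjI allI ballI image_subsetI)
  then show thesis using that D by blast
qed

end

section \<open>An intersection lemma of Krull type\<close>

context char0_superalgebra
begin

lemma DerD:
  assumes "D \<in> Der scale gr i"
  shows Der_add: "D (x + y) = D x + D y" and Der_scale: "D (scale c x) = scale c (D x)"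
    and Der_zero: "D 0 = 0"
    and Der_diff: "D (x - y) = D x - D y"
    and Der_sum: "D (sum f A) = (\<Sum>a\<in>A. D (f a))"
    and Der_gr: "a \<in> gr j \<Longrightarrow> D a \<in> gr (i + j)"
    and Der_leibniz: "a \<in> gr j \<Longrightarrow> D (a * z) = D a * z + koszul (i * j) * (a * D z)"
proof -
  have lin: "Vector_Spaces.linear scale scale D" using assms by (simp add: Der_def)
  note r = linear_map_rules[OF lin]
  show "D (x + y) = D x + D y" "D (scale c x) = scale c (D x)" "D 0 = 0" "D (sum f A) = (\<Sum>a\<in>A. D (f a))"
    by (rule r)+
  show "D (x - y) = D x - D y" using r(1)[of x "scale (- 1) y"] r(2)[of "- 1" y] by simp
  show "a \<in> gr j \<Longrightarrow> D a \<in> gr (i + j)" using assms unfolding Der_def by blast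
  show "a \<in> gr j \<Longrightarrow> D (a * z) = D a * z + koszul (i * j) * (a * D z)" using assms by (simp add: Der_def)
qed

lemma Der_even_scalar: "D \<in> Der scale gr i \<Longrightarrow> s \<in> gr 0 \<Longrightarrow> D (s * z) = D s * z + s * D z"
  using Der_leibniz[of D i s 0 z] by (simp add: koszul_def)

end

context localized_letters
begin

lemma sat_common_denominator:
  assumes I: "finite I" "\<And>i. i \<in> I \<Longrightarrow> h i \<in> sat J" and J: "\<And>a x. x \<in> J \<Longrightarrow> a * x \<in> J"
  shows "\<exists>s\<in>S. \<forall>i\<in>I. s * h i \<in> J"
  using I
proof (induction I)
  case empty then show ?case using one_S by auto
next
  case (insert j I)
  then obtain s where s: "s \<in> S" "\<forall>i\<in>I. s * h i \<in> J" by auto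
  obtain t where t: "t \<in> S" "t * h j \<in> J" using insert.prems[of j] by (auto elim: satE)
  have "(t * s) * h i = t * (s * h i)" "(t * s) * h i = s * (t * h i)" for i
    using S_central[OF t(1), of s] by (auto simp: mult.assoc[symmetric])
  then show ?case using s t J mult_S by (metis insert_iff)
qed

lemma V_Suc_letters:
  "z \<in> V (Suc m) (n + t) \<Longrightarrow> \<exists>v w. v \<in> V m (Suc n) \<and> z = v + b m ^ t * w"
proof (induction t arbitrary: z)
  case 0 show ?case by (intro exI[of _ 0] exI[of _ z]) (simp add: V_zero)
next
  case (Suc t)
  then obtain Z where "jet UNIV (Suc m) (Suc (n + t)) z Z" unfolding V_def by auto
  from jet_split[OF this] obtain g G h H where *: "jet UNIV m (Suc (n + t)) g G"
    "jet UNIV (if par m = 0 then Suc m else m) (n + t) h H" "z = g + b m * h" by auto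
  have "jet UNIV (Suc m) (n + t) h H" by (rule jet_mono[OF *(2)]) auto
  then obtain v w where vw: "v \<in> V m (Suc n)" "h = v + b m ^ t * w" using Suc.IH VI by blast
  have "g \<in> V m (Suc n)" using VI[OF *(1)] V_antimono[of "Suc n" "Suc (n + t)" m] by auto
  then have "g + b m * v \<in> V m (Suc n)" using vw(1) V_add V_mult_left by blast
  moreover have "z = (g + b m * v) + b m ^ Suc t * w"
    using *(3) vw(2) by (simp add: distrib_left mult.assoc add.assoc)
  ultimately show ?case by blast
qed

text \<open>
  The letters are treated one after the other: by \<open>V_Suc_letters\<close>, a high power of the ideal of the
  letters lies in a power of the ideal of the preceding letters plus the multiples of a power of the
  last one.
\<close>

lemma V_subset_of_letter_powers:
  assumes Q: "\<And>x y. x \<in> Q \<Longrightarrow> y \<in> Q \<Longrightarrow> x + y \<in> Q" "\<And>x a. x \<in> Q \<Longrightarrow> x * a \<in> Q" "0 \<in> Q"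
  shows "(\<And>j. j < m \<Longrightarrow> \<exists>t. b j ^ t \<in> Q) \<Longrightarrow> \<exists>n. V m n \<subseteq> Q"
proof (induction m)
  case 0
  have "y = 0" if y: "y \<in> V 0 1" for y
  proof -
    obtain Y where "jet UNIV 0 1 y Y" using y unfolding V_def by blast
    from jet_euler[OF this] show ?thesis by simp
  qed
  then show ?case using Q(3) by blast
next
  case (Suc m)
  then obtain n where n: "V m n \<subseteq> Q" by fastforce
  obtain t where t: "b m ^ t \<in> Q" using Suc.prems by blast
  have "V (Suc m) (n + t) \<subseteq> Q"
  proof
    fix z assume "z \<in> V (Suc m) (n + t)"
    then obtain v w where "v \<in> V m (Suc n)" "z = v + b m ^ t * w" using V_Suc_letters by blast
    then show "z \<in> Q" using n t Q V_Suc_subset by blast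
  qed
  then show ?case by blast
qed

end

locale generated_point = regular_point scale gr b par S m + Gen: generators scale gr x xpar N
  for scale :: "'k::field_char_0 \<Rightarrow> 'a::ring_1 \<Rightarrow> 'a" and gr :: "bit \<Rightarrow> 'a set"
    and b :: "nat \<Rightarrow> 'a" and par :: "nat \<Rightarrow> bit" and S :: "'a set" and m :: nat
    and x :: "nat \<Rightarrow> 'a" and xpar :: "nat \<Rightarrow> bit" and N :: nat
begin

lemma b_in_P: "j < m \<Longrightarrow> b j \<in> P m 1"
  using P_letter[of 1 m 0 j] by simp

text \<open>
  The multiples \<open>q * y\<close>, with \<open>q\<close> in the point, are added to \<open>W\<close>; if \<open>y\<close> were not in
  the resulting module, choose \<open>C\<close> above it maximal without \<open>y\<close>.  For an even letter the modules
  of functions that its \<open>t\<close>-th power maps into \<open>C\<close> become stationary, and then \<open>y\<close> cannot lie in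
  \<open>C\<close> plus the multiples of that power: otherwise multiplication by the letter once more would put
  \<open>y\<close> into \<open>C\<close>.  By maximality a power of each letter, hence a power of their ideal, maps all functions
  into \<open>C\<close>; with the hypothesis this forces \<open>y\<close> into \<open>C\<close>.
\<close>

theorem krull:
  fixes I :: "'i set"
  assumes I: "finite I" and W: "Gen.Fun.op_stable Gen.left_ops W" "W \<subseteq> Gen.functions_on I"
    and y: "y \<in> Gen.functions_on I"
    and close: "\<And>n. \<exists>w\<in>W. \<forall>i. y i - w i \<in> P m n"
  shows "\<exists>q\<in>P m 1. (\<lambda>i. y i - q * y i) \<in> W"
proof -
  let ?M = "Gen.functions_on I"
  note stable = Gen.left_stable_iff[THEN iffD1, rule_format]
  \<comment> \<open>once \<open>q * y\<close> is in the module for all \<open>q\<close>, only \<open>y\<close> itself is in question\<close>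
  define W1 where "W1 = {(\<lambda>i. w i + q * y i) |w q. w \<in> W \<and> q \<in> P m 1}"
  have W1I: "(\<lambda>i. w i + q * y i) \<in> W1" if "w \<in> W" "q \<in> P m 1" for w q
    using that unfolding W1_def by blast
  have W1: "Gen.Fun.op_stable Gen.left_ops W1"
    unfolding Gen.left_stable_iff
  proof (intro conjI ballI allI)
    have "(\<lambda>i. 0 i + 0 * y i) \<in> W1" by (rule W1I) (use stable[OF W(1)] P_ideal(1) in auto)
    then show "0 \<in> W1" by (simp add: zero_fun_def)
    fix f assume "f \<in> W1"
    then obtain w q where f: "f = (\<lambda>i. w i + q * y i)" "w \<in> W" "q \<in> P m 1" unfolding W1_def by blast
    show "f + g \<in> W1" if g: "g \<in> W1" for g
    proof -
      obtain w' q' where g': "g = (\<lambda>i. w' i + q' * y i)" "w' \<in> W" "q' \<in> P m 1" using g unfolding W1_def by blast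
      have "f + g = (\<lambda>i. (w + w') i + (q + q') * y i)" unfolding f g' by (auto simp: algebra_simps)
      also have "\<dots> \<in> W1" using W1I[of "w + w'" "q + q'"] stable[OF W(1)] P_ideal(2) f g' by blast
      finally show ?thesis .
    qed
    fix a
    have "(\<lambda>i. a * f i) = (\<lambda>i. (\<lambda>i. a * w i) i + (a * q) * y i)" unfolding f by (auto simp: algebra_simps mult.assoc)
    also have "\<dots> \<in> W1" by (rule W1I) (use stable[OF W(1)] P_ideal(3) f in auto)
    finally show "(\<lambda>i. a * f i) \<in> W1" .
  qed
  have W1M: "W1 \<subseteq> ?M" using W(2) y unfolding W1_def Gen.functions_on_def by auto
  have WW1: "W \<subseteq> W1"
  proof
    fix w assume "w \<in> W"
    then have "(\<lambda>i. w i + 0 * y i) \<in> W1" by (rule W1I) (use P_ideal(1) in auto)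
    then show "w \<in> W1" by simp
  qed
  have qyW1: "(\<lambda>i. q * y i) \<in> W1" if "q \<in> P m 1" for q
  proof -
    have "(\<lambda>i. 0 i + q * y i) \<in> W1" by (rule W1I) (use that stable[OF W(1)] in auto)
    then show ?thesis by simp
  qed
  show ?thesis
  proof (cases "y \<in> W1")
    case True
    then obtain w q where "y = (\<lambda>i. w i + q * y i)" "w \<in> W" "q \<in> P m 1" unfolding W1_def by blast
    moreover from this(1) have "y i - q * y i = w i" for i
      by (metis add_diff_cancel_right')
    then have "(\<lambda>i. y i - q * y i) = w" by (rule ext)
    ultimately show ?thesis by blast
  next
    case False
    obtain C where C: "Gen.Fun.op_stable Gen.left_ops C" "W1 \<subseteq> C" "C \<subseteq> ?M" "y \<notin> C"
      and max: "\<And>C'. Gen.Fun.op_stable Gen.left_ops C' \<Longrightarrow> C \<subseteq> C' \<Longrightarrow> C' \<subseteq> ?M \<Longrightarrow> y \<notin> C' \<Longrightarrow> C' = C"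
      by (rule Gen.Fun.acc_on_maximal[OF Gen.acc_left[OF I] W1 W1M, of "\<lambda>C. y \<notin> C"]) (use False in blast)+
    note C0 = stable[OF C(1)]
    have Mst: "Gen.Fun.op_stable Gen.left_ops ?M"
      unfolding Gen.left_stable_iff Gen.functions_on_def by auto
    define Q where "Q = {a. \<forall>f\<in>?M. (\<lambda>i. a * f i) \<in> C}"
    have "\<exists>t. b j ^ t \<in> Q" if j: "j < m" for j
    proof (cases "par j = 0")
      case False
      then have "par j = 1" by (cases "par j") auto
      then have "b j ^ 2 = 0" using odd_square[of "b j"] b_gr[of j] by (simp add: power2_eq_square)
      then have "b j ^ 2 \<in> Q" unfolding Q_def using C0 by (auto simp: zero_fun_def)
      then show ?thesis ..
    next
      case True
      then have ev: "b j ^ t \<in> gr 0" for t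
        using b_gr[of j] one_gr mult_gr[of _ 0 _ 0] by (induction t) auto
      have cent: "b j ^ t * a = a * b j ^ t" for t a by (rule even_central[OF ev])
      define D where "D t = {f \<in> ?M. (\<lambda>i. b j ^ t * f i) \<in> C}" for t
      have Dst: "Gen.Fun.op_stable Gen.left_ops (D t)" for t
        unfolding Gen.left_stable_iff
      proof (intro conjI ballI allI)
        show "0 \<in> D t" unfolding D_def using C0 stable[OF Mst] by (simp add: zero_fun_def)
        fix f assume f: "f \<in> D t"
        show "f + g \<in> D t" if g: "g \<in> D t" for g
        proof -
          have "(\<lambda>i. b j ^ t * (f + g) i) = (\<lambda>i. b j ^ t * f i) + (\<lambda>i. b j ^ t * g i)"
            by (auto simp: distrib_left)
          then show ?thesis using f g C0 stable[OF Mst] unfolding D_def by auto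
        qed
        fix a
        have "(\<lambda>i. b j ^ t * (a * f i)) = (\<lambda>i. a * (b j ^ t * f i))"
          using cent[of t a] by (auto simp: mult.assoc[symmetric])
        then show "(\<lambda>i. a * f i) \<in> D t" using f C0 stable[OF Mst] unfolding D_def by auto
      qed
      have "D t \<subseteq> D (Suc t)" for t
      proof
        fix f assume "f \<in> D t"
        then have "f \<in> ?M" "(\<lambda>i. b j * (b j ^ t * f i)) \<in> C" using C0 unfolding D_def by auto
        then show "f \<in> D (Suc t)" unfolding D_def by (simp add: mult.assoc)
      qed
      then have "incseq D" by (rule incseq_SucI)
      moreover have "\<forall>t. Gen.Fun.op_stable Gen.left_ops (D t) \<and> D t \<subseteq> ?M" using Dst unfolding D_def by blast
      ultimately obtain t where t: "\<forall>k\<ge>t. D k = D t"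
        using Gen.acc_left[OF I] unfolding Gen.Fun.acc_on_def by meson
      \<comment> \<open>maximality gives \<open>C' = C\<close> unless \<open>y\<close> is in \<open>C'\<close>, which stationarity of \<open>D\<close> excludes\<close>
      define C' where "C' = {c + (\<lambda>i. b j ^ t * f i) |c f. c \<in> C \<and> f \<in> ?M}"
      have C'I: "c \<in> C \<Longrightarrow> f \<in> ?M \<Longrightarrow> c + (\<lambda>i. b j ^ t * f i) \<in> C'" for c f unfolding C'_def by blast
      have "C' = C"
      proof (rule max)
        show "C \<subseteq> C'"
        proof
          fix c assume "c \<in> C"
          then have "c + (\<lambda>i. b j ^ t * 0 i) \<in> C'" by (rule C'I) (use stable[OF Mst] in blast)
          moreover have "c + (\<lambda>i. b j ^ t * 0 i) = c" by auto
          ultimately show "c \<in> C'" by simp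
        qed
        show "C' \<subseteq> ?M" using C(3) unfolding C'_def Gen.functions_on_def by fastforce
        show "Gen.Fun.op_stable Gen.left_ops C'"
          unfolding Gen.left_stable_iff
        proof (intro conjI ballI allI)
          show "0 \<in> C'" using \<open>C \<subseteq> C'\<close> C0 by blast
          fix h assume "h \<in> C'"
          then obtain c f where h: "h = c + (\<lambda>i. b j ^ t * f i)" "c \<in> C" "f \<in> ?M" unfolding C'_def by blast
          show "h + h' \<in> C'" if h': "h' \<in> C'" for h'
          proof -
            obtain c' f' where h'': "h' = c' + (\<lambda>i. b j ^ t * f' i)" "c' \<in> C" "f' \<in> ?M"
              using h' unfolding C'_def by blast
            have "h + h' = (c + c') + (\<lambda>i. b j ^ t * (f + f') i)" unfolding h h'' by (auto simp: algebra_simps)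
            also have "\<dots> \<in> C'" using C'I[of "c + c'" "f + f'"] C0 stable[OF Mst] h h'' by blast
            finally show ?thesis .
          qed
          fix a
          have "(\<lambda>i. a * h i) = (\<lambda>i. a * c i) + (\<lambda>i. b j ^ t * (\<lambda>i. a * f i) i)"
            unfolding h using cent[of t a] by (auto simp: distrib_left mult.assoc[symmetric])
          also have "\<dots> \<in> C'" by (rule C'I) (use C0 stable[OF Mst] h in auto)
          finally show "(\<lambda>i. a * h i) \<in> C'" .
        qed
        show "y \<notin> C'"
        proof
          assume "y \<in> C'"
          then obtain c f where yc: "y = c + (\<lambda>i. b j ^ t * f i)" "c \<in> C" "f \<in> ?M" unfolding C'_def by blast
          have "(\<lambda>i. b j * y i) \<in> C" using qyW1[OF b_in_P[OF j]] C(2) by blast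
          then have "(\<lambda>i. b j * y i) + (\<lambda>i. (- b j) * c i) \<in> C" using C0 yc(2) by blast
          moreover have "(\<lambda>i. b j * y i) + (\<lambda>i. (- b j) * c i) = (\<lambda>i. b j ^ Suc t * f i)"
            unfolding yc by (auto simp: distrib_left mult.assoc)
          ultimately have "(\<lambda>i. b j ^ Suc t * f i) \<in> C" by (simp only:)
          then have "f \<in> D (Suc t)" unfolding D_def using yc(3) by blast
          moreover have "D (Suc t) = D t" using t by (meson le_SucI order_refl)
          ultimately have "(\<lambda>i. b j ^ t * f i) \<in> C" unfolding D_def by blast
          then have "y \<in> C" unfolding yc(1) using C0 yc(2) by blast
          then show False using C(4) by blast
        qed
      qed
      have "b j ^ t \<in> Q"
        unfolding Q_def
      proof (intro CollectI ballI)
        fix f assume "f \<in> ?M"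
        then have "0 + (\<lambda>i. b j ^ t * f i) \<in> C'" using C'I C0 by blast
        then show "(\<lambda>i. b j ^ t * f i) \<in> C" using \<open>C' = C\<close> by simp
      qed
      then show ?thesis ..
    qed
    moreover have "a + a' \<in> Q" if "a \<in> Q" "a' \<in> Q" for a a'
      unfolding Q_def
    proof (intro CollectI ballI)
      fix f assume "f \<in> ?M"
      then have "(\<lambda>i. a * f i) + (\<lambda>i. a' * f i) \<in> C" using that C0 unfolding Q_def by blast
      then show "(\<lambda>i. (a + a') * f i) \<in> C" by (simp add: plus_fun_def distrib_right)
    qed
    moreover have "a * a' \<in> Q" if "a \<in> Q" for a a'
      using that stable[OF Mst] unfolding Q_def by (auto simp: mult.assoc)
    moreover have "0 \<in> Q" unfolding Q_def using C0 by (simp add: zero_fun_def)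
    ultimately obtain n where n: "V m n \<subseteq> Q" using V_subset_of_letter_powers[of Q m] by blast
    obtain w where w: "w \<in> W" "\<forall>i. y i - w i \<in> P m n" using close by blast
    obtain s where s: "s \<in> S" "\<forall>i\<in>I. s * (y i - w i) \<in> V m n"
      using sat_common_denominator[OF I, of "\<lambda>i. y i - w i" "V m n"] w(2) V_mult_left unfolding P_def by blast
    have hM: "(\<lambda>i. s * (y i - w i)) \<in> ?M" using y w W(2) unfolding Gen.functions_on_def by auto
    have expand: "(\<lambda>i. s * (y i - w i)) = (\<Sum>j\<in>I. (\<lambda>i. (s * (y j - w j)) * Gen.unit_at j i))"
      by (rule Gen.function_expansion[OF I hM])
    have mem: "(\<lambda>i. (s * (y j - w j)) * Gen.unit_at j i) \<in> C" if "j \<in> I" for j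
    proof -
      have "Gen.unit_at j \<in> ?M" using that unfolding Gen.unit_at_def Gen.functions_on_def by auto
      then show ?thesis using s(2) n that unfolding Q_def by blast
    qed
    have 1: "(\<lambda>i. s * (y i - w i)) \<in> C"
      unfolding expand by (rule Gen.Fun.subspace_sum[OF Gen.Fun.op_stableD(1)[OF C(1)]]) (rule mem)
    have 2: "(\<lambda>i. s * w i) \<in> C" using C0 w(1) WW1 C(2) by blast
    obtain c where c: "s - scale c 1 \<in> P m 1" using residue by blast
    have "c \<noteq> 0"
    proof
      assume "c = 0"
      then have "s * 1 \<in> P m 1" using c by simp
      then show False using P_cancel[OF s(1)] proper by blast
    qed
    have 3: "(\<lambda>i. - (s - scale c 1) * y i) \<in> C" using qyW1[OF P_ideal(7)[OF c]] C(2) by blast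
    have "(\<lambda>i. s * (y i - w i)) + (\<lambda>i. s * w i) + (\<lambda>i. - (s - scale c 1) * y i) = (\<lambda>i. scale c (y i))"
      by (auto simp: algebra_simps scale_mult_left)
    then have "(\<lambda>i. scale c (y i)) \<in> C" using C0 1 2 3 by metis
    then have "(\<lambda>i. scale (1/c) (scale c (y i))) \<in> C"
      by (rule Gen.Fun.subspace_scale[OF Gen.Fun.op_stableD(1)[OF C(1)]])
    then have "y \<in> C" using \<open>c \<noteq> 0\<close> by simp
    then show ?thesis using C(4) by blast
  qed
qed

end

section \<open>Vector fields dual to a regular sequence\<close>

context generated_point
begin

text \<open>
  The chain rule holds modulo order \<open>n\<close> because the product rule for jets does; the parity of \<open>v k\<close> makes
  the signs agree.  For a relation between the generators \<open>Y i\<close> can be taken to be \<open>0\<close>, so \<open>v\<close> is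
  an approximate solution of the equations for a derivation.
\<close>

lemma truncated_chain_rule:
  assumes v: "\<And>k. v k \<in> gr (xpar k + par i)"
    and app: "\<And>k. k < N \<Longrightarrow> \<exists>y Y. pjet m y Y \<and> x k - y \<in> P m (Suc n) \<and> Y i = v k"
    and z: "Gen.pjet N z Z" and y: "pjet m y Y" "z - y \<in> P m (Suc n)"
  shows "Y i - (\<Sum>k<N. v k * Z k) \<in> P m n"
proof -
  have "\<exists>y Y. pjet m y Y \<and> z - y \<in> P m (Suc n) \<and> Y i - (\<Sum>k<N. v k * Z k) \<in> P m n" using z
  proof (induction rule: Gen.pjet.induct)
    case (pjet_const c)
    then show ?case using pjet.pjet_const[of m c] P_ideal(1) by force
  next
    case (pjet_add y Y z Z)
    obtain y' Y' z' Z' where *: "pjet m y' Y'" "y - y' \<in> P m (Suc n)" "Y' i - (\<Sum>k<N. v k * Y k) \<in> P m n"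
      "pjet m z' Z'" "z - z' \<in> P m (Suc n)" "Z' i - (\<Sum>k<N. v k * Z k) \<in> P m n"
      using pjet_add.IH by blast
    show ?case
      using pjet.pjet_add[OF *(1,4)] P_ideal(2)[OF *(2,5)] P_ideal(2)[OF *(3,6)]
      by (intro exI conjI) (auto simp: algebra_simps sum.distrib)
  next
    case (pjet_letter z Z j)
    obtain y Y where y: "pjet m y Y" "z - y \<in> P m (Suc n)" "Y i - (\<Sum>k<N. v k * Z k) \<in> P m n"
      using pjet_letter.IH by blast
    obtain w W where w: "pjet m w W" "x j - w \<in> P m (Suc n)" "W i = v j" using app pjet_letter.hyps(2) by blast
    let ?t = "twist (par i)"
    have eq1: "x j * z - w * y = (x j - w) * z + w * (z - y)" by (simp add: algebra_simps)
    have 1: "x j * z - w * y \<in> P m (Suc n)"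
      unfolding eq1 by (intro P_ideal(2) P_ideal(3) P_ideal(4) w y)
    have c: "v k * (twist (xpar k) (x j) * a) = ?t (x j) * (v k * a)" for k a
    proof -
      have "v k * x j = koszul ((xpar k + par i) * xpar j) * (x j * v k)"
        by (rule supercommutative[OF v Gen.b_gr])
      then have "v k * twist (xpar k) (x j) = ?t (x j) * v k"
        unfolding Gen.twist_b by (cases "xpar k"; cases "par i"; cases "xpar j") (auto simp: koszul_def)
      then show ?thesis by (simp add: mult.assoc[symmetric])
    qed
    have "(\<Sum>k<N. v k * ((if k = j then z else 0) + twist (xpar k) (x j) * Z k)) =
        (\<Sum>k<N. (if k = j then v j * z else 0) + ?t (x j) * (v k * Z k))"
      by (rule sum.cong[OF refl]) (simp add: distrib_left c)
    also have "\<dots> = v j * z + ?t (x j) * (\<Sum>k<N. v k * Z k)"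
      using pjet_letter.hyps(2) by (simp add: sum.distrib sum_distrib_left)
    finally have eq2: "(W i * y + ?t w * Y i) - (\<Sum>k<N. v k * ((if k = j then z else 0) + twist (xpar k) (x j) * Z k))
       = ?t w * (Y i - (\<Sum>k<N. v k * Z k)) - (v j * (z - y) + ?t (x j - w) * (\<Sum>k<N. v k * Z k))"
      by (simp add: w(3) algebra_simps twist_diff)
    have sub: "P m (Suc n) \<subseteq> P m n" by (rule P_antimono) simp
    have "(W i * y + ?t w * Y i) - (\<Sum>k<N. v k * ((if k = j then z else 0) + twist (xpar k) (x j) * Z k)) \<in> P m n"
      unfolding eq2
      by (intro P_ideal(6) P_ideal(2) P_ideal(3)[OF y(3)] P_ideal(3) P_ideal(4) P_ideal(5) subsetD[OF sub] y(2) w(2))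
    then show ?case using pjet_mult[OF w(1) y(1)] 1 by blast
  qed
  then obtain y' Y' where y': "pjet m y' Y'" "z - y' \<in> P m (Suc n)" "Y' i - (\<Sum>k<N. v k * Z k) \<in> P m n" by blast
  have "(z - y') - (z - y) \<in> P m (Suc n)" by (rule P_ideal(6)[OF y'(2) y(2)])
  then have "y - y' \<in> P m (Suc n)" by simp
  then have "Y i - Y' i \<in> P m n" using pjet_welldefined[OF pjet_diff[OF y(1) y'(1)]] by blast
  then have "(Y i - Y' i) + (Y' i - (\<Sum>k<N. v k * Z k)) \<in> P m n" using y'(3) by (rule P_ideal(2))
  then show ?thesis by simp
qed

text \<open>
  Let \<open>v n k\<close> be the formal derivative by \<open>b i\<close> of the \<open>k\<close>-th generator, modulo order \<open>n\<close>.  The gradients of the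
  relations form a right submodule, so finitely many of them, \<open>R0\<close>, give all the equations.
  With \<open>\<Phi>\<close> the left-linear map given by these equations and \<open>W\<close> the image of the vectors with entries in the
  point, \<open>\<Phi> (v 1)\<close> lies in \<open>W\<close> up to order \<open>n\<close> for each \<open>n\<close>, because \<open>\<Phi> (v n)\<close> has order \<open>n\<close> and \<open>v 1 - v n\<close> has
  entries in the point.  By \<open>krull\<close> an exact solution is congruent to \<open>v 1\<close>; its part of
  the right parity is still a solution, as the gradients are stable under the twist.
\<close>

theorem dual_derivation:
  assumes i: "i < m"
  shows "\<exists>D\<in>Der scale gr (par i). \<forall>j<m. D (b j) - (if i = j then 1 else 0) \<in> P m 1"
proof -
  have "\<forall>n k. \<exists>c. c \<in> gr (xpar k + par i) \<and>
      (\<exists>y Y. pjet m y Y \<and> x k - y \<in> P m (Suc n) \<and> Y i = c)"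
    using pjet_approx_homogeneous[OF Gen.b_gr] by blast
  then obtain v where v: "\<And>n k. v n k \<in> gr (xpar k + par i)"
    and app: "\<And>n k. \<exists>y Y. pjet m y Y \<and> x k - y \<in> P m (Suc n) \<and> Y i = v n k" by metis
  have chain: "Y i - (\<Sum>k<N. v n k * Z k) \<in> P m n"
    if "Gen.pjet N z Z" "pjet m y Y" "z - y \<in> P m (Suc n)" for z Z y Y n
    using truncated_chain_rule[where v = "v n" and n = n and i = i] v app that by blast
  have relP: "(\<Sum>k<N. v n k * Z k) \<in> P m n" if "Gen.pjet N 0 Z" for Z n
    using chain[OF that pjet_zero, of n] P_ideal(1) P_ideal(7) by fastforce
  have v1: "v 1 k - v n k \<in> P m 1" if "n \<ge> 1" for n k
  proof -
    obtain y Y where y: "pjet m y Y" "x k - y \<in> P m (Suc n)" "Y i = v n k" using app by blast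
    obtain z Z where z: "pjet m z Z" "x k - z \<in> P m (Suc 1)" "Z i = v 1 k" using app by blast
    have "x k - y \<in> P m (Suc 1)" using y(2) P_antimono[of "Suc 1" "Suc n" m] that by auto
    then have "(x k - y) - (x k - z) \<in> P m (Suc 1)" using z(2) by (rule P_ideal(6))
    then have "z - y \<in> P m (Suc 1)" by simp
    then have "Z i - Y i \<in> P m 1" using pjet_welldefined[OF pjet_diff[OF z(1) y(1)]] by blast
    then show ?thesis using y z by simp
  qed
  \<comment> \<open>the gradients of the relations between the generators\<close>
  define R where "R = {Z. Gen.pjet N 0 Z}"
  have RM: "R \<subseteq> Gen.functions_on {..<N}"
    unfolding R_def Gen.functions_on_def using Gen.pjet_support by auto
  have Mst: "Gen.Fun.op_stable Gen.right_ops (Gen.functions_on {..<N})"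
    unfolding Gen.Fun.op_stable_def Gen.right_ops_def Gen.functions_on_def
    by (auto intro!: Gen.Fun.subspaceI)
  obtain R0 where R0: "finite R0" "R0 \<subseteq> R" "R \<subseteq> Gen.Fun.op_stable Gen.right_ops hull R0"
    by (rule Gen.Fun.acc_on_finite_subset[OF Gen.acc_right[of "{..<N}"] Mst RM]) simp
  have R0_R: "(\<Sum>k<N. u k * Z k) = 0" if u: "\<And>Z. Z \<in> R0 \<Longrightarrow> (\<Sum>k<N. u k * Z k) = 0" and Z: "Z \<in> R" for u Z
  proof -
    have "Gen.Fun.op_stable Gen.right_ops {Z. (\<Sum>k<N. u k * Z k) = 0}"
      unfolding Gen.Fun.op_stable_def Gen.right_ops_def
      by (auto intro!: Gen.Fun.subspaceI simp: distrib_left sum.distrib scale_mult_right scale_sum_right[symmetric]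
        mult.assoc[symmetric] sum_distrib_right[symmetric])
    then have "Gen.Fun.op_stable Gen.right_ops hull R0 \<subseteq> {Z. (\<Sum>k<N. u k * Z k) = 0}"
      using u by (intro hull_minimal) auto
    then show ?thesis using R0(3) Z by blast
  qed
  define \<Phi> where "\<Phi> u = (\<lambda>Z. if Z \<in> R0 then \<Sum>k<N. u k * Z k else 0)" for u
  have \<Phi>_add: "\<Phi> (\<lambda>k. u k + w k) = \<Phi> u + \<Phi> w" for u w
    unfolding \<Phi>_def by (auto simp: distrib_right sum.distrib)
  have \<Phi>_mult: "\<Phi> (\<lambda>k. a * u k) = (\<lambda>Z. a * \<Phi> u Z)" for a u
    unfolding \<Phi>_def by (auto simp: mult.assoc sum_distrib_left)
  have \<Phi>_diff: "\<Phi> (\<lambda>k. u k - w k) Z = \<Phi> u Z - \<Phi> w Z" for u w Z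
    unfolding \<Phi>_def by (auto simp: left_diff_distrib sum_subtractf)
  define W where "W = \<Phi> ` {w. \<forall>k. w k \<in> P m 1}"
  have W: "Gen.Fun.op_stable Gen.left_ops W"
    unfolding Gen.left_stable_iff
  proof (intro conjI ballI allI)
    have "\<Phi> (\<lambda>_. 0) \<in> W" unfolding W_def using P_ideal(1) by blast
    moreover have "\<Phi> (\<lambda>_. 0) = 0" unfolding \<Phi>_def by (rule ext) simp
    ultimately show "0 \<in> W" by simp
    fix f assume "f \<in> W"
    then obtain u where u: "f = \<Phi> u" "\<forall>k. u k \<in> P m 1" unfolding W_def by blast
    show "f + g \<in> W" if g: "g \<in> W" for g
    proof -
      obtain w where w: "g = \<Phi> w" "\<forall>k. w k \<in> P m 1" using g unfolding W_def by blast
      show ?thesis unfolding u w \<Phi>_add[symmetric] W_def using u w P_ideal(2) by blast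
    qed
    show "(\<lambda>i. a * f i) \<in> W" for a
      unfolding u \<Phi>_mult[symmetric] W_def using u P_ideal(3) by blast
  qed
  have "\<exists>q\<in>P m 1. (\<lambda>Z. \<Phi> (v 1) Z - q * \<Phi> (v 1) Z) \<in> W"
  proof (rule krull[OF R0(1) W])
    show "W \<subseteq> Gen.functions_on R0" "\<Phi> (v 1) \<in> Gen.functions_on R0"
      unfolding W_def \<Phi>_def Gen.functions_on_def by auto
    fix n :: nat
    let ?n = "max n 1"
    have "\<Phi> (\<lambda>k. v 1 k - v ?n k) \<in> W" unfolding W_def using v1 by auto
    moreover have "\<Phi> (v 1) Z - \<Phi> (\<lambda>k. v 1 k - v ?n k) Z \<in> P m n" for Z
    proof -
      have "\<Phi> (v ?n) Z \<in> P m ?n" unfolding \<Phi>_def using relP[of Z ?n] R0(2) P_ideal(1) R_def by auto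
      then have "\<Phi> (v ?n) Z \<in> P m n" using P_antimono[of n ?n m] by auto
      then show ?thesis by (simp add: \<Phi>_diff)
    qed
    ultimately show "\<exists>w\<in>W. \<forall>Z. \<Phi> (v 1) Z - w Z \<in> P m n" by blast
  qed
  then obtain q w where q: "q \<in> P m 1" and w: "\<And>k. w k \<in> P m 1"
    and eq: "(\<lambda>Z. \<Phi> (v 1) Z - q * \<Phi> (v 1) Z) = \<Phi> w" unfolding W_def by blast
  define u where "u k = (v 1 k - q * v 1 k) - w k" for k
  have "\<Phi> u Z = 0" for Z
    using fun_cong[OF eq, of Z] unfolding u_def \<Phi>_diff by (simp add: \<Phi>_mult)
  then have u0: "(\<Sum>k<N. u k * Z k) = 0" if "Gen.pjet N 0 Z" for Z
    using R0_R[of u Z] that unfolding \<Phi>_def R_def by (metis mem_Collect_eq)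
  have uv: "u k - v 1 k \<in> P m 1" for k
  proof -
    have "u k - v 1 k = - (q * v 1 k + w k)" unfolding u_def by simp
    also have "\<dots> \<in> P m 1" by (intro P_ideal(7) P_ideal(2) P_ideal(4) q w)
    finally show ?thesis .
  qed
  let ?h = "\<lambda>k a. scale (1/2) (a + koszul k * twist 1 a)"
  \<comment> \<open>project to the parity required by \<open>derivation_of_values\<close>\<close>
  define u' where "u' k = ?h (xpar k + par i) (u k)" for k
  have u'_gr: "u' k \<in> gr (par i + xpar k)" for k
    unfolding u'_def add.commute[of "par i"] by (rule pjet_homogeneous_part(2)[OF pjet_zero])
  have u'v: "u' k - v 1 k \<in> P m 1" for k
  proof -
    have "?h (xpar k + par i) (u k - v 1 k) \<in> P m 1"
      by (rule P_ideal(8), rule P_ideal(2), rule uv, rule P_ideal(3), rule P_ideal(5), rule uv)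
    moreover have "?h (xpar k + par i) (u k - v 1 k) = u' k - ?h (xpar k + par i) (v 1 k)"
      unfolding u'_def by (simp add: twist_diff scale_right_distrib scale_right_diff_distrib right_diff_distrib)
    ultimately show ?thesis using homogeneous_part_id[OF v, of 1 k] by simp
  qed
  have u'0: "(\<Sum>k<N. u' k * Z k) = 0" if Z: "Gen.pjet N 0 Z" for Z
  proof -
    have "Gen.pjet N 0 (\<lambda>k. koszul (xpar k) * twist 1 (Z k))"
      using Gen.pjet_twist[OF Z, of 1] by (simp only: mult_1_left twist_zero)
    from u0[OF this] have "twist 1 (\<Sum>k<N. u k * (koszul (xpar k) * twist 1 (Z k))) = 0" by simp
    then have "(\<Sum>k<N. twist 1 (u k) * (koszul (xpar k) * Z k)) = 0"
      using twist_koszul[of 1 _ 1] by (simp add: twist_sum twist_mult twist_twist)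
    then have "koszul (par i) * (\<Sum>k<N. twist 1 (u k) * (koszul (xpar k) * Z k)) = 0" by simp
    moreover have "koszul (par i) * (twist 1 a * (koszul c * d)) = koszul (c + par i) * twist 1 a * d" for a c d
      by (cases "par i"; cases c) (auto simp: koszul_def)
    ultimately have "(\<Sum>k<N. koszul (xpar k + par i) * twist 1 (u k) * Z k) = 0"
      by (simp add: sum_distrib_left)
    then have "(\<Sum>k<N. u k * Z k) + (\<Sum>k<N. koszul (xpar k + par i) * twist 1 (u k) * Z k) = 0"
      using u0[OF Z] by simp
    then have "(\<Sum>k<N. (u k + koszul (xpar k + par i) * twist 1 (u k)) * Z k) = 0"
      by (simp add: sum.distrib distrib_right)
    then have "scale (1/2) (\<Sum>k<N. (u k + koszul (xpar k + par i) * twist 1 (u k)) * Z k) = 0" by simp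
    then show ?thesis unfolding u'_def by (simp only: scale_sum_right scale_mult_left)
  qed
  obtain D where D: "D \<in> Der scale gr (par i)" "\<And>y Y. Gen.pjet N y Y \<Longrightarrow> D y = (\<Sum>k<N. u' k * Y k)"
    using Gen.derivation_of_values[OF u'_gr u'0] by blast
  have "D (b j) - (if i = j then 1 else 0) \<in> P m 1" if j: "j < m" for j
  proof -
    obtain Z where Z: "Gen.pjet N (b j) Z" using Gen.generates by blast
    have "(if i = j then 1 else 0) - (\<Sum>k<N. v 1 k * Z k) \<in> P m 1"
      using chain[OF Z pjet_b[OF j], of 1] P_ideal(1) by simp
    moreover have "(\<Sum>k<N. (u' k - v 1 k) * Z k) \<in> P m 1"
      by (rule twist_ideal_sum[OF twist_ideal_P]) (rule P_ideal(4)[OF u'v])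
    ultimately have "(\<Sum>k<N. (u' k - v 1 k) * Z k) - ((if i = j then 1 else 0) - (\<Sum>k<N. v 1 k * Z k)) \<in> P m 1"
      by (rule P_ideal(6)[rotated])
    then show ?thesis unfolding D(2)[OF Z] by (simp add: left_diff_distrib sum_subtractf algebra_simps)
  qed
  then show ?thesis using D(1) by blast
qed

text \<open>
  By Euler's formula for the dual vector fields, membership of \<open>\<Lambda>\<close> in order \<open>n\<close> improves to order \<open>n + 1\<close>.
  The conclusion is Krull's intersection theorem for the elements of infinite order.
\<close>

theorem derivation_closed_in_point:
  assumes \<Lambda>: "\<Lambda> \<subseteq> P m 1" and closed: "\<And>i D f. D \<in> Der scale gr i \<Longrightarrow> f \<in> \<Lambda> \<Longrightarrow> D f \<in> \<Lambda>"
    and f: "f \<in> \<Lambda>"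
  shows "\<exists>q\<in>P m 1. f = q * f"
proof -
  obtain D where D: "\<And>i. i < m \<Longrightarrow> D i \<in> Der scale gr (par i)"
    and dual: "\<And>i j. i < m \<Longrightarrow> j < m \<Longrightarrow> D i (b j) - (if i = j then 1 else 0) \<in> P m 1"
    using dual_derivation by metis
  have Djet: "D i y - Y i \<in> P m n" if i: "i < m" and "jet UNIV m n y Y" for i n y Y
    using that(2)
  proof (induction rule: jet.induct)
    case (jet_const c) then show ?case by simp
  next
    case (jet_zero d) then show ?case using P_ideal(1) by (simp add: Der_zero[OF D[OF i]])
  next
    case (jet_add d y Y z Z)
    then have "(D i y - Y i) + (D i z - Z i) \<in> P m d" by (intro P_ideal(2))
    then show ?case by (simp add: Der_add[OF D[OF i]] algebra_simps)
  next
    case (jet_letter d y Y j)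
    have "y \<in> P m d" using jet_letter.hyps(1) VI V_subset_P by blast
    then have "(D i (b j) - (if i = j then 1 else 0)) * y \<in> P m (Suc d)"
      using P_mult[OF dual[OF i jet_letter.hyps(2)]] by simp
    moreover have "koszul (par i * par j) * (b j * (D i y - Y i)) \<in> P m (Suc d)"
      by (rule P_ideal(3), rule P_letter[OF jet_letter.IH jet_letter.hyps(2)])
    ultimately have "(D i (b j) - (if i = j then 1 else 0)) * y + koszul (par i * par j) * (b j * (D i y - Y i)) \<in> P m (Suc d)"
      by (rule P_ideal(2))
    moreover have "D i (b j * y) - ((if i = j then y else 0) + twist (par i) (b j) * Y i) =
      (D i (b j) - (if i = j then 1 else 0)) * y + koszul (par i * par j) * (b j * (D i y - Y i))"
      by (simp add: Der_leibniz[OF D[OF i] b_gr] twist_b algebra_simps mult.assoc)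
    ultimately show ?case by simp
  qed
  have "f \<in> P m n" if "f \<in> \<Lambda>" for f n
    using that
  proof (induction n arbitrary: f)
    case (Suc n)
    show ?case
    proof (cases n)
      case 0 then show ?thesis using \<Lambda> Suc.prems by auto
    next
      case (Suc n')
      have f: "f \<in> P m n" using Suc.IH Suc.prems by blast
      then obtain s where s: "s \<in> S" "s * f \<in> V m n" unfolding P_def by (rule satE)
      then obtain Y where Y: "jet UNIV m n (s * f) Y" unfolding V_def by blast
      have "b i * Y i \<in> P m (Suc n)" if i: "i < m" for i
      proof -
        have "D i f \<in> P m n" using Suc.IH closed[OF D[OF i] Suc.prems] by blast
        then have "D i (s * f) \<in> P m n"
          using Der_even_scalar[OF D[OF i], of s f] s(1) S_even f P_ideal(2,3) by auto
        then have "D i (s * f) - (D i (s * f) - Y i) \<in> P m n" using Djet[OF i Y] by (rule P_ideal(6))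
        then show ?thesis using P_letter i by simp
      qed
      then have "(\<Sum>i<m. b i * Y i) \<in> P m (Suc n)" by (intro twist_ideal_sum[OF twist_ideal_P]) auto
      then have "of_nat (Suc n') * (s * f) \<in> P m (Suc n)" using jet_euler[OF Y] Suc by simp
      then have "s * f \<in> P m (Suc n)" by (rule twist_ideal_of_nat[OF twist_ideal_P])
      then show ?thesis by (rule P_cancel[OF s(1)])
    qed
  qed simp
  then have fP: "f \<in> P m n" for n using f by blast
  have "\<exists>q\<in>P m 1. (\<lambda>i. Gen.unit_at () i * f - q * (Gen.unit_at () i * f)) \<in> {0}"
  proof (rule krull[of "{()}"])
    show "Gen.Fun.op_stable Gen.left_ops {0}" unfolding Gen.left_stable_iff by (auto simp: fun_eq_iff)
  qed (use fP P_ideal(3) in \<open>auto simp: Gen.functions_on_def\<close>)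
  then show ?thesis by (auto simp: fun_eq_iff Gen.unit_at_def)
qed

end

section \<open>Characters of finitely generated algebras\<close>

text \<open>
  The bookkeeping of one step of division with remainder when letters commute only modulo an
  ideal: every summand on the right contains a commutator or an error from an earlier step.
\<close>

lemma division_step_noncommutative:
  fixes t T a x U L w M D Q R :: "'a::ring"
  shows "(t * T) * (a + x * U) - (L * (w + x * M) + D) =
      (((t * x) * L - L * (t * x)) + L * (t * x - x * t)) * Q + (t * x) * (T * U - (L * Q + R))
      + t * (T * x - x * T) * U - (D - (t * (T * a + x * R) - L * w)) - L * x * (M - t * Q)"
  by (simp only: ring_distribs mult.assoc diff_conv_add_uminus minus_add_distrib minus_minus
      mult_minus_left mult_minus_right) (simp add: algebra_simps)

lemma division_step_commutative:
  fixes t T a c U L w D Q R :: "'a::comm_ring"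
  assumes "D = t * (T * a + c * R) - L * w" "T * U = L * Q + R"
  shows "t * T * (a + c * U) = L * (w + c * (t * Q)) + D"
proof -
  have "t * T * (a + c * U) = t * T * a + t * c * (T * U)" by (simp add: algebra_simps)
  then show ?thesis unfolding assms by (simp add: algebra_simps)
qed

lemma elimination_step_commutative:
  fixes t a c U L w D b h :: "'a::comm_ring"
  assumes "D = t * U - L * w" "h = t * a - b * w"
  shows "h + c * D = t * (a + c * U) - (b + c * L) * w"
  unfolding assms by (simp add: algebra_simps)

text \<open>
  The domain \<open>A / P\<close> is represented by congruences modulo \<open>P\<close>.
\<close>

locale prime_quotient = char0_superalgebra scale gr
  for scale :: "'k::{alg_closed_field, field_char_0} \<Rightarrow> 'a::ring_1 \<Rightarrow> 'a" and gr :: "bit \<Rightarrow> 'a set" +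
  fixes P :: "'a set"
  assumes P_0: "0 \<in> P" and P_add: "x \<in> P \<Longrightarrow> y \<in> P \<Longrightarrow> x + y \<in> P"
    and P_left: "x \<in> P \<Longrightarrow> a * x \<in> P" and P_right: "x \<in> P \<Longrightarrow> x * a \<in> P"
    and one_notin_P: "1 \<notin> P" and prime_P: "x * y \<in> P \<Longrightarrow> x \<in> P \<or> y \<in> P"
    and commutator_P: "x * y - y * x \<in> P"
begin

lemma P_minus: "x \<in> P \<Longrightarrow> - x \<in> P" using P_left[of x "- 1"] by simp

lemma P_diff: "x \<in> P \<Longrightarrow> y \<in> P \<Longrightarrow> x - y \<in> P" using P_add[of x "- y"] P_minus by simp

lemma P_cong: "x - y \<in> P \<Longrightarrow> x \<in> P \<longleftrightarrow> y \<in> P"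
  using P_add[of "x - y" y] P_diff[of x "x - y"] by auto

lemma power_notin_P: "t \<notin> P \<Longrightarrow> t ^ n \<notin> P"
  by (induction n) (use one_notin_P prime_P in auto)

definition subalg :: "'a set \<Rightarrow> bool" where
  "subalg B \<longleftrightarrow> P \<subseteq> B \<and> (\<forall>c. scale c 1 \<in> B) \<and> (\<forall>a\<in>B. \<forall>b\<in>B. a + b \<in> B \<and> a * b \<in> B)"

definition character_on :: "'a set \<Rightarrow> ('a \<Rightarrow> 'k) \<Rightarrow> bool" where
  "character_on B \<chi> \<longleftrightarrow> (\<forall>a\<in>B. \<forall>b\<in>B. \<chi> (a + b) = \<chi> a + \<chi> b \<and> \<chi> (a * b) = \<chi> a * \<chi> b) \<and>
     (\<forall>c. \<chi> (scale c 1) = c) \<and> (\<forall>a\<in>P. \<chi> a = 0)"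

text \<open>
  The statement that is carried from a subalgebra to the subalgebra with one more generator: any
  prescribed element outside \<open>P\<close> can be kept nonzero by a character.
\<close>

definition separated :: "'a set \<Rightarrow> bool" where
  "separated B \<longleftrightarrow> (\<forall>f\<in>B - P. \<exists>\<chi>. character_on B \<chi> \<and> \<chi> f \<noteq> 0)"

lemma subalgD:
  assumes "subalg B"
  shows "P \<subseteq> B" "scale c 1 \<in> B" "a \<in> B \<Longrightarrow> b \<in> B \<Longrightarrow> a + b \<in> B" "a \<in> B \<Longrightarrow> b \<in> B \<Longrightarrow> a * b \<in> B"
    "0 \<in> B" "1 \<in> B" "a \<in> B \<Longrightarrow> - a \<in> B" "a \<in> B \<Longrightarrow> b \<in> B \<Longrightarrow> a - b \<in> B" "a \<in> B \<Longrightarrow> a ^ n \<in> B"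
proof -
  show 1: "P \<subseteq> B" "\<And>c. scale c 1 \<in> B" "\<And>a b. a \<in> B \<Longrightarrow> b \<in> B \<Longrightarrow> a + b \<in> B"
     "\<And>a b. a \<in> B \<Longrightarrow> b \<in> B \<Longrightarrow> a * b \<in> B" using assms unfolding subalg_def by auto
  show "0 \<in> B" "1 \<in> B" using 1(2)[of 0] 1(2)[of 1] by auto
  show 2: "\<And>a. a \<in> B \<Longrightarrow> - a \<in> B" using 1(4)[OF 1(2)[of "- 1"]] by simp
  show "a \<in> B \<Longrightarrow> b \<in> B \<Longrightarrow> a - b \<in> B" using 1(3)[of a "- b"] 2 by simp
  show "a \<in> B \<Longrightarrow> a ^ n \<in> B" using 1(2)[of 1] 1(4) by (induction n) auto
qed

lemma characterD:
  assumes "character_on B \<chi>" "subalg B"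
  shows "a \<in> B \<Longrightarrow> b \<in> B \<Longrightarrow> \<chi> (a + b) = \<chi> a + \<chi> b" "a \<in> B \<Longrightarrow> b \<in> B \<Longrightarrow> \<chi> (a * b) = \<chi> a * \<chi> b"
    "\<chi> (scale c 1) = c" "a \<in> P \<Longrightarrow> \<chi> a = 0" "\<chi> 1 = 1" "\<chi> 0 = 0"
    "a \<in> B \<Longrightarrow> \<chi> (- a) = - \<chi> a" "a \<in> B \<Longrightarrow> b \<in> B \<Longrightarrow> \<chi> (a - b) = \<chi> a - \<chi> b" "a \<in> B \<Longrightarrow> \<chi> (a ^ n) = \<chi> a ^ n"
proof -
  note B = subalgD[OF assms(2)]
  show 1: "\<And>a b. a \<in> B \<Longrightarrow> b \<in> B \<Longrightarrow> \<chi> (a + b) = \<chi> a + \<chi> b" "\<And>a b. a \<in> B \<Longrightarrow> b \<in> B \<Longrightarrow> \<chi> (a * b) = \<chi> a * \<chi> b"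
    "\<And>c. \<chi> (scale c 1) = c" "a \<in> P \<Longrightarrow> \<chi> a = 0" using assms(1) unfolding character_on_def by auto
  show 2: "\<chi> 1 = 1" "\<chi> 0 = 0" using 1(3)[of 1] 1(3)[of 0] by auto
  have "\<chi> (- 1) = - 1" using 1(3)[of "- 1"] by simp
  then show 3: "\<And>a. a \<in> B \<Longrightarrow> \<chi> (- a) = - \<chi> a" using 1(2)[of "- 1"] B(6,7) by (metis mult_minus1)
  show "a \<in> B \<Longrightarrow> b \<in> B \<Longrightarrow> \<chi> (a - b) = \<chi> a - \<chi> b" using 1(1)[of a "- b"] 3 B(7) by simp
  show "a \<in> B \<Longrightarrow> \<chi> (a ^ n) = \<chi> a ^ n" using 1(2) 2 B(9) by (induction n) auto
qed

text \<open>
  A list over \<open>B\<close> stands for a polynomial with coefficients in \<open>B\<close>, lowest degree first; \<open>horner x\<close>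
  evaluates it at \<open>x\<close>, and \<open>value_at \<chi> c\<close> evaluates its image under \<open>\<chi>\<close> at \<open>c\<close>.
\<close>

primrec horner :: "'a \<Rightarrow> 'a list \<Rightarrow> 'a" where
  "horner x [] = 0"
| "horner x (a # l) = a + x * horner x l"

abbreviation value_at :: "('a \<Rightarrow> 'k) \<Rightarrow> 'k \<Rightarrow> 'a list \<Rightarrow> 'k" where
  "value_at \<chi> c l \<equiv> poly (Poly (map \<chi> l)) c"

lemma horner_in_P: "set l \<subseteq> P \<Longrightarrow> horner x l \<in> P"
  by (induction l) (auto intro: P_0 P_add P_left)

lemma horner_map_left: "horner x (map (\<lambda>a. t * a) l) - t * horner x l \<in> P"
proof (induction l)
  case (Cons a l)
  have "horner x (map (\<lambda>a. t * a) (a # l)) - t * horner x (a # l) =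
     x * (horner x (map (\<lambda>a. t * a) l) - t * horner x l) - (t * x - x * t) * horner x l"
    by (simp add: algebra_simps)
  then show ?case using Cons P_left P_right P_diff commutator_P by metis
qed (simp add: P_0)

lemma horner_snoc_P: "w \<in> P \<Longrightarrow> horner x (u @ [w]) - horner x u \<in> P"
proof (induction u)
  case (Cons a u)
  have "horner x ((a # u) @ [w]) - horner x (a # u) = x * (horner x (u @ [w]) - horner x u)"
    by (simp add: algebra_simps)
  then show ?case using Cons P_left by simp
qed simp

fun list_add :: "'a list \<Rightarrow> 'a list \<Rightarrow> 'a list" where
  "list_add [] v = v"
| "list_add u [] = u"
| "list_add (a # u) (b # v) = (a + b) # list_add u v"

lemma horner_list_add: "horner x (list_add u v) = horner x u + horner x v"
  by (induction u v rule: list_add.induct) (auto simp: algebra_simps)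

context
  fixes B assumes B: "subalg B"
begin

lemma list_add_in: "set u \<subseteq> B \<Longrightarrow> set v \<subseteq> B \<Longrightarrow> set (list_add u v) \<subseteq> B"
  by (induction u v rule: list_add.induct) (auto intro: subalgD(3)[OF B])

lemma value_at_list_add:
  assumes "character_on B \<chi>"
  shows "set u \<subseteq> B \<Longrightarrow> set v \<subseteq> B \<Longrightarrow> value_at \<chi> c (list_add u v) = value_at \<chi> c u + value_at \<chi> c v"
  by (induction u v rule: list_add.induct) (auto simp: algebra_simps characterD(1)[OF assms B])

lemma value_at_map_left:
  assumes "character_on B \<chi>" "t \<in> B"
  shows "set l \<subseteq> B \<Longrightarrow> value_at \<chi> c (map (\<lambda>a. t * a) l) = \<chi> t * value_at \<chi> c l"
  by (induction l) (auto simp: algebra_simps characterD(2)[OF assms(1) B assms(2)])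

lemma value_at_minus:
  assumes "character_on B \<chi>"
  shows "set l \<subseteq> B \<Longrightarrow> value_at \<chi> c (map uminus l) = - value_at \<chi> c l"
  by (induction l) (auto simp: algebra_simps characterD(7)[OF assms(1) B])

lemma horner_minus: "horner x (map uminus l) = - horner x l"
  by (induction l) auto

lemma horner_absorb:
  assumes "set l \<subseteq> B" "p \<in> P"
  shows "\<exists>l'. set l' \<subseteq> B \<and> horner x l' = horner x l + p \<and>
    (\<forall>\<chi> c. character_on B \<chi> \<longrightarrow> value_at \<chi> c l' = value_at \<chi> c l)"
proof (intro exI conjI allI impI)
  have p: "set [p] \<subseteq> B" using assms subalgD(1)[OF B] by auto
  show "set (list_add l [p]) \<subseteq> B" by (rule list_add_in[OF assms(1) p])
  show "horner x (list_add l [p]) = horner x l + p" by (simp add: horner_list_add)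
  show "value_at \<chi> c (list_add l [p]) = value_at \<chi> c l" if "character_on B \<chi>" for \<chi> c
    using value_at_list_add[OF that assms(1) p] characterD(4)[OF that B assms(2)] by simp
qed

lemma horner_product:
  assumes l': "set l' \<subseteq> B"
  shows "set l \<subseteq> B \<Longrightarrow> \<exists>l''. set l'' \<subseteq> B \<and> horner x l'' = horner x l * horner x l' \<and>
    (\<forall>\<chi> c. character_on B \<chi> \<longrightarrow> value_at \<chi> c l'' = value_at \<chi> c l * value_at \<chi> c l')"
proof (induction l)
  case Nil show ?case by (intro exI[of _ "[]"]) auto
next
  case (Cons a l)
  then obtain u where u: "set u \<subseteq> B" "horner x u = horner x l * horner x l'"
    "\<And>\<chi> c. character_on B \<chi> \<Longrightarrow> value_at \<chi> c u = value_at \<chi> c l * value_at \<chi> c l'" by auto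
  have a: "a \<in> B" using Cons.prems by simp
  let ?v = "list_add (map (\<lambda>b. a * b) l') (0 # u)"
  have m: "set (map (\<lambda>b. a * b) l') \<subseteq> B" using l' a subalgD(4)[OF B] by auto
  have z: "set (0 # u) \<subseteq> B" using u subalgD(5)[OF B] by auto
  have v: "set ?v \<subseteq> B" by (rule list_add_in[OF m z])
  have "horner x (a # l) * horner x l' - horner x ?v \<in> P"
    using P_minus[OF horner_map_left[of x a l']] by (simp add: horner_list_add u algebra_simps)
  from horner_absorb[OF v this, of x] obtain w where w: "set w \<subseteq> B"
    "horner x w = horner x (a # l) * horner x l'"
    "\<And>\<chi> c. character_on B \<chi> \<Longrightarrow> value_at \<chi> c w = value_at \<chi> c ?v" by auto
  have "value_at \<chi> c w = value_at \<chi> c (a # l) * value_at \<chi> c l'" if \<chi>: "character_on B \<chi>" for \<chi> c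
    using w(3)[OF \<chi>] value_at_list_add[OF \<chi> m z] value_at_map_left[OF \<chi> a l'] u(3)[OF \<chi>]
      characterD(6)[OF \<chi> B] by (simp add: algebra_simps)
  then show ?case using w by blast
qed

lemma subalg_adjoin: "subalg {horner x l |l. set l \<subseteq> B}"
  unfolding subalg_def
proof (intro conjI allI ballI subsetI)
  fix p assume "p \<in> P"
  then have "set [p] \<subseteq> B" "horner x [p] = p" using subalgD(1)[OF B] by auto
  then show "p \<in> {horner x l |l. set l \<subseteq> B}" by (metis (mono_tags, lifting) mem_Collect_eq)
next
  fix c
  have "set [scale c 1] \<subseteq> B" "horner x [scale c 1] = scale c 1" using subalgD(2)[OF B] by auto
  then show "scale c 1 \<in> {horner x l |l. set l \<subseteq> B}" by (metis (mono_tags, lifting) mem_Collect_eq)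
next
  fix a b assume "a \<in> {horner x l |l. set l \<subseteq> B}" "b \<in> {horner x l |l. set l \<subseteq> B}"
  then obtain u v where u: "a = horner x u" "set u \<subseteq> B" and v: "b = horner x v" "set v \<subseteq> B" by blast
  show "a + b \<in> {horner x l |l. set l \<subseteq> B}"
    using horner_list_add[of x u v] list_add_in[OF u(2) v(2)] u v by (metis (mono_tags, lifting) mem_Collect_eq)
  show "a * b \<in> {horner x l |l. set l \<subseteq> B}"
    using horner_product[OF v(2) u(2), of x] u v by (metis (mono_tags, lifting) mem_Collect_eq)
qed

text \<open>
  The extension sends \<open>x\<close> to \<open>c\<close>.  It does not depend on the polynomial chosen to express an
  element, because the difference of two choices is a relation of \<open>x\<close>, which becomes a relation of \<open>c\<close>.
\<close>

lemma character_extends: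
  assumes \<chi>: "character_on B \<chi>"
    and well: "\<And>l. set l \<subseteq> B \<Longrightarrow> horner x l \<in> P \<Longrightarrow> value_at \<chi> c l = 0"
  shows "\<exists>\<psi>. character_on {horner x l |l. set l \<subseteq> B} \<psi> \<and> (\<forall>l. set l \<subseteq> B \<longrightarrow> \<psi> (horner x l) = value_at \<chi> c l)"
proof -
  define \<psi> where "\<psi> y = value_at \<chi> c (SOME l. set l \<subseteq> B \<and> horner x l = y)" for y
  have \<psi>: "\<psi> (horner x l) = value_at \<chi> c l" if l: "set l \<subseteq> B" for l
  proof -
    define u where "u = (SOME u. set u \<subseteq> B \<and> horner x u = horner x l)"
    have u: "set u \<subseteq> B \<and> horner x u = horner x l" unfolding u_def by (rule someI[of _ l]) (use l in simp)
    have m: "set (map uminus l) \<subseteq> B" using l subalgD(7)[OF B] by auto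
    have "value_at \<chi> c (list_add u (map uminus l)) = 0"
      by (rule well) (use u m list_add_in P_0 in \<open>auto simp: horner_list_add horner_minus\<close>)
    then have "value_at \<chi> c u = value_at \<chi> c l"
      using value_at_list_add[OF \<chi> _ m] value_at_minus[OF \<chi> l] u by simp
    then show ?thesis unfolding \<psi>_def u_def .
  qed
  have const: "\<psi> a = \<chi> a" if "a \<in> B" for a using \<psi>[of "[a]"] that by simp
  have "character_on {horner x l |l. set l \<subseteq> B} \<psi>"
    unfolding character_on_def
  proof (intro conjI ballI allI)
    fix a b assume "a \<in> {horner x l |l. set l \<subseteq> B}" "b \<in> {horner x l |l. set l \<subseteq> B}"
    then obtain u v where u: "a = horner x u" "set u \<subseteq> B" and v: "b = horner x v" "set v \<subseteq> B" by blast
    show "\<psi> (a + b) = \<psi> a + \<psi> b"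
      using \<psi>[OF list_add_in[OF u(2) v(2)]] value_at_list_add[OF \<chi> u(2) v(2)]
      by (simp add: horner_list_add u v \<psi>)
    obtain w where "set w \<subseteq> B" "horner x w = a * b" "value_at \<chi> c w = value_at \<chi> c u * value_at \<chi> c v"
      using horner_product[OF v(2) u(2), of x] \<chi> u v by blast
    then show "\<psi> (a * b) = \<psi> a * \<psi> b" using \<psi> u v by metis
  next
    show "\<psi> (scale c' 1) = c'" for c'
      using const[OF subalgD(2)[OF B]] characterD(3)[OF \<chi> B] by simp
    show "\<psi> a = 0" if "a \<in> P" for a
      using const characterD(4)[OF \<chi> B that] subalgD(1)[OF B] that by auto
  qed
  then show ?thesis using \<psi> by blast
qed

lemma eliminate_top:
  assumes "length u0 = length l0" "set u0 \<subseteq> B" "set l0 \<subseteq> B" "t \<in> B" "w \<in> B"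
  defines "d \<equiv> map2 (\<lambda>a b. t * a - b * w) u0 l0"
  shows "set d \<subseteq> B" and "horner x d - (t * horner x (u0 @ [w]) - horner x (l0 @ [t]) * w) \<in> P"
    and "character_on B \<chi> \<Longrightarrow> value_at \<chi> c d = \<chi> t * value_at \<chi> c (u0 @ [w]) - value_at \<chi> c (l0 @ [t]) * \<chi> w"
proof -
  show "set d \<subseteq> B" unfolding d_def
    using assms(1-5) subalgD(4,8)[OF B] by (induction u0 l0 rule: list_induct2) auto
  show "horner x d - (t * horner x (u0 @ [w]) - horner x (l0 @ [t]) * w) \<in> P"
    unfolding d_def using assms(1)
  proof (induction u0 l0 rule: list_induct2)
    case Nil then show ?case by (simp add: P_0)
  next
    case (Cons a u b l)
    let ?D = "horner x (map2 (\<lambda>a b. t * a - b * w) u l)" and ?U = "horner x (u @ [w])" and ?L = "horner x (l @ [t])"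
    have "(t * a - b * w + x * ?D) - (t * (a + x * ?U) - (b + x * ?L) * w) =
      x * (?D - (t * ?U - ?L * w)) - (t * x - x * t) * ?U" by (simp add: algebra_simps)
    also have "\<dots> \<in> P" by (rule P_diff[OF P_left[OF Cons.IH] P_right[OF commutator_P]])
    finally show ?case by simp
  qed
  show "value_at \<chi> c d = \<chi> t * value_at \<chi> c (u0 @ [w]) - value_at \<chi> c (l0 @ [t]) * \<chi> w"
    if \<chi>: "character_on B \<chi>"
    unfolding d_def using assms(1-3)
  proof (induction u0 l0 rule: list_induct2)
    case (Cons a u b l)
    have ab: "a \<in> B" "b \<in> B" using Cons.prems by auto
    have "\<chi> (t * a - b * w) = \<chi> t * \<chi> a - \<chi> b * \<chi> w"
      using characterD(8)[OF \<chi> B subalgD(4)[OF B assms(4) ab(1)] subalgD(4)[OF B ab(2) assms(5)]]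
        characterD(2)[OF \<chi> B] ab assms(4,5) by simp
    moreover let ?D = "value_at \<chi> c (map2 (\<lambda>a b. t * a - b * w) u l)" and ?U = "value_at \<chi> c (u @ [w])"
      and ?L = "value_at \<chi> c (l @ [t])"
    have "?D = \<chi> t * ?U - ?L * \<chi> w" using Cons.IH Cons.prems by (meson set_subset_Cons subset_trans)
    moreover have "value_at \<chi> c (map2 (\<lambda>a b. t * a - b * w) (a # u) (b # l)) = \<chi> (t * a - b * w) + c * ?D" by simp
    moreover have "value_at \<chi> c ((a # u) @ [w]) = \<chi> a + c * ?U" "value_at \<chi> c ((b # l) @ [t]) = \<chi> b + c * ?L" by simp_all
    ultimately show ?case using elimination_step_commutative by metis
  qed simp
qed

text \<open>
  Division with remainder by a polynomial with leading coefficient \<open>t\<close>, after multiplication by a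
  power of \<open>t\<close>.  The same quotient and remainder serve modulo \<open>P\<close> and for the images under all
  characters, so that relations of \<open>x\<close> and of its image \<open>c\<close> can be reduced in parallel.
\<close>

lemma pseudo_division:
  assumes l: "set l0 \<subseteq> B" "t \<in> B"
  shows "set u \<subseteq> B \<Longrightarrow> length u > length l0 \<Longrightarrow>
    \<exists>N M q r. set q \<subseteq> B \<and> set r \<subseteq> B \<and> length q = length u - length l0 \<and> last q = t ^ M * last u \<and>
      length r = length l0 \<and>
      t ^ N * horner x u - (horner x (l0 @ [t]) * horner x q + horner x r) \<in> P \<and>
      (\<forall>\<chi> c. character_on B \<chi> \<longrightarrow>
        \<chi> t ^ N * value_at \<chi> c u = value_at \<chi> c (l0 @ [t]) * value_at \<chi> c q + value_at \<chi> c r)"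
proof (induction u)
  case (Cons a u)
  show ?case
  proof (cases "length u = length l0")
    case True
    define u0 where "u0 = butlast (a # u)"
    define w where "w = last (a # u)"
    have au: "a # u = u0 @ [w]" unfolding u0_def w_def by simp
    have len: "length u0 = length l0" unfolding u0_def length_butlast using True by simp
    have sub: "set u0 \<subseteq> B" "w \<in> B" using Cons.prems(1) unfolding au by auto
    note d = eliminate_top[OF len sub(1) l sub(2)]
    let ?d = "map2 (\<lambda>a b. t * a - b * w) u0 l0"
    show ?thesis
    proof (rule exI[of _ 1], rule exI[of _ 0], rule exI[of _ "[w]"], rule exI[of _ ?d], intro conjI allI impI)
      show "set ?d \<subseteq> B" by (rule d(1))
      show "t ^ 1 * horner x (a # u) - (horner x (l0 @ [t]) * horner x [w] + horner x ?d) \<in> P"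
        using P_minus[OF d(2)[of x]] unfolding au by (simp add: algebra_simps)
      show "\<chi> t ^ 1 * value_at \<chi> c (a # u) = value_at \<chi> c (l0 @ [t]) * value_at \<chi> c [w] + value_at \<chi> c ?d"
        if "character_on B \<chi>" for \<chi> c
        using d(3)[OF that, of c] unfolding au by (simp add: algebra_simps)
      show "last [w] = t ^ 0 * last (a # u)" unfolding w_def by simp
      show "length [w] = length (a # u) - length l0" using True by simp
    qed (use sub len in simp_all)
  next
    case False
    then obtain N M q r where q: "set q \<subseteq> B" "set r \<subseteq> B" "length q = length u - length l0" "last q = t ^ M * last u"
      "length r = length l0" and div: "t ^ N * horner x u - (horner x (l0 @ [t]) * horner x q + horner x r) \<in> P"
      and val: "\<And>\<chi> c. character_on B \<chi> \<Longrightarrow>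
        \<chi> t ^ N * value_at \<chi> c u = value_at \<chi> c (l0 @ [t]) * value_at \<chi> c q + value_at \<chi> c r"
      using Cons by auto
    have qne: "q \<noteq> []" "u \<noteq> []" using q(3) False Cons.prems(2) by auto
    let ?T = "t ^ N"
    have aB: "a \<in> B" "?T \<in> B" using Cons.prems subalgD(9)[OF B l(2)] by auto
    define u0 where "u0 = butlast (?T * a # r)"
    define w where "w = last (?T * a # r)"
    have au: "?T * a # r = u0 @ [w]" unfolding u0_def w_def by simp
    have len: "length u0 = length l0" unfolding u0_def length_butlast using q(5) by simp
    have "set (u0 @ [w]) \<subseteq> B" using q(2) aB subalgD(4)[OF B] unfolding au[symmetric] by auto
    then have sub: "set u0 \<subseteq> B" "w \<in> B" by auto
    note d = eliminate_top[OF len sub(1) l sub(2)]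
    let ?d = "map2 (\<lambda>a b. t * a - b * w) u0 l0"
    let ?q = "w # map (\<lambda>a. t * a) q"
    let ?L = "horner x (l0 @ [t])" and ?Q = "horner x q" and ?R = "horner x r" and ?U = "horner x u"
      and ?M = "horner x (map (\<lambda>a. t * a) q)" and ?D = "horner x ?d"
    have d2: "?D - (t * (?T * a + x * ?R) - ?L * w) \<in> P" using d(2)[of x] unfolding au[symmetric] by simp
    have "t ^ Suc N * horner x (a # u) - (?L * horner x ?q + ?D) =
      (((t * x) * ?L - ?L * (t * x)) + ?L * (t * x - x * t)) * ?Q + (t * x) * (?T * ?U - (?L * ?Q + ?R))
      + t * (?T * x - x * ?T) * ?U - (?D - (t * (?T * a + x * ?R) - ?L * w)) - ?L * x * (?M - t * ?Q)"
      unfolding horner.simps power_Suc by (rule division_step_noncommutative)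
    also have "\<dots> \<in> P"
      by (intro P_diff P_add P_right P_left div d2 horner_map_left commutator_P)
    finally have 1: "t ^ Suc N * horner x (a # u) - (?L * horner x ?q + ?D) \<in> P" .
    have 2: "\<chi> t ^ Suc N * value_at \<chi> c (a # u) = value_at \<chi> c (l0 @ [t]) * value_at \<chi> c ?q + value_at \<chi> c ?d"
      if \<chi>: "character_on B \<chi>" for \<chi> c
    proof -
      have "value_at \<chi> c (u0 @ [w]) = \<chi> t ^ N * \<chi> a + c * value_at \<chi> c r"
        unfolding au[symmetric] using characterD(2,9)[OF \<chi> B] aB l(2) by simp
      then have "value_at \<chi> c ?d = \<chi> t * (\<chi> t ^ N * \<chi> a + c * value_at \<chi> c r) - value_at \<chi> c (l0 @ [t]) * \<chi> w"
        using d(3)[OF \<chi>, of c] by simp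
      note step = division_step_commutative[OF this val[OF \<chi>, of c]]
      have "value_at \<chi> c ?q = \<chi> w + c * (\<chi> t * value_at \<chi> c q)"
        using value_at_map_left[OF \<chi> l(2) q(1)] by simp
      moreover have "value_at \<chi> c (a # u) = \<chi> a + c * value_at \<chi> c u" by simp
      ultimately show ?thesis using step by (simp only: power_Suc)
    qed
    have "last ?q = t ^ Suc M * last (a # u)" using q(4) qne by (simp add: last_map mult.assoc)
    moreover have "length ?q = length (a # u) - length l0" using q(3) Cons.prems(2) by (simp add: Suc_diff_le)
    moreover have "set ?q \<subseteq> B" using sub q(1) subalgD(4)[OF B l(2)] by auto
    moreover have "length ?d = length l0" using len by simp
    ultimately show ?thesis using 1 2 d(1) by blast
  qed
qed simp

end

text \<open>
  If \<open>x\<close> is transcendental over \<open>B\<close> modulo \<open>P\<close>, keep one coefficient of \<open>f\<close> nonzero and send \<open>x\<close> to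
  a scalar that is not a root.  Otherwise take a relation \<open>m\<close> of minimal length, with leading
  coefficient \<open>t\<close>, and a nonzero multiple \<open>h\<close> of \<open>f\<close> of minimal length.  Dividing \<open>m\<close> by \<open>h\<close> shows that \<open>h\<close> is a
  constant \<open>w\<close>: a nonzero remainder would be a shorter multiple, and a zero remainder would give a
  shorter relation, since \<open>h\<close> would be cancelled.  A character of \<open>B\<close> that is nonzero on \<open>t * w\<close> extends by sending
  \<open>x\<close> to a root of the image of \<open>m\<close>, and is nonzero on \<open>f\<close>, a divisor of \<open>w\<close>.
\<close>

theorem separated_adjoin:
  assumes B: "subalg B" and sep: "separated B"
  shows "separated {horner x l |l. set l \<subseteq> B}"
  unfolding separated_def
proof
  let ?B' = "{horner x l |l. set l \<subseteq> B}"
  fix f assume "f \<in> ?B' - P"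
  then obtain l where l: "f = horner x l" "set l \<subseteq> B" and fP: "horner x l \<notin> P" by blast
  note B' = subalg_adjoin[OF B, of x]
  show "\<exists>\<chi>. character_on ?B' \<chi> \<and> \<chi> f \<noteq> 0"
  proof (cases "\<forall>u. set u \<subseteq> B \<longrightarrow> horner x u \<in> P \<longrightarrow> set u \<subseteq> P")
    case True
    then obtain a where a: "a \<in> set l" "a \<notin> P" using fP horner_in_P by blast
    then obtain \<chi> where \<chi>: "character_on B \<chi>" "\<chi> a \<noteq> 0" using sep l unfolding separated_def by blast
    have "Poly (map \<chi> l) \<noteq> 0"
    proof
      assume "Poly (map \<chi> l) = 0"
      then have "nth_default 0 (map \<chi> l) i = 0" for i by (metis coeff_0 coeff_Poly_eq)
      then show False using a \<chi>(2) by (auto simp: in_set_conv_nth nth_default_def) (metis nth_map)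
    qed
    then have "finite {c. value_at \<chi> c l = 0}" by (rule poly_roots_finite)
    then obtain c where c: "value_at \<chi> c l \<noteq> 0" using infinite_UNIV_char_0[where 'a = 'k]
      by (metis (mono_tags, lifting) Collect_cong UNIV_def)
    have "value_at \<chi> c u = 0" if "set u \<subseteq> B" "horner x u \<in> P" for u
    proof -
      have "set u \<subseteq> P" using True that by blast
      then show ?thesis by (induction u) (auto simp: characterD(4)[OF \<chi>(1) B])
    qed
    from character_extends[OF B \<chi>(1) this] obtain \<psi> where "character_on ?B' \<psi>"
      "\<psi> (horner x l) = value_at \<chi> c l" using l(2) by blast
    then show ?thesis using c l(1) by auto
  next
    case False
    \<comment> \<open>the nontrivial relations of \<open>x\<close> modulo \<open>P\<close>\<close>
    define rel where "rel u \<longleftrightarrow> set u \<subseteq> B \<and> horner x u \<in> P \<and> \<not> set u \<subseteq> P" for u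
    have "\<exists>u. rel u" using False unfolding rel_def by blast
    then obtain m where m: "rel m" and min: "\<And>u. rel u \<Longrightarrow> length m \<le> length u"
      by (metis arg_min_nat_lemma)
    have "m \<noteq> []" using m unfolding rel_def by auto
    then obtain m0 t where m0: "m = m0 @ [t]" by (metis rev_exhaust)
    have mB: "set m0 \<subseteq> B" "t \<in> B" and mP: "horner x (m0 @ [t]) \<in> P" using m unfolding rel_def m0 by auto
    have tP: "t \<notin> P"
    proof
      assume "t \<in> P"
      then have "horner x m0 \<in> P" using P_cong[OF horner_snoc_P] mP by blast
      then have "rel m0" using m \<open>t \<in> P\<close> unfolding rel_def m0 by auto
      then show False using min m0 by fastforce
    qed
    have m0ne: "m0 \<noteq> []" using mP tP by auto
    have short: "set u \<subseteq> P" if "set u \<subseteq> B" "horner x u \<in> P" "length u \<le> length m0" for u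
      using min[of u] that unfolding rel_def m0 by auto
    have reduce: "\<exists>N r. set r \<subseteq> B \<and> length r \<le> length m0 \<and> t ^ N * horner x u - horner x r \<in> P \<and>
        (\<forall>\<chi> c. character_on B \<chi> \<longrightarrow> value_at \<chi> c m = 0 \<longrightarrow> \<chi> t ^ N * value_at \<chi> c u = value_at \<chi> c r)"
      if u: "set u \<subseteq> B" for u
    proof (cases "length u \<le> length m0")
      case True then show ?thesis using u P_0 by (intro exI[of _ 0] exI[of _ u]) auto
    next
      case False
      then obtain N q r where q: "set r \<subseteq> B" "length r = length m0"
        "t ^ N * horner x u - (horner x m * horner x q + horner x r) \<in> P"
        "\<And>\<chi> c. character_on B \<chi> \<Longrightarrow> \<chi> t ^ N * value_at \<chi> c u = value_at \<chi> c m * value_at \<chi> c q + value_at \<chi> c r"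
        using pseudo_division[OF B mB u, of x] unfolding m0 by auto
      have "(t ^ N * horner x u - (horner x m * horner x q + horner x r)) + horner x m * horner x q \<in> P"
        using q(3) P_right[of "horner x m"] mP P_add unfolding m0 by blast
      then have "t ^ N * horner x u - horner x r \<in> P" by (simp add: algebra_simps)
      then show ?thesis using q by (intro exI[of _ N] exI[of _ r]) auto
    qed
    \<comment> \<open>the multiples of \<open>f\<close> outside \<open>P\<close>, as polynomials in \<open>x\<close>\<close>
    define mult where "mult h \<longleftrightarrow> set h \<subseteq> B \<and> horner x h \<notin> P \<and> (\<exists>v. set v \<subseteq> B \<and> horner x h - horner x l * horner x v \<in> P)" for h
    have "mult l" unfolding mult_def using l fP subalgD(6)[OF B] P_0 by (auto intro!: exI[of _ "[1]"])
    then obtain h where h: "mult h" and hmin: "\<And>u. mult u \<Longrightarrow> length h \<le> length u"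
      by (metis arg_min_nat_lemma)
    have hB: "set h \<subseteq> B" "horner x h \<notin> P" using h unfolding mult_def by auto
    obtain v where v: "set v \<subseteq> B" "horner x h - horner x l * horner x v \<in> P" using h unfolding mult_def by blast
    have "length h \<le> length m0"
    proof -
      obtain N r where r: "set r \<subseteq> B" "length r \<le> length m0" "t ^ N * horner x h - horner x r \<in> P"
        using reduce[OF hB(1)] by blast
      have "horner x r \<notin> P" using P_cong[OF r(3)] prime_P power_notin_P[OF tP] hB(2) by blast
      obtain v' where v': "set v' \<subseteq> B" "horner x v' = horner x v * horner x [t ^ N]"
        using horner_product[OF B _ v(1), of "[t ^ N]" x] subalgD(9)[OF B mB(2)] by auto
      have "horner x r - horner x l * horner x v' =
        (t ^ N * (horner x h - horner x l * horner x v)) - (t ^ N * horner x h - horner x r)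
        + (t ^ N * (horner x l * horner x v) - (horner x l * horner x v) * t ^ N)"
        unfolding v' by (simp add: algebra_simps)
      also have "\<dots> \<in> P" by (intro P_add P_diff P_left v(2) r(3) commutator_P)
      finally have "mult r" unfolding mult_def using r(1) \<open>horner x r \<notin> P\<close> v'(1) by blast
      then show ?thesis using hmin r(2) by fastforce
    qed
    have "h \<noteq> []" using hB P_0 by auto
    then obtain h0 w where h0: "h = h0 @ [w]" by (metis rev_exhaust)
    have h0B: "set h0 \<subseteq> B" "w \<in> B" using hB h0 by auto
    have wP: "w \<notin> P"
    proof
      assume w: "w \<in> P"
      have d: "horner x h - horner x h0 \<in> P" unfolding h0 by (rule horner_snoc_P[OF w])
      have "(horner x h - horner x l * horner x v) - (horner x h - horner x h0) \<in> P" by (rule P_diff[OF v(2) d])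
      then have "mult h0" unfolding mult_def using h0B P_cong[OF d] hB v(1) by auto
      then show False using hmin h0 by fastforce
    qed
    have "h0 = []"
    proof (rule ccontr)
      assume ne: "h0 \<noteq> []"
      have "length m > length h0" using \<open>length h \<le> length m0\<close> h0 m0 by simp
      moreover have "set m \<subseteq> B" using mB m0 by auto
      ultimately obtain N M q r where q: "set q \<subseteq> B" "set r \<subseteq> B" "length q = length m - length h0"
        "last q = w ^ M * last m" "length r = length h0"
        "w ^ N * horner x m - (horner x h * horner x q + horner x r) \<in> P"
        using pseudo_division[OF B h0B, of m x] unfolding h0 by blast
      have "w ^ N * horner x m \<in> P" using mP P_left m0 by simp
      then have hq: "horner x h * horner x q + horner x r \<in> P" using P_cong[OF q(6)] by blast
      show False
      proof (cases "horner x r \<in> P")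
        case True
        then have "horner x h * horner x q \<in> P" using P_diff[OF hq True] by simp
        then have "horner x q \<in> P" using prime_P hB by blast
        then have "set q \<subseteq> P" by (rule short[OF q(1)]) (use q(3) m0 ne in \<open>cases h0; simp\<close>)
        moreover have "q \<noteq> []" using q(3) \<open>length m > length h0\<close> by auto
        ultimately have "w ^ M * t \<in> P" using q(4) m0 last_in_set by (metis last_snoc subsetD)
        then show False using prime_P power_notin_P[OF wP] tP by blast
      next
        case False
        obtain v' where v': "set v' \<subseteq> B" "horner x v' = horner x v * horner x q"
          using horner_product[OF B q(1) v(1)] by blast
        have v'': "set (map uminus v') \<subseteq> B" using v'(1) subalgD(7)[OF B] by auto
        have "horner x r - horner x l * horner x (map uminus v') =
          (horner x h * horner x q + horner x r) - (horner x h - horner x l * horner x v) * horner x q"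
          unfolding horner_minus[OF B] v' by (simp add: algebra_simps)
        also have "\<dots> \<in> P" by (intro P_diff P_right hq v(2))
        finally have "mult r" unfolding mult_def using q(2) False v'' by blast
        then show False using hmin q(5) h0 by fastforce
      qed
    qed
    then have wmult: "w - horner x l * horner x v \<in> P" using v(2) h0 by simp
    have "t * w \<in> B - P" using mB h0B subalgD(4)[OF B] tP wP prime_P by blast
    then obtain \<chi> where \<chi>: "character_on B \<chi>" "\<chi> (t * w) \<noteq> 0" using sep unfolding separated_def by blast
    then have tw: "\<chi> t \<noteq> 0" "\<chi> w \<noteq> 0" using characterD(2)[OF \<chi>(1) B mB(2) h0B(2)] by auto
    have "coeff (Poly (map \<chi> m)) (length m0) = \<chi> t" unfolding m0 by (simp add: nth_default_def nth_append)
    then have "degree (Poly (map \<chi> m)) \<ge> length m0" using tw(1) by (intro le_degree) simp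
    then have "degree (Poly (map \<chi> m)) > 0" using m0ne by (cases m0) auto
    then obtain c where c: "value_at \<chi> c m = 0" using alg_closed_imp_poly_has_root by blast
    have "value_at \<chi> c u = 0" if u: "set u \<subseteq> B" "horner x u \<in> P" for u
    proof -
      obtain N r where r: "set r \<subseteq> B" "length r \<le> length m0" "t ^ N * horner x u - horner x r \<in> P"
        "\<chi> t ^ N * value_at \<chi> c u = value_at \<chi> c r" using reduce[OF u(1)] \<chi>(1) c by blast
      have "horner x r \<in> P" using P_cong[OF r(3)] P_left[OF u(2)] by blast
      then have "set r \<subseteq> P" using short r by blast
      then have "value_at \<chi> c r = 0" by (induction r) (auto simp: characterD(4)[OF \<chi>(1) B])
      then show ?thesis using r(4) tw(1) by simp
    qed
    from character_extends[OF B \<chi>(1) this] obtain \<psi> where \<psi>: "character_on ?B' \<psi>"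
      "\<And>u. set u \<subseteq> B \<Longrightarrow> \<psi> (horner x u) = value_at \<chi> c u" by blast
    have "\<psi> w \<noteq> 0" using \<psi>(2)[of "[w]"] h0B tw by simp
    moreover have "\<psi> w = \<psi> (horner x l * horner x v)"
    proof -
      have mem: "horner x l * horner x v \<in> ?B'" using l v(1) subalgD(4)[OF B'] by blast
      have "\<psi> ((w - horner x l * horner x v) + horner x l * horner x v) =
        \<psi> (w - horner x l * horner x v) + \<psi> (horner x l * horner x v)"
        by (rule characterD(1)[OF \<psi>(1) B' subsetD[OF subalgD(1)[OF B'] wmult] mem])
      then have "\<psi> w = \<psi> (w - horner x l * horner x v) + \<psi> (horner x l * horner x v)" by simp
      then show ?thesis using characterD(4)[OF \<psi>(1) B' wmult] by simp
    qed
    moreover have "\<psi> (horner x l * horner x v) = \<psi> (horner x l) * \<psi> (horner x v)"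
      by (rule characterD(2)[OF \<psi>(1) B']) (use l v in blast)+
    ultimately have "\<psi> (horner x l) \<noteq> 0" by (metis mult_zero_left)
    then have "\<psi> f \<noteq> 0" unfolding l(1) .
    then show ?thesis using \<psi>(1) by blast
  qed
qed

lemma separated_scalars: "subalg {scale c 1 + p |c p. p \<in> P}" "separated {scale c 1 + p |c p. p \<in> P}"
proof -
  let ?B = "{scale c 1 + p |c p. p \<in> P}"
  have uniq: "c = c'" if "scale c 1 + p = scale c' 1 + p'" "p \<in> P" "p' \<in> P" for c c' p p'
  proof (rule ccontr)
    assume "c \<noteq> c'"
    have "scale (c - c') 1 = p' - p" using that(1) by (simp add: scale_left_diff_distrib algebra_simps)
    then have "scale (c - c') 1 \<in> P" using P_diff that by simp
    then have "scale (1 / (c - c')) 1 * scale (c - c') 1 \<in> P" by (rule P_left)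
    then show False using \<open>c \<noteq> c'\<close> one_notin_P by (simp add: scale_mult_left)
  qed
  have I: "scale c 1 + p \<in> ?B" if "p \<in> P" for c p using that by blast
  show sub: "subalg ?B"
    unfolding subalg_def
  proof (intro conjI subsetI allI ballI)
    show "p \<in> ?B" if "p \<in> P" for p using I[OF that, of 0] by simp
    show "scale c 1 \<in> ?B" for c using I[OF P_0, of c] by simp
    fix a b assume "a \<in> ?B" "b \<in> ?B"
    then obtain c p d q where a: "a = scale c 1 + p" "p \<in> P" and b: "b = scale d 1 + q" "q \<in> P" by blast
    have "a + b = scale (c + d) 1 + (p + q)" using a b by (simp add: scale_left_distrib algebra_simps)
    then show "a + b \<in> ?B" using I[OF P_add[OF a(2) b(2)], of "c + d"] by simp
    have "a * b = scale (c * d) 1 + (scale c q + p * b)"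
      unfolding a b by (simp add: algebra_simps scale_mult_left scale_mult_right)
    moreover have "scale c q \<in> P" using P_left[OF b(2), of "scale c 1"] by (simp add: scale_mult_left)
    ultimately show "a * b \<in> ?B" using I[OF P_add[OF _ P_right[OF a(2)]]] by simp
  qed
  define \<chi> where "\<chi> a = (THE c. \<exists>p\<in>P. a = scale c 1 + p)" for a
  have \<chi>: "\<chi> (scale c 1 + p) = c" if "p \<in> P" for c p
    unfolding \<chi>_def by (rule the_equality) (use that uniq in blast)+
  have "character_on ?B \<chi>"
    unfolding character_on_def
  proof (intro conjI ballI allI)
    fix a b assume "a \<in> ?B" "b \<in> ?B"
    then obtain c p d q where a: "a = scale c 1 + p" "p \<in> P" and b: "b = scale d 1 + q" "q \<in> P" by blast
    have ab: "\<chi> a = c" "\<chi> b = d" unfolding a(1) b(1) by (rule \<chi>[OF a(2)], rule \<chi>[OF b(2)])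
    have "a + b = scale (c + d) 1 + (p + q)" using a b by (simp add: scale_left_distrib algebra_simps)
    then show "\<chi> (a + b) = \<chi> a + \<chi> b" using \<chi>[OF P_add[OF a(2) b(2)]] ab by simp
    have "a * b = scale (c * d) 1 + (scale c q + p * b)"
      unfolding a b by (simp add: algebra_simps scale_mult_left scale_mult_right)
    moreover have "scale c q \<in> P" using P_left[OF b(2), of "scale c 1"] by (simp add: scale_mult_left)
    ultimately show "\<chi> (a * b) = \<chi> a * \<chi> b" using \<chi>[OF P_add[OF _ P_right[OF a(2)]]] ab by simp
  next
    show "\<chi> (scale c 1) = c" for c using \<chi>[OF P_0, of c] by simp
    show "\<chi> p = 0" if "p \<in> P" for p using \<chi>[OF that, of 0] by simp
  qed
  moreover have "\<chi> f \<noteq> 0" if fB: "f \<in> ?B - P" for f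
  proof -
    obtain c p where f: "f = scale c 1 + p" "p \<in> P" using fB by blast
    then have "c \<noteq> 0" using fB by auto
    then show ?thesis using \<chi> f by simp
  qed
  ultimately show "separated ?B" unfolding separated_def by blast
qed

text \<open>
  The weak Nullstellensatz: adjoin the generators one by one, starting from the scalars.
\<close>

theorem finitely_generated_character:
  assumes "finitely_generated_superalgebra scale gr"
  shows "\<exists>\<chi>. character_on UNIV \<chi>"
proof -
  obtain F where F: "finite F" "\<And>B. subalgebra scale B \<Longrightarrow> F \<subseteq> B \<Longrightarrow> B = UNIV"
    using assms unfolding finitely_generated_superalgebra_def by blast
  have "\<exists>B. subalg B \<and> separated B \<and> F \<subseteq> B" using F(1)
  proof (induction F)
    case empty then show ?case using separated_scalars by blast
  next
    case (insert x F)
    then obtain B where B: "subalg B" "separated B" "F \<subseteq> B" by blast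
    let ?B' = "{horner x l |l. set l \<subseteq> B}"
    have "horner x [a] \<in> ?B'" if "a \<in> B" for a using that by (intro CollectI exI[of _ "[a]"]) simp
    moreover have "horner x [0, 1] \<in> ?B'" using subalgD(5,6)[OF B(1)] by (intro CollectI exI[of _ "[0, 1]"]) simp
    ultimately have "insert x F \<subseteq> ?B'" using B(3) by auto
    then show ?case using subalg_adjoin[OF B(1)] separated_adjoin[OF B(1,2)] by blast
  qed
  then obtain B where B: "subalg B" "separated B" "F \<subseteq> B" by blast
  have "subalgebra scale B"
    unfolding subalgebra_def
  proof (intro conjI ballI)
    show "subspace B"
    proof (rule subspaceI)
      fix c a assume "a \<in> B"
      then have "scale c 1 * a \<in> B" using subalgD(2,4)[OF B(1)] by blast
      then show "scale c a \<in> B" by (simp add: scale_mult_left)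
    qed (use subalgD[OF B(1)] in auto)
  qed (use subalgD[OF B(1)] in auto)
  then have "B = UNIV" using F(2) B(3) by blast
  then show ?thesis using B(2) one_notin_P unfolding separated_def by blast
qed

end

section \<open>Fractions with even denominators and regularity in the stalk\<close>

context even_denominators
begin

lemma S_comm: "s \<in> S \<Longrightarrow> a * s = s * a"
  using S_even even_central by (metis subsetD)

lemma S_left_comm: "s \<in> S \<Longrightarrow> a * (s * c) = s * (a * c)"
  using S_comm[of s a] by (metis mult.assoc)

lemma S_left_comm': "s \<in> S \<Longrightarrow> s * (a * c) = a * (s * c)"
  by (rule S_left_comm[symmetric])

lemmas S_simps = S_comm S_left_comm S_left_comm' mult.assoc distrib_left distrib_right

lemma equiv_frac_rel: "equiv (UNIV \<times> S) (frac_rel S)"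
proof (rule equivI)
  show "frac_rel S \<subseteq> (UNIV \<times> S) \<times> UNIV \<times> S" unfolding frac_rel_def by auto
  show "refl_on (UNIV \<times> S) (frac_rel S)"
    using one_S unfolding refl_on_def frac_rel_def by auto
  show "sym (frac_rel S)"
  proof (rule symI)
    fix x y assume "(x, y) \<in> frac_rel S"
    then obtain a s b t u where x: "x = (a, s)" "y = (b, t)" "s \<in> S" "t \<in> S" "u \<in> S" "u * (t * a - s * b) = 0"
      unfolding frac_rel_def by auto
    have "u * (s * b - t * a) = - (u * (t * a - s * b))" by (simp add: algebra_simps)
    then show "(y, x) \<in> frac_rel S" unfolding frac_rel_def using x by auto
  qed
  show "trans (frac_rel S)"
  proof (rule transI)
    fix x y z assume "(x, y) \<in> frac_rel S" "(y, z) \<in> frac_rel S"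
    then obtain a s b t u c r v where x: "x = (a, s)" "y = (b, t)" "z = (c, r)" "s \<in> S" "t \<in> S" "r \<in> S"
      and u: "u \<in> S" "u * (t * a - s * b) = 0" and v: "v \<in> S" "v * (r * b - t * c) = 0"
      unfolding frac_rel_def by auto
    have "(u * v * t) * (r * a - s * c) = r * (v * (u * (t * a - s * b))) + s * (u * (v * (r * b - t * c)))"
      using x u(1) v(1) by (simp add: S_simps right_diff_distrib)
    also have "\<dots> = 0" using u v by simp
    finally show "(x, z) \<in> frac_rel S"
      unfolding frac_rel_def using x u(1) v(1) mult_S by blast
  qed
qed

lemma fraction_eq_iff:
  "s \<in> S \<Longrightarrow> t \<in> S \<Longrightarrow> fraction S a s = fraction S c t \<longleftrightarrow> (\<exists>u\<in>S. u * (t * a - s * c) = 0)"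
  unfolding fraction_def by (subst eq_equiv_class_iff[OF equiv_frac_rel]) (auto simp: frac_rel_def)

lemma fraction_eqI: "s \<in> S \<Longrightarrow> t \<in> S \<Longrightarrow> t * a = s * c \<Longrightarrow> fraction S a s = fraction S c t"
  using fraction_eq_iff one_S by auto

abbreviation R where "R \<equiv> localization gr S"

lemma carrier_R: "carrier R = {fraction S a s |a s. s \<in> S}"
  unfolding localization_def quotient_def fraction_def by auto

lemma fraction_carrier: "s \<in> S \<Longrightarrow> fraction S a s \<in> carrier R"
  unfolding carrier_R by blast

lemma mult_fraction:
  assumes "s \<in> S" "t \<in> S"
  shows "fraction S a s \<otimes>\<^bsub>R\<^esub> fraction S c t = fraction S (a * c) (s * t)"
proof -
  have cong: "congruent2 (frac_rel S) (frac_rel S) (\<lambda>x y. fraction S (fst x * fst y) (snd x * snd y))"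
  proof (rule congruent2I')
    fix x x' y y' assume "(x, x') \<in> frac_rel S" "(y, y') \<in> frac_rel S"
    then obtain a s a' s' u c t c' t' v where x: "x = (a, s)" "x' = (a', s')" "s \<in> S" "s' \<in> S"
      and y: "y = (c, t)" "y' = (c', t')" "t \<in> S" "t' \<in> S"
      and u: "u \<in> S" "u * (s' * a - s * a') = 0" and v: "v \<in> S" "v * (t' * c - t * c') = 0"
      unfolding frac_rel_def by auto
    have "(u * v) * ((s' * t') * (a * c) - (s * t) * (a' * c')) =
      (u * (s' * a - s * a')) * (v * (t' * c)) + (u * (s * a')) * (v * (t' * c - t * c'))"
      using x(3,4) y(3,4) u(1) v(1) by (simp add: S_simps left_diff_distrib right_diff_distrib)
    also have "\<dots> = 0" using u v by simp
    finally show "fraction S (fst x * fst y) (snd x * snd y) = fraction S (fst x' * fst y') (snd x' * snd y')"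
      using x y u(1) v(1) mult_S fraction_eq_iff by auto
  qed
  show ?thesis
    unfolding localization_def
    using UN_equiv_class2[OF equiv_frac_rel equiv_frac_rel cong, of "(a, s)" "(c, t)"] assms
    by (simp add: fraction_def)
qed

lemma add_fraction:
  assumes "s \<in> S" "t \<in> S"
  shows "fraction S a s \<oplus>\<^bsub>R\<^esub> fraction S c t = fraction S (t * a + s * c) (s * t)"
proof -
  have cong: "congruent2 (frac_rel S) (frac_rel S)
     (\<lambda>x y. fraction S (snd y * fst x + snd x * fst y) (snd x * snd y))"
  proof (rule congruent2I')
    fix x x' y y' assume "(x, x') \<in> frac_rel S" "(y, y') \<in> frac_rel S"
    then obtain a s a' s' u c t c' t' v where x: "x = (a, s)" "x' = (a', s')" "s \<in> S" "s' \<in> S"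
      and y: "y = (c, t)" "y' = (c', t')" "t \<in> S" "t' \<in> S"
      and u: "u \<in> S" "u * (s' * a - s * a') = 0" and v: "v \<in> S" "v * (t' * c - t * c') = 0"
      unfolding frac_rel_def by auto
    have "(u * v) * ((s' * t') * (t * a + s * c) - (s * t) * (t' * a' + s' * c')) =
      v * (t * (t' * (u * (s' * a - s * a')))) + u * (s * (s' * (v * (t' * c - t * c'))))"
      using x(3,4) y(3,4) u(1) v(1) by (simp add: S_simps left_diff_distrib right_diff_distrib)
    also have "\<dots> = 0" using u v by simp
    finally show "fraction S (snd y * fst x + snd x * fst y) (snd x * snd y) =
       fraction S (snd y' * fst x' + snd x' * fst y') (snd x' * snd y')"
      using x y u(1) v(1) mult_S fraction_eq_iff by auto
  qed
  show ?thesis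
    unfolding localization_def
    using UN_equiv_class2[OF equiv_frac_rel equiv_frac_rel cong, of "(a, s)" "(c, t)"] assms
    by (simp add: fraction_def)
qed

lemma add_fraction_same: "s \<in> S \<Longrightarrow> fraction S a s \<oplus>\<^bsub>R\<^esub> fraction S c s = fraction S (a + c) s"
  unfolding add_fraction by (rule fraction_eqI) (auto simp: mult_S S_simps)

lemma one_R: "\<one>\<^bsub>R\<^esub> = fraction S 1 1" and zero_R: "\<zero>\<^bsub>R\<^esub> = fraction S 0 1"
  and part_R: "part R i = {fraction S a s |a s. a \<in> gr i \<and> s \<in> S}"
  unfolding localization_def by simp_all

lemma zero_fraction: "s \<in> S \<Longrightarrow> fraction S 0 s = \<zero>\<^bsub>R\<^esub>"
  unfolding zero_R by (rule fraction_eqI) (auto simp: one_S)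

lemma fraction_expand:
  assumes "s \<in> S" "t \<in> S"
  shows "fraction S a s = fraction S (t * a) (s * t)" and "fraction S a s = fraction S (t * a) (t * s)"
proof -
  show "fraction S a s = fraction S (t * a) (s * t)"
    by (rule fraction_eqI) (simp_all add: assms mult_S mult.assoc)
  then show "fraction S a s = fraction S (t * a) (t * s)" using S_comm[OF assms(2), of s] by simp
qed

lemma common_denominator:
  assumes "x \<in> carrier R" "y \<in> carrier R"
  obtains a c s where "s \<in> S" "x = fraction S a s" "y = fraction S c s"
proof -
  obtain a s c t where xy: "x = fraction S a s" "s \<in> S" "y = fraction S c t" "t \<in> S"
    using assms unfolding carrier_R by blast
  have "x = fraction S (t * a) (s * t)" "y = fraction S (s * c) (s * t)"
    unfolding xy(1,3) by (rule fraction_expand[OF xy(2,4)], rule fraction_expand[OF xy(4,2)])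
  then show thesis using that[OF mult_S[OF xy(2,4)]] by blast
qed

lemma common_denominator3:
  assumes "x \<in> carrier R" "y \<in> carrier R" "z \<in> carrier R"
  obtains a c d s where "s \<in> S" "x = fraction S a s" "y = fraction S c s" "z = fraction S d s"
proof -
  obtain a c s where xy: "s \<in> S" "x = fraction S a s" "y = fraction S c s"
    using common_denominator[OF assms(1,2)] by blast
  obtain d t where z: "z = fraction S d t" "t \<in> S" using assms unfolding carrier_R by blast
  have "x = fraction S (t * a) (s * t)" "y = fraction S (t * c) (s * t)" "z = fraction S (s * d) (s * t)"
    unfolding xy(2,3) z(1)
    by (rule fraction_expand(1)[OF xy(1) z(2)], rule fraction_expand(1)[OF xy(1) z(2)],
        rule fraction_expand(2)[OF z(2) xy(1)])
  then show thesis using that[OF mult_S[OF xy(1) z(2)]] by blast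
qed

lemma ring_R: "ring R"
proof (rule ringI)
  show "abelian_group R"
  proof (rule abelian_groupI)
    fix x y assume xy: "x \<in> carrier R" "y \<in> carrier R"
    then obtain a c s where *: "s \<in> S" "x = fraction S a s" "y = fraction S c s" by (rule common_denominator)
    show "x \<oplus>\<^bsub>R\<^esub> y \<in> carrier R" unfolding * add_fraction_same[OF *(1)] by (rule fraction_carrier[OF *(1)])
    show "x \<oplus>\<^bsub>R\<^esub> y = y \<oplus>\<^bsub>R\<^esub> x" unfolding * add_fraction_same[OF *(1)] by (simp add: add.commute)
    show "\<zero>\<^bsub>R\<^esub> \<oplus>\<^bsub>R\<^esub> x = x"
      unfolding *(2) zero_fraction[OF *(1), symmetric] add_fraction_same[OF *(1)] by simp
    show "\<exists>y\<in>carrier R. y \<oplus>\<^bsub>R\<^esub> x = \<zero>\<^bsub>R\<^esub>"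
      using add_fraction_same[OF *(1), of "- a" a] zero_fraction[OF *(1)] fraction_carrier[OF *(1), of "- a"] *(2)
      by auto
  next
    fix x y z assume "x \<in> carrier R" "y \<in> carrier R" "z \<in> carrier R"
    then obtain a c d s where *: "s \<in> S" "x = fraction S a s" "y = fraction S c s" "z = fraction S d s"
      by (rule common_denominator3)
    show "x \<oplus>\<^bsub>R\<^esub> y \<oplus>\<^bsub>R\<^esub> z = x \<oplus>\<^bsub>R\<^esub> (y \<oplus>\<^bsub>R\<^esub> z)"
      unfolding * add_fraction_same[OF *(1)] by (simp add: add.assoc)
  next
    show "\<zero>\<^bsub>R\<^esub> \<in> carrier R" unfolding zero_R by (rule fraction_carrier[OF one_S])
  qed
  show "monoid R"
  proof (rule monoidI)
    fix x y assume xy: "x \<in> carrier R" "y \<in> carrier R"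
    then obtain a c s where *: "s \<in> S" "x = fraction S a s" "y = fraction S c s" by (rule common_denominator)
    show "x \<otimes>\<^bsub>R\<^esub> y \<in> carrier R" unfolding * mult_fraction[OF *(1,1)] by (rule fraction_carrier[OF mult_S[OF *(1,1)]])
    show "\<one>\<^bsub>R\<^esub> \<otimes>\<^bsub>R\<^esub> x = x" "x \<otimes>\<^bsub>R\<^esub> \<one>\<^bsub>R\<^esub> = x"
      unfolding * one_R mult_fraction[OF *(1) one_S] mult_fraction[OF one_S *(1)] by simp_all
  next
    fix x y z assume "x \<in> carrier R" "y \<in> carrier R" "z \<in> carrier R"
    then obtain a c d s where *: "s \<in> S" "x = fraction S a s" "y = fraction S c s" "z = fraction S d s"
      by (rule common_denominator3)
    show "x \<otimes>\<^bsub>R\<^esub> y \<otimes>\<^bsub>R\<^esub> z = x \<otimes>\<^bsub>R\<^esub> (y \<otimes>\<^bsub>R\<^esub> z)"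
      unfolding * using *(1) by (simp add: mult_fraction mult_S mult.assoc)
  next
    show "\<one>\<^bsub>R\<^esub> \<in> carrier R" unfolding one_R by (rule fraction_carrier[OF one_S])
  qed
  fix x y z assume "x \<in> carrier R" "y \<in> carrier R" "z \<in> carrier R"
  then obtain a c d s where *: "s \<in> S" "x = fraction S a s" "y = fraction S c s" "z = fraction S d s"
    by (rule common_denominator3)
  show "(x \<oplus>\<^bsub>R\<^esub> y) \<otimes>\<^bsub>R\<^esub> z = x \<otimes>\<^bsub>R\<^esub> z \<oplus>\<^bsub>R\<^esub> y \<otimes>\<^bsub>R\<^esub> z" "z \<otimes>\<^bsub>R\<^esub> (x \<oplus>\<^bsub>R\<^esub> y) = z \<otimes>\<^bsub>R\<^esub> x \<oplus>\<^bsub>R\<^esub> z \<otimes>\<^bsub>R\<^esub> y"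
    unfolding * using *(1) by (simp_all add: add_fraction_same mult_fraction mult_S distrib_left distrib_right)
qed

definition extend :: "'a set \<Rightarrow> ('a \<times> 'a) set set" where
  "extend I = {fraction S x s |x s. x \<in> I \<and> s \<in> S}"

lemma fraction_extend_iff:
  assumes I: "twist_ideal I" and s: "s \<in> S"
  shows "fraction S a s \<in> extend I \<longleftrightarrow> (\<exists>u\<in>S. u * a \<in> I)"
proof
  assume "fraction S a s \<in> extend I"
  then obtain x t u where x: "x \<in> I" "t \<in> S" "u \<in> S" "u * (t * a - s * x) = 0"
    unfolding extend_def using fraction_eq_iff[OF s] by auto
  then have "(u * t) * a = (u * s) * x" by (simp add: algebra_simps)
  then have "(u * t) * a \<in> I" using x(1) twist_idealD(3)[OF I] by simp
  then show "\<exists>u\<in>S. u * a \<in> I" using mult_S x by blast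
next
  assume "\<exists>u\<in>S. u * a \<in> I"
  then obtain u where u: "u \<in> S" "u * a \<in> I" by blast
  have "fraction S a s = fraction S (u * a) (u * s)"
    by (rule fraction_eqI) (use u s mult_S in \<open>auto simp: S_simps\<close>)
  then show "fraction S a s \<in> extend I" unfolding extend_def using u s mult_S by blast
qed

lemma ideal_extend:
  assumes I: "twist_ideal I"
  shows "ideal (extend I) R"
proof (rule idealI[OF ring_R])
  interpret R: ring R by (rule ring_R)
  have sub: "extend I \<subseteq> carrier R" unfolding extend_def carrier_R by blast
  have add: "x \<oplus>\<^bsub>R\<^esub> y \<in> extend I" if xy: "x \<in> extend I" "y \<in> extend I" for x y
  proof -
    obtain a s c t where *: "x = fraction S a s" "y = fraction S c t" "a \<in> I" "c \<in> I" "s \<in> S" "t \<in> S"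
      using xy unfolding extend_def by blast
    have "t * a + s * c \<in> I" using * twist_idealD(2,3)[OF I] by blast
    then show ?thesis unfolding extend_def *(1,2) add_fraction[OF *(5,6)] using mult_S[OF *(5,6)] by blast
  qed
  have neg: "\<ominus>\<^bsub>R\<^esub> x \<in> extend I" if x: "x \<in> extend I" for x
  proof -
    obtain a s where a: "x = fraction S a s" "a \<in> I" "s \<in> S" using x unfolding extend_def by blast
    have "fraction S (- a) s \<oplus>\<^bsub>R\<^esub> x = \<zero>\<^bsub>R\<^esub>" using a add_fraction_same zero_fraction by simp
    then have "\<ominus>\<^bsub>R\<^esub> x = fraction S (- a) s"
      by (rule R.minus_equality) (use x sub fraction_carrier[OF a(3)] in auto)
    then show ?thesis unfolding extend_def using a twist_ideal_minus[OF I] by auto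
  qed
  show "subgroup (extend I) (add_monoid R)"
  proof
    show "extend I \<subseteq> carrier (add_monoid R)" using sub by simp
    show "\<one>\<^bsub>add_monoid R\<^esub> \<in> extend I"
      using zero_R twist_idealD(1)[OF I] one_S unfolding extend_def by auto
    show "inv\<^bsub>add_monoid R\<^esub> x \<in> extend I" if "x \<in> extend I" for x
      using neg[OF that] unfolding a_inv_def .
  qed (use add in simp)
  fix x y assume x: "x \<in> extend I" and y: "y \<in> carrier R"
  obtain a s c t where *: "x = fraction S a s" "y = fraction S c t" "a \<in> I" "s \<in> S" "t \<in> S"
    using x y unfolding extend_def carrier_R by blast
  show "y \<otimes>\<^bsub>R\<^esub> x \<in> extend I"
    unfolding *(1,2) mult_fraction[OF *(5,4)] extend_def
    using mult_S[OF *(5,4)] twist_idealD(3)[OF I *(3)] by blast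
  show "x \<otimes>\<^bsub>R\<^esub> y \<in> extend I"
    unfolding *(1,2) mult_fraction[OF *(4,5)] extend_def
    using mult_S[OF *(4,5)] twist_idealD(4)[OF I *(3)] by blast
qed

end

context localized_letters
begin

lemma fraction_extend_V: "s \<in> S \<Longrightarrow> fraction S a s \<in> extend (V n d) \<longleftrightarrow> a \<in> P n d"
  using fraction_extend_iff[OF twist_ideal_V] unfolding P_def sat_def by auto

lemma Idl_letters:
  assumes st: "\<And>j. j < n \<Longrightarrow> st j \<in> S"
  shows "Idl\<^bsub>R\<^esub> ((\<lambda>j. fraction S (b j) (st j)) ` {..<n}) = extend (V n 1)"
proof
  interpret R: ring R by (rule ring_R)
  let ?G = "(\<lambda>j. fraction S (b j) (st j)) ` {..<n}"
  have G: "?G \<subseteq> carrier R" using st fraction_carrier by blast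
  show "Idl\<^bsub>R\<^esub> ?G \<subseteq> extend (V n 1)"
  proof (rule R.genideal_minimal[OF ideal_extend[OF twist_ideal_V]])
    have "b j \<in> V n 1" if "j < n" for j using V_letter[of 1 n 0 j] that by simp
    then show "?G \<subseteq> extend (V n 1)" unfolding extend_def using st by blast
  qed
  interpret I: ideal "Idl\<^bsub>R\<^esub> ?G" R by (rule R.genideal_ideal[OF G])
  have "fraction S x s \<in> Idl\<^bsub>R\<^esub> ?G" if "jet UNIV n 1 x Y" "s \<in> S" for x Y s
    using that
  proof (induction "1::nat" x Y rule: jet.induct)
    case jet_zero then show ?case using zero_fraction I.zero_closed by simp
  next
    case (jet_add y Y z Z)
    then have "fraction S y s \<in> Idl\<^bsub>R\<^esub> ?G" "fraction S z s \<in> Idl\<^bsub>R\<^esub> ?G" by blast+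
    from I.a_closed[OF this] show ?case unfolding add_fraction_same[OF \<open>s \<in> S\<close>] .
  next
    case (jet_letter d y Y j)
    have sj: "st j \<in> S" using st jet_letter by blast
    have eq: "fraction S (b j * y) s = fraction S (b j) (st j) \<otimes>\<^bsub>R\<^esub> fraction S (st j * y) s"
      unfolding mult_fraction[OF sj \<open>s \<in> S\<close>] S_left_comm[OF sj, of "b j" y]
      by (rule fraction_expand(2)[OF \<open>s \<in> S\<close> sj])
    have "fraction S (b j) (st j) \<in> Idl\<^bsub>R\<^esub> ?G" using R.genideal_self[OF G] jet_letter by blast
    then show ?case unfolding eq by (rule I.I_r_closed) (rule fraction_carrier[OF \<open>s \<in> S\<close>])
  qed simp
  then show "extend (V n 1) \<subseteq> Idl\<^bsub>R\<^esub> ?G" unfolding extend_def V_def by blast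
qed

text \<open>
  Passing from the ring of fractions back to saturated ideals: a fraction lies in the ideal
  generated by the preceding elements exactly if its numerator is in the saturated ideal.
\<close>

lemma regular_letterI:
  assumes st: "\<And>j. j \<le> n \<Longrightarrow> st j \<in> S"
  defines "a \<equiv> \<lambda>j. fraction S (b j) (st j)"
  defines "I \<equiv> Idl\<^bsub>R\<^esub> (a ` {..<n})"
  assumes reg: "par n = 0 \<and> even_regular (R Quot I) (I +>\<^bsub>R\<^esub> a n) \<or>
    par n = 1 \<and> odd_regular (R Quot I) (I +>\<^bsub>R\<^esub> a n)"
  shows "regular_letter n"
proof -
  interpret R: ring R by (rule ring_R)
  have I_eq: "I = extend (V n 1)" unfolding I_def a_def by (rule Idl_letters) (use st in auto)
  interpret I: ideal I R unfolding I_eq by (rule ideal_extend[OF twist_ideal_V])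
  have an: "a n \<in> carrier R" unfolding a_def using st fraction_carrier by blast
  have key: "a n \<otimes>\<^bsub>R\<^esub> fraction S y 1 \<in> I" if "b n * y \<in> P n 1" for y
    unfolding I_eq a_def using that fraction_extend_V st one_S by (simp add: mult_fraction)
  have fy: "fraction S y 1 \<in> carrier R" for y using fraction_carrier one_S by blast
  have coset: "(I +>\<^bsub>R\<^esub> a n) \<otimes>\<^bsub>R Quot I\<^esub> (I +>\<^bsub>R\<^esub> g) = I +>\<^bsub>R\<^esub> (a n \<otimes>\<^bsub>R\<^esub> g)"
    if "g \<in> carrier R" for g
    unfolding FactRing_def using I.rcoset_mult_add[OF an that] by simp
  have carr: "I +>\<^bsub>R\<^esub> g \<in> carrier (R Quot I)" if "g \<in> carrier R" for g
    unfolding FactRing_def A_RCOSETS_def' using that by auto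
  show ?thesis
    using reg
  proof
    assume "par n = 0 \<and> even_regular (R Quot I) (I +>\<^bsub>R\<^esub> a n)"
    then have p: "par n = 0" and inj: "inj_on (\<lambda>b. (I +>\<^bsub>R\<^esub> a n) \<otimes>\<^bsub>R Quot I\<^esub> b) (carrier (R Quot I))"
      unfolding even_regular_def by auto
    have "y \<in> P n 1" if y: "b n * y \<in> P n 1" for y
    proof -
      have "(I +>\<^bsub>R\<^esub> a n) \<otimes>\<^bsub>R Quot I\<^esub> (I +>\<^bsub>R\<^esub> fraction S y 1) = I"
        unfolding coset[OF fy] using I.a_rcos_const[OF key[OF y]] .
      moreover have "(I +>\<^bsub>R\<^esub> a n) \<otimes>\<^bsub>R Quot I\<^esub> (I +>\<^bsub>R\<^esub> \<zero>\<^bsub>R\<^esub>) = I"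
        unfolding coset[OF R.zero_closed] using an I.a_rcos_const[OF I.zero_closed] by simp
      ultimately have "I +>\<^bsub>R\<^esub> fraction S y 1 = I +>\<^bsub>R\<^esub> \<zero>\<^bsub>R\<^esub>"
        using inj_onD[OF inj] carr[OF fy] carr[OF R.zero_closed] by metis
      then have "I +>\<^bsub>R\<^esub> fraction S y 1 = I" using I.a_rcos_const[OF I.zero_closed] by simp
      then have "fraction S y 1 \<in> I" using I.rcos_const_imp_mem[OF fy] by blast
      then show ?thesis unfolding I_eq using fraction_extend_V[OF one_S] by blast
    qed
    then show ?thesis unfolding regular_letter_def using p by blast
  next
    assume "par n = 1 \<and> odd_regular (R Quot I) (I +>\<^bsub>R\<^esub> a n)"
    then have p: "par n = 1" and ex: "{b \<in> carrier (R Quot I). (I +>\<^bsub>R\<^esub> a n) \<otimes>\<^bsub>R Quot I\<^esub> b = \<zero>\<^bsub>R Quot I\<^esub>} =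
       (\<lambda>b. (I +>\<^bsub>R\<^esub> a n) \<otimes>\<^bsub>R Quot I\<^esub> b) ` carrier (R Quot I)"
      unfolding odd_regular_def by auto
    have "y \<in> P (Suc n) 1" if y: "b n * y \<in> P n 1" for y
    proof -
      have "(I +>\<^bsub>R\<^esub> a n) \<otimes>\<^bsub>R Quot I\<^esub> (I +>\<^bsub>R\<^esub> fraction S y 1) = \<zero>\<^bsub>R Quot I\<^esub>"
        unfolding coset[OF fy] using I.a_rcos_const[OF key[OF y]] by (simp add: FactRing_def)
      then have "I +>\<^bsub>R\<^esub> fraction S y 1 \<in> (\<lambda>b. (I +>\<^bsub>R\<^esub> a n) \<otimes>\<^bsub>R Quot I\<^esub> b) ` carrier (R Quot I)"
        using ex carr[OF fy] by blast
      then obtain G where "G \<in> carrier (R Quot I)"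
        "I +>\<^bsub>R\<^esub> fraction S y 1 = (I +>\<^bsub>R\<^esub> a n) \<otimes>\<^bsub>R Quot I\<^esub> G" by blast
      then obtain g where g: "g \<in> carrier R"
        "I +>\<^bsub>R\<^esub> fraction S y 1 = I +>\<^bsub>R\<^esub> (a n \<otimes>\<^bsub>R\<^esub> g)"
        unfolding FactRing_def A_RCOSETS_def' using coset by (auto simp: FactRing_def)
      have ag: "a n \<otimes>\<^bsub>R\<^esub> g \<in> carrier R" using an g by simp
      have d: "fraction S y 1 \<ominus>\<^bsub>R\<^esub> (a n \<otimes>\<^bsub>R\<^esub> g) \<in> I"
        using R.quotient_eq_iff_same_a_r_cos[OF I.ideal_axioms fy ag] g(2) by blast
      interpret I': ideal "extend (V (Suc n) 1)" R by (rule ideal_extend[OF twist_ideal_V])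
      have "I \<subseteq> extend (V (Suc n) 1)" unfolding I_eq extend_def using V_mono[of n "Suc n" 1] by auto
      moreover have "a n \<in> extend (V (Suc n) 1)"
        unfolding a_def using V_letter[of 1 "Suc n" 0 n] st unfolding extend_def by auto
      ultimately have "(fraction S y 1 \<ominus>\<^bsub>R\<^esub> (a n \<otimes>\<^bsub>R\<^esub> g)) \<oplus>\<^bsub>R\<^esub> (a n \<otimes>\<^bsub>R\<^esub> g) \<in> extend (V (Suc n) 1)"
        using d g(1) I'.I_r_closed I'.a_closed by blast
      moreover have "(fraction S y 1 \<ominus>\<^bsub>R\<^esub> (a n \<otimes>\<^bsub>R\<^esub> g)) \<oplus>\<^bsub>R\<^esub> (a n \<otimes>\<^bsub>R\<^esub> g) = fraction S y 1"
        using fy[of y] ag by (simp add: a_minus_def R.a_assoc R.l_neg)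
      ultimately show ?thesis using fraction_extend_V[OF one_S] by simp
    qed
    then show ?thesis unfolding regular_letter_def using p by blast
  qed
qed

end

section \<open>Closed points\<close>

lemma ring_of_type_algebra_simps:
  "carrier ring_of_type_algebra = (UNIV :: 'a::ring_1 set)"
  "x \<otimes>\<^bsub>ring_of_type_algebra\<^esub> y = (x * y :: 'a)"
  "x \<oplus>\<^bsub>ring_of_type_algebra\<^esub> y = (x + y :: 'a)"
  "\<zero>\<^bsub>ring_of_type_algebra\<^esub> = (0 :: 'a)"
  "\<one>\<^bsub>ring_of_type_algebra\<^esub> = (1 :: 'a)"
  by (simp_all add: ring_of_type_algebra_def)

lemma ring_of_type_algebra_ring_1: "ring (ring_of_type_algebra :: 'a::ring_1 ring)"
proof (rule ringI)
  show "abelian_group (ring_of_type_algebra :: 'a ring)"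
  proof (rule abelian_groupI)
    show "\<exists>y\<in>carrier ring_of_type_algebra. y \<oplus>\<^bsub>ring_of_type_algebra\<^esub> x = \<zero>\<^bsub>ring_of_type_algebra\<^esub>" for x :: 'a
      by (auto simp: ring_of_type_algebra_simps intro: exI[of _ "- x"])
  qed (auto simp: ring_of_type_algebra_simps add.assoc add.commute)
  show "monoid (ring_of_type_algebra :: 'a ring)"
    by (rule monoidI) (auto simp: ring_of_type_algebra_simps mult.assoc)
qed (auto simp: ring_of_type_algebra_simps algebra_simps)

lemma ideal_ring_of_type_algebra_iff:
  fixes I :: "'a::ring_1 set"
  shows "ideal I ring_of_type_algebra \<longleftrightarrow>
     0 \<in> I \<and> (\<forall>x\<in>I. \<forall>y\<in>I. x + y \<in> I) \<and> (\<forall>x\<in>I. \<forall>a. a * x \<in> I \<and> x * a \<in> I)"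
proof
  assume "ideal I ring_of_type_algebra"
  then interpret ideal I "ring_of_type_algebra :: 'a ring" .
  show "0 \<in> I \<and> (\<forall>x\<in>I. \<forall>y\<in>I. x + y \<in> I) \<and> (\<forall>x\<in>I. \<forall>a. a * x \<in> I \<and> x * a \<in> I)"
    using additive_subgroup.zero_closed[OF additive_subgroup_axioms] additive_subgroup.a_closed[OF additive_subgroup_axioms]
      I_l_closed I_r_closed by (simp add: ring_of_type_algebra_simps)
next
  assume I: "0 \<in> I \<and> (\<forall>x\<in>I. \<forall>y\<in>I. x + y \<in> I) \<and> (\<forall>x\<in>I. \<forall>a. a * x \<in> I \<and> x * a \<in> I)"
  interpret R: ring "ring_of_type_algebra :: 'a ring" by (rule ring_of_type_algebra_ring_1)
  show "ideal I ring_of_type_algebra"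
  proof (rule idealI[OF R.ring_axioms])
    show "subgroup I (add_monoid ring_of_type_algebra)"
    proof
      fix x assume x: "x \<in> I"
      have "\<ominus>\<^bsub>ring_of_type_algebra\<^esub> x = - x"
        by (rule R.minus_equality) (auto simp: ring_of_type_algebra_simps)
      moreover have "- x \<in> I" using I x by (metis mult_minus1)
      ultimately show "inv\<^bsub>add_monoid ring_of_type_algebra\<^esub> x \<in> I" by (simp add: a_inv_def)
    qed (use I in \<open>auto simp: ring_of_type_algebra_simps\<close>)
  qed (use I in \<open>auto simp: ring_of_type_algebra_simps\<close>)
qed

context char0_superalgebra
begin

lemma superideal_twist_ideal:
  assumes "superideal gr I" shows "twist_ideal I"
proof -
  have I: "0 \<in> I" "\<And>x y. x \<in> I \<Longrightarrow> y \<in> I \<Longrightarrow> x + y \<in> I" "\<And>x a. x \<in> I \<Longrightarrow> a * x \<in> I" "\<And>x a. x \<in> I \<Longrightarrow> x * a \<in> I"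
    using assms unfolding superideal_def ideal_ring_of_type_algebra_iff by auto
  have tw: "twist i w \<in> I" if w: "w \<in> I" for w i
  proof -
    obtain x y where xy: "x \<in> I" "x \<in> gr 0" "y \<in> I" "y \<in> gr 1" "w = x + y"
      using assms w unfolding superideal_def graded_subset_def by blast
    have "x + (- 1) * y \<in> I" using xy I by blast
    then show ?thesis using xy \<open>w \<in> I\<close> by (cases i) (auto simp: twist_parts)
  qed
  show ?thesis unfolding twist_ideal_def by (intro conjI ballI allI I tw)
qed

lemma odd_square_left: "x \<in> gr 1 \<Longrightarrow> (a * x) * (a * x) = 0"
proof -
  assume x: "x \<in> gr 1"
  have "(a * x) * (a * x) = a * ((x * a) * x)" by (simp add: mult.assoc)
  also have "x * a = twist 1 a * x" by (rule commute_left[OF x])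
  also have "a * (twist 1 a * x * x) = a * (twist 1 a * (x * x))" by (simp add: mult.assoc)
  finally show ?thesis using odd_square[OF x] by simp
qed

text \<open>
  Numerators of the elements of the regular sequence serve as letters.  If all of them were used as
  odd elements, the number \<open>s\<close> of odd elements would be the full length \<open>r + s\<close>; so for \<open>r \<ge> 1\<close> some
  letter is even.
\<close>

theorem smooth_point_coordinates:
  assumes p: "p \<in> Spec gr" and smooth: "smooth_point gr p r s"
  obtains b par m where "localized_letters scale gr b par (gr 0 - p)"
    "\<And>j. j < m \<Longrightarrow> localized_letters.regular_letter gr b par (gr 0 - p) j"
    "localized_letters.P gr b par (gr 0 - p) m 1 = p"
    "r \<ge> 1 \<Longrightarrow> \<exists>j<m. par j = 0"
proof -
  let ?S = "gr 0 - p"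
  have sup: "superideal gr p" and pU: "p \<noteq> UNIV" and prime: "\<And>a c. a * c \<in> p \<Longrightarrow> a \<in> p \<or> c \<in> p"
    using p unfolding Spec_def by auto
  note tp = superideal_twist_ideal[OF sup]
  have one_p: "1 \<notin> p" using pU twist_idealD(3)[OF tp, of 1] by auto
  interpret even_denominators scale gr ?S
  proof
    show "s * t \<in> ?S" if "s \<in> ?S" "t \<in> ?S" for s t
      using that mult_gr[of s 0 t 0] prime by auto
  qed (use one_gr one_p in auto)
  obtain as where reg: "regular_sequence R as" and len: "length as = r + s"
    and ev: "length (filter (\<lambda>x. x \<in> part R 0) as) = r" and od: "length (filter (\<lambda>x. x \<in> part R 1) as) = s"
    and gen: "stalk_maximal_ideal gr p = Idl\<^bsub>R\<^esub> (set as)"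
    using smooth unfolding smooth_point_def stalk_def by blast
  define m where "m = length as"
  define B where "B n = R Quot (Idl\<^bsub>R\<^esub> (set (take n as)))" for n
  define z where "z n = Idl\<^bsub>R\<^esub> (set (take n as)) +>\<^bsub>R\<^esub> (as ! n)" for n
  have reg': "as ! n \<in> part R 0 \<and> even_regular (B n) (z n) \<or> as ! n \<in> part R 1 \<and> odd_regular (B n) (z n)"
    if "n < m" for n
    using reg that unfolding regular_sequence_def B_def z_def m_def by (simp add: Let_def)
  define par where "par n = (if as ! n \<in> part R 0 \<and> even_regular (B n) (z n) then 0 else 1 :: bit)" for n
  have par: "as ! n \<in> part R (par n)" "par n = 0 \<and> even_regular (B n) (z n) \<or> par n = 1 \<and> odd_regular (B n) (z n)"
    if "n < m" for n using reg'[OF that] unfolding par_def by auto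
  have "\<exists>a t. a \<in> gr (par n) \<and> t \<in> ?S \<and> (n < m \<longrightarrow> as ! n = fraction ?S a t)" for n
  proof (cases "n < m")
    case True then show ?thesis using par(1)[OF True] unfolding part_R by blast
  next
    case False then show ?thesis using gr_zero one_S by blast
  qed
  then obtain b st where b: "\<And>n. b n \<in> gr (par n)" and st: "\<And>n. st n \<in> ?S"
    and as: "\<And>n. n < m \<Longrightarrow> as ! n = fraction ?S (b n) (st n)" by metis
  interpret L: localized_letters scale gr b par ?S
    by unfold_locales (use b S_even one_S mult_S in auto)
  have set_take: "set (take n as) = (\<lambda>j. fraction ?S (b j) (st j)) ` {..<n}" if "n \<le> m" for n
  proof -
    have "set (take n as) = (\<lambda>j. as ! j) ` {..<n}"
      using nth_image[of n as] that unfolding m_def by (auto simp: lessThan_atLeast0)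
    then show ?thesis using as that by (auto intro!: image_cong)
  qed
  have 1: "L.regular_letter j" if j: "j < m" for j
  proof (rule L.regular_letterI)
    show "st i \<in> ?S" for i by (rule st)
    show "par j = 0 \<and> even_regular (R Quot Idl\<^bsub>R\<^esub> ((\<lambda>j. fraction ?S (b j) (st j)) ` {..<j}))
        (Idl\<^bsub>R\<^esub> ((\<lambda>j. fraction ?S (b j) (st j)) ` {..<j}) +>\<^bsub>R\<^esub> fraction ?S (b j) (st j)) \<or>
      par j = 1 \<and> odd_regular (R Quot Idl\<^bsub>R\<^esub> ((\<lambda>j. fraction ?S (b j) (st j)) ` {..<j}))
        (Idl\<^bsub>R\<^esub> ((\<lambda>j. fraction ?S (b j) (st j)) ` {..<j}) +>\<^bsub>R\<^esub> fraction ?S (b j) (st j))"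
      using par(2)[OF j] unfolding B_def z_def as[OF j] set_take[OF less_imp_le[OF j]] .
  qed
  have "set as = (\<lambda>j. fraction ?S (b j) (st j)) ` {..<m}" using set_take[of m] by (simp add: m_def)
  then have gen': "stalk_maximal_ideal gr p = extend (L.V m 1)"
    using gen L.Idl_letters[of m st] st by simp
  have "stalk_maximal_ideal gr p = extend p"
    unfolding stalk_maximal_ideal_def extend_def ..
  then have pV: "extend p = extend (L.V m 1)" using gen' by simp
  have 2: "L.P m 1 = p"
  proof (rule Set.set_eqI)
    fix q
    have "q \<in> L.P m 1 \<longleftrightarrow> fraction ?S q 1 \<in> extend p"
      unfolding pV using L.fraction_extend_V[OF one_S] by simp
    also have "\<dots> \<longleftrightarrow> (\<exists>u\<in>?S. u * q \<in> p)" by (rule fraction_extend_iff[OF tp one_S])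
    also have "\<dots> \<longleftrightarrow> q \<in> p" using prime twist_idealD(3)[OF tp] one_S by blast
    finally show "q \<in> L.P m 1 \<longleftrightarrow> q \<in> p" .
  qed
  have 3: "\<exists>j<m. par j = 0" if "r \<ge> 1"
  proof (rule ccontr)
    assume no: "\<not> (\<exists>j<m. par j = 0)"
    have "x \<in> part R 1" if x: "x \<in> set as" for x
    proof -
      obtain j where j: "j < m" "x = as ! j" using x unfolding m_def in_set_conv_nth by auto
      then have "par j = 1" using no par(2)[OF j(1)] by auto
      then show ?thesis using par(1)[OF j(1)] j(2) by simp
    qed
    then have "filter (\<lambda>x. x \<in> part R 1) as = as" by (simp add: filter_id_conv)
    then show False using od len that by simp
  qed
  show thesis by (rule that[OF L.localized_letters_axioms 1 2 3])
qed

lemma generators_exist: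
  assumes "finitely_generated_superalgebra scale gr"
  obtains x xpar N where "generators scale gr x xpar N"
proof -
  obtain F where F: "finite F" "F \<subseteq> gr 0 \<union> gr 1" "\<And>B. subalgebra scale B \<Longrightarrow> F \<subseteq> B \<Longrightarrow> B = UNIV"
    using assms unfolding finitely_generated_superalgebra_def by blast
  obtain xs where xs: "set xs = F" using finite_list[OF F(1)] by blast
  define x where "x k = (if k < length xs then xs ! k else 0)" for k
  define xpar where "xpar k = (if x k \<in> gr 0 then 0 else 1 :: bit)" for k
  have "x k \<in> gr 0 \<union> gr 1" for k
    unfolding x_def using F(2) xs gr_zero nth_mem by fastforce
  then have "x k \<in> gr (xpar k)" for k unfolding xpar_def by auto
  then interpret letters scale gr x xpar by unfold_locales
  let ?N = "length xs"
  define B where "B = {a. \<exists>Y. pjet ?N a Y}"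
  have "subalgebra scale B"
    unfolding subalgebra_def
  proof (intro conjI ballI)
    show "subspace B" unfolding B_def
      by (rule subspaceI) (auto intro: pjet_zero pjet_add pjet_scale)
    show "1 \<in> B" unfolding B_def using pjet_const[of ?N 1] by auto
    show "a * c \<in> B" if "a \<in> B" "c \<in> B" for a c using that pjet_mult unfolding B_def by blast
  qed
  moreover have "F \<subseteq> B"
  proof
    fix f assume "f \<in> F"
    then obtain k where "k < ?N" "f = x k" unfolding xs[symmetric] in_set_conv_nth x_def by auto
    then show "f \<in> B" unfolding B_def using pjet_b by blast
  qed
  ultimately have "B = UNIV" by (rule F(3))
  then have "generators scale gr x xpar ?N" by unfold_locales (auto simp: B_def)
  then show thesis by (rule that)
qed

theorem smooth_point_derivations:
  assumes fg: "finitely_generated_superalgebra scale gr"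
    and p: "p \<in> Spec gr" and smooth: "smooth_point gr p r s"
    and residue: "\<And>a. \<exists>c. a - scale c 1 \<in> p"
  shows "\<Lambda> \<subseteq> p \<Longrightarrow> (\<And>i D f. D \<in> Der scale gr i \<Longrightarrow> f \<in> \<Lambda> \<Longrightarrow> D f \<in> \<Lambda>) \<Longrightarrow> f \<in> \<Lambda> \<Longrightarrow> \<exists>q\<in>p. f = q * f"
    and "r \<ge> 1 \<Longrightarrow> \<exists>D\<in>Der scale gr 0. \<exists>g\<in>gr 0. D g \<notin> p"
proof -
  obtain b par m where L: "localized_letters scale gr b par (gr 0 - p)"
    and reg: "\<And>j. j < m \<Longrightarrow> localized_letters.regular_letter gr b par (gr 0 - p) j"
    and P: "localized_letters.P gr b par (gr 0 - p) m 1 = p"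
    and even: "r \<ge> 1 \<Longrightarrow> \<exists>j<m. par j = 0"
    using smooth_point_coordinates[OF p smooth] by blast
  obtain x xpar N where G: "generators scale gr x xpar N" using generators_exist[OF fg] by blast
  interpret L: localized_letters scale gr b par "gr 0 - p" by (rule L)
  interpret G: generators scale gr x xpar N by (rule G)
  have tp: "twist_ideal p" using p superideal_twist_ideal unfolding Spec_def by blast
  have one_p: "1 \<notin> p" using p twist_idealD(3)[OF tp, of 1] unfolding Spec_def by auto
  interpret generated_point scale gr b par "gr 0 - p" m x xpar N
    by unfold_locales (use reg P residue one_p in auto)
  show "\<Lambda> \<subseteq> p \<Longrightarrow> (\<And>i D f. D \<in> Der scale gr i \<Longrightarrow> f \<in> \<Lambda> \<Longrightarrow> D f \<in> \<Lambda>) \<Longrightarrow> f \<in> \<Lambda> \<Longrightarrow> \<exists>q\<in>p. f = q * f"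
    using derivation_closed_in_point[of \<Lambda> f] unfolding P by blast
  show "\<exists>D\<in>Der scale gr 0. \<exists>g\<in>gr 0. D g \<notin> p" if r: "r \<ge> 1"
  proof -
    obtain j where j: "j < m" "par j = 0" using even[OF r] by blast
    obtain D where D: "D \<in> Der scale gr 0" "D (b j) - 1 \<in> p"
      using dual_derivation[OF j(1)] j unfolding P by auto
    have "D (b j) \<notin> p"
    proof
      assume "D (b j) \<in> p"
      then have "D (b j) - (D (b j) - 1) \<in> p" using D(2) twist_ideal_diff[OF tp] by blast
      then show False using one_p by simp
    qed
    then show ?thesis using D(1) L.b_gr[of j] j(2) by auto
  qed
qed

end

locale closed_superalgebra = char0_superalgebra scale gr
  for scale :: "'k::{alg_closed_field, field_char_0} \<Rightarrow> 'a::ring_1 \<Rightarrow> 'a" and gr :: "bit \<Rightarrow> 'a set"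
begin

lemma maximal_ideal_above:
  assumes I: "ideal (I :: 'a set) ring_of_type_algebra" "1 \<notin> I"
  obtains M where "ideal M ring_of_type_algebra" "I \<subseteq> M" "1 \<notin> M"
    "\<And>M'. ideal M' ring_of_type_algebra \<Longrightarrow> M \<subseteq> M' \<Longrightarrow> 1 \<notin> M' \<Longrightarrow> M' = M"
proof -
  let ?A = "{M. ideal M ring_of_type_algebra \<and> I \<subseteq> M \<and> (1 :: 'a) \<notin> M}"
  have "\<exists>M\<in>?A. \<forall>Z\<in>?A. M \<subseteq> Z \<longrightarrow> Z = M"
  proof (rule subset_Zorn_nonempty)
    show "?A \<noteq> {}" using I by blast
    fix \<C> assume ne: "\<C> \<noteq> {}" and chain: "subset.chain ?A \<C>"
    have C: "\<And>M. M \<in> \<C> \<Longrightarrow> M \<in> ?A" "\<And>M M'. M \<in> \<C> \<Longrightarrow> M' \<in> \<C> \<Longrightarrow> M \<subseteq> M' \<or> M' \<subseteq> M"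
      using chain unfolding subset.chain_def by auto
    have "ideal (\<Union>\<C>) ring_of_type_algebra"
      unfolding ideal_ring_of_type_algebra_iff
    proof (intro conjI ballI allI)
      show "0 \<in> \<Union>\<C>" using ne C(1) ideal_ring_of_type_algebra_iff by fastforce
      fix x assume "x \<in> \<Union>\<C>"
      then obtain M where M: "M \<in> \<C>" "x \<in> M" by blast
      then have iM: "ideal M ring_of_type_algebra" using C(1) by blast
      show "a * x \<in> \<Union>\<C>" "x * a \<in> \<Union>\<C>" for a
        using M iM unfolding ideal_ring_of_type_algebra_iff by blast+
      show "x + y \<in> \<Union>\<C>" if y: "y \<in> \<Union>\<C>" for y
      proof -
        obtain M' where M': "M' \<in> \<C>" "y \<in> M'" using y by blast
        then have iM': "ideal M' ring_of_type_algebra" using C(1) by blast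
        show ?thesis using C(2)[OF M(1) M'(1)]
        proof
          assume "M \<subseteq> M'"
          then have "x + y \<in> M'" using iM' M M' unfolding ideal_ring_of_type_algebra_iff by blast
          then show ?thesis using M' by blast
        next
          assume "M' \<subseteq> M"
          then have "x + y \<in> M" using iM M M' unfolding ideal_ring_of_type_algebra_iff by blast
          then show ?thesis using M by blast
        qed
      qed
    qed
    then show "\<Union>\<C> \<in> ?A" using ne C(1) by blast
  qed
  then obtain M where M: "M \<in> ?A" and max: "\<forall>Z\<in>?A. M \<subseteq> Z \<longrightarrow> Z = M" by (rule bexE)
  show thesis
  proof (rule that[of M])
    show "M' = M" if "ideal M' ring_of_type_algebra" "M \<subseteq> M'" "1 \<notin> M'" for M'
      using bspec[OF max, of M'] M that by fast
  qed (use M in auto)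
qed

text \<open>
  A maximal two-sided ideal contains every odd \<open>x\<close>, because \<open>(c * x) * (c * x) = 0\<close> makes
  \<open>1 - c * x\<close> invertible; so it is prime with commutative quotient.  The kernel of a character that kills it is
  the required point.
\<close>

theorem closed_point_above:
  assumes fg: "finitely_generated_superalgebra scale gr"
    and I: "ideal (I :: 'a set) ring_of_type_algebra" "1 \<notin> I"
  obtains p where "closed_point gr p" "I \<subseteq> p" "gr 1 \<subseteq> p" "\<And>a. \<exists>c. a - scale c 1 \<in> p"
proof -
  obtain M where iM: "ideal M ring_of_type_algebra" and IM: "I \<subseteq> M" and oneM: "1 \<notin> M"
    and max: "\<And>M'. ideal M' ring_of_type_algebra \<Longrightarrow> M \<subseteq> M' \<Longrightarrow> 1 \<notin> M' \<Longrightarrow> M' = M"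
    using maximal_ideal_above[OF I] by metis
  have M: "0 \<in> M" "\<And>x y. x \<in> M \<Longrightarrow> y \<in> M \<Longrightarrow> x + y \<in> M" "\<And>x a. x \<in> M \<Longrightarrow> a * x \<in> M" "\<And>x a. x \<in> M \<Longrightarrow> x * a \<in> M"
    using iM unfolding ideal_ring_of_type_algebra_iff by auto
  have Mdiff: "x - y \<in> M" if "x \<in> M" "y \<in> M" for x y
    using M(2)[of x "- 1 * y"] M(3)[of y "- 1"] that by simp
  have extend_max: "a \<in> M \<or> (\<exists>m\<in>M. \<exists>c. 1 = m + c * a)"
    if comm: "\<And>c. a * c - twist i c * a \<in> M" for a i
  proof (rule ccontr)
    assume no: "\<not> (a \<in> M \<or> (\<exists>m\<in>M. \<exists>c. 1 = m + c * a))"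
    let ?M = "{m + c * a |m c. m \<in> M}"
    have MI: "m + c * a \<in> ?M" if "m \<in> M" for m c using that by blast
    have "ideal ?M ring_of_type_algebra"
      unfolding ideal_ring_of_type_algebra_iff
    proof (intro conjI ballI allI)
      show "0 \<in> ?M" using MI[OF M(1), of 0] by simp
      fix x assume "x \<in> ?M"
      then obtain m c where x: "x = m + c * a" "m \<in> M" by blast
      show "x + y \<in> ?M" if "y \<in> ?M" for y
      proof -
        obtain m' c' where y: "y = m' + c' * a" "m' \<in> M" using \<open>y \<in> ?M\<close> by blast
        have "x + y = (m + m') + (c + c') * a" unfolding x y by (simp add: algebra_simps)
        then show ?thesis using MI[OF M(2)[OF x(2) y(2)], of "c + c'"] by simp
      qed
      fix d
      have "d * x = d * m + (d * c) * a" unfolding x by (simp add: algebra_simps)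
      then show "d * x \<in> ?M" using MI[OF M(3)[OF x(2)], of d "d * c"] by simp
      have "x * d = (m * d + c * (a * d - twist i d * a)) + (c * twist i d) * a"
        unfolding x by (simp add: algebra_simps)
      then show "x * d \<in> ?M"
        using MI[OF M(2)[OF M(4)[OF x(2)] M(3)[OF comm]], of d c d "c * twist i d"] by simp
    qed
    moreover have "M \<subseteq> ?M" using MI[of _ 0] by auto
    moreover have "1 \<notin> ?M" using no by auto
    ultimately have "?M = M" by (rule max)
    moreover have "a \<in> ?M" using MI[OF M(1), of 1] by simp
    ultimately show False using no by blast
  qed
  have odd: "x \<in> M" if x: "x \<in> gr 1" for x
  proof (rule ccontr)
    assume "x \<notin> M"
    moreover have "x * c - twist 1 c * x \<in> M" for c using commute_left[OF x] M(1) by simp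
    ultimately obtain m c where m: "m \<in> M" "1 = m + c * x" using extend_max[of x 1] by blast
    have "(c * x) * (c * x) = 0" by (rule odd_square_left[OF x])
    moreover have "1 = m * (1 + c * x) + (c * x) * (c * x)"
    proof -
      have "1 = (1 - y) * (1 + y) + y * y" for y :: 'a by (simp add: algebra_simps)
      moreover have "m = 1 - c * x" using m(2) by (simp add: algebra_simps)
      ultimately show ?thesis by simp
    qed
    ultimately have "1 \<in> M" using M(4)[OF m(1), of "1 + c * x"] by simp
    then show False using oneM by blast
  qed
  have comm: "a * c - c * a \<in> M" for a c
  proof -
    obtain x y where a: "x \<in> gr 0" "y \<in> gr 1" "a = x + y" by (rule obtain_parts)
    have "a * c - c * a = y * c - c * y" using even_central[OF a(1), of c] unfolding a(3) by (simp add: algebra_simps)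
    then show ?thesis using Mdiff[OF M(4) M(3)] odd[OF a(2)] by simp
  qed
  have prime: "a \<in> M \<or> c \<in> M" if ac: "a * c \<in> M" for a c
  proof (rule ccontr)
    assume no: "\<not> (a \<in> M \<or> c \<in> M)"
    then obtain m d where m: "m \<in> M" "1 = m + d * a" using extend_max[of a 0] comm by auto
    have "c = m * c + d * (a * c)" using arg_cong[OF m(2), of "\<lambda>z. z * c"] by (simp add: algebra_simps)
    then have "c \<in> M" using M(2)[OF M(4)[OF m(1), of c] M(3)[OF ac, of d]] by simp
    then show False using no by blast
  qed
  interpret PQ: prime_quotient scale gr M
    by unfold_locales (use M oneM prime comm in auto)
  obtain \<chi> where \<chi>: "PQ.character_on UNIV \<chi>" using PQ.finitely_generated_character[OF fg] by blast
  have "PQ.subalg UNIV" unfolding PQ.subalg_def by simp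
  note X = PQ.characterD[OF \<chi> this]
  define p where "p = {a. \<chi> a = 0}"
  have Mp: "M \<subseteq> p" unfolding p_def using X(4) by blast
  have oddp: "gr 1 \<subseteq> p" using odd Mp by blast
  have res: "a - scale (\<chi> a) 1 \<in> p" for a unfolding p_def using X(3,8) by simp
  have ip: "ideal p ring_of_type_algebra"
    unfolding ideal_ring_of_type_algebra_iff p_def using X(1,2,6) by simp
  have gp: "graded_subset gr p"
    unfolding graded_subset_def
  proof
    fix w assume w: "w \<in> p"
    obtain x y where xy: "x \<in> gr 0" "y \<in> gr 1" "w = x + y" by (rule obtain_parts)
    have "y \<in> p" using oddp xy by blast
    moreover have "x \<in> p" using w \<open>y \<in> p\<close> X(1)[of x y] unfolding p_def xy by simp
    ultimately show "\<exists>x\<in>p \<inter> gr 0. \<exists>y\<in>p \<inter> gr 1. w = x + y" using xy by blast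
  qed
  have one_p: "1 \<notin> p" unfolding p_def using X(5) by simp
  have "p \<in> Spec gr"
    unfolding Spec_def superideal_def using ip gp one_p X(2) unfolding p_def by auto
  moreover have "{p} = {q \<in> Spec gr. p \<subseteq> q}"
  proof
    show "{p} \<subseteq> {q \<in> Spec gr. p \<subseteq> q}" using \<open>p \<in> Spec gr\<close> by blast
    show "{q \<in> Spec gr. p \<subseteq> q} \<subseteq> {p}"
    proof safe
      fix q a assume q: "q \<in> Spec gr" "p \<subseteq> q" and a: "a \<in> q"
      have tq: "twist_ideal q" and qU: "q \<noteq> UNIV" using q(1) superideal_twist_ideal unfolding Spec_def by auto
      have "a - (a - scale (\<chi> a) 1) \<in> q" using a res q(2) twist_ideal_diff[OF tq] by blast
      then have sc: "scale (\<chi> a) 1 \<in> q" by simp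
      show "a \<in> p"
      proof (rule ccontr)
        assume "a \<notin> p"
        then have "\<chi> a \<noteq> 0" unfolding p_def by simp
        then have "1 \<in> q" using twist_ideal_scale[OF tq sc, of "1 / \<chi> a"] by simp
        then have "q = UNIV" using twist_idealD(3)[OF tq, of 1] by auto
        then show False using qU by blast
      qed
    qed
  qed
  ultimately have "closed_point gr p"
    unfolding closed_point_def zariski_closed_def superideal_def using ip gp by blast
  then show thesis using that IM Mp oddp res by blast
qed

end

section \<open>The Lie superalgebra of derivations\<close>

context char0_superalgebra
begin

abbreviation L where "L \<equiv> Der scale gr"

definition commutator :: "bit \<Rightarrow> bit \<Rightarrow> ('a \<Rightarrow> 'a) \<Rightarrow> ('a \<Rightarrow> 'a) \<Rightarrow> 'a \<Rightarrow> 'a" where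
  "commutator i j D E = (\<lambda>a. D (E a) - koszul (i * j) * E (D a))"

lemma Der_minus: "D \<in> L i \<Longrightarrow> D (- x) = - D x"
  using Der_scale[of D i "- 1" x] by simp

lemma Der_koszul: "D \<in> L i \<Longrightarrow> D (koszul j * x) = koszul j * D x"
  by (simp add: koszul_def Der_minus)

lemma Der_leibniz_twist: "D \<in> L i \<Longrightarrow> D (a * x) = D a * x + twist i a * D x"
proof -
  assume D: "D \<in> L i"
  obtain u v where a: "u \<in> gr 0" "v \<in> gr 1" "a = u + v" by (rule obtain_parts)
  have "D (a * x) = (D u * x + u * D x) + (D v * x + koszul i * (v * D x))"
    using Der_leibniz[OF D a(1), of x] Der_leibniz[OF D a(2), of x]
    unfolding a(3) by (simp add: distrib_right Der_add[OF D] koszul_def)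
  then show ?thesis using a
    by (cases i) (auto simp: twist_parts koszul_def distrib_right Der_add[OF D] left_diff_distrib)
qed

lemma DerI:
  assumes "\<And>x y. D (x + y) = D x + D y" "\<And>c x. D (scale c x) = scale c (D x)"
    and "\<And>j x. x \<in> gr j \<Longrightarrow> D x \<in> gr (i + j)"
    and "\<And>a x. D (a * x) = D a * x + twist i a * D x"
  shows "D \<in> L i"
  unfolding Der_def mem_Collect_eq
proof (intro conjI allI ballI image_subsetI)
  show "Vector_Spaces.linear scale scale D"
    by (intro Vector_Spaces.linear.intro module_hom.intro) (unfold_locales, auto simp: assms(1,2))
  show "D x \<in> gr (i + j)" if "x \<in> gr j" for j x using assms(3) that by blast
  show "D (a * x) = D a * x + koszul (i * j) * (a * D x)" if "a \<in> gr j" for j a x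
    using assms(4)[of a x] twist_homogeneous[OF that, of i] by (simp only: mult.assoc)
qed

lemma Der_zero_mem: "0 \<in> L i"
  by (rule DerI) (auto simp: gr_zero)

lemma Der_add_mem:
  assumes "D \<in> L i" "E \<in> L i" shows "D + E \<in> L i"
proof (rule DerI)
  show "(D + E) x \<in> gr (i + j)" if "x \<in> gr j" for j x
    unfolding plus_fun_apply by (rule gr_add[OF Der_gr[OF assms(1) that] Der_gr[OF assms(2) that]])
qed (auto simp: assms[THEN Der_add] assms[THEN Der_scale] assms[THEN Der_leibniz_twist] scale_right_distrib
    algebra_simps)

lemma Der_scale_mem:
  assumes "D \<in> L i" shows "(\<lambda>a. scale c (D a)) \<in> L i"
proof (rule DerI)
  show "scale c (D x) \<in> gr (i + j)" if "x \<in> gr j" for j x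
    by (rule gr_scale[OF Der_gr[OF assms that]])
qed (auto simp: assms[THEN Der_add] assms[THEN Der_scale] assms[THEN Der_leibniz_twist] scale_right_distrib
    scale_mult_left scale_mult_right mult.commute)

lemma Der_module:
  assumes "c \<in> gr j" "D \<in> L i"
  shows "(\<lambda>a. c * D a) \<in> L (j + i)"
proof (rule DerI)
  fix a x
  have "c * twist i a = twist (j + i) a * c"
    using commute_left[OF assms(1), of "twist i a"] twist_twist[of 1 a] by (cases i; cases j) auto
  then show "c * D (a * x) = c * D a * x + twist (j + i) a * (c * D x)"
    by (simp add: Der_leibniz_twist[OF assms(2)] distrib_left mult.assoc[symmetric])
next
  fix k x assume "x \<in> gr k"
  then have "c * D x \<in> gr (j + (i + k))" using mult_gr[OF assms(1) Der_gr[OF assms(2)]] by blast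
  then show "c * D x \<in> gr (j + i + k)" by (simp only: add.assoc)
qed (auto simp: Der_add[OF assms(2)] Der_scale[OF assms(2)] distrib_left scale_mult_right)

lemma commutator_mem:
  assumes D: "D \<in> L i" and E: "E \<in> L j"
  shows "commutator i j D E \<in> L (i + j)"
proof (rule DerI)
  fix k x assume x: "x \<in> gr k"
  have 1: "D (E x) \<in> gr (i + (j + k))" by (rule Der_gr[OF D Der_gr[OF E x]])
  have 2: "E (D x) \<in> gr (j + (i + k))" by (rule Der_gr[OF E Der_gr[OF D x]])
  have "j + (i + k) = i + j + k" "i + (j + k) = i + j + k" by (simp_all only: ac_simps)
  then have "D (E x) \<in> gr (i + j + k)" "scale (koszul (i * j)) (E (D x)) \<in> gr (i + j + k)"
    using 1 2 gr_scale by metis+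
  then show "commutator i j D E x \<in> gr (i + j + k)"
    unfolding commutator_def koszul_scale by (rule gr_diff)
next
  fix a x
  have t: "twist i (E a) = koszul (i * j) * E (twist i a)" "twist j (D a) = koszul (i * j) * D (twist j a)" for a
  proof -
    have gen: "twist i' (F a) = koszul (i' * j') * F (twist i' a)" if F: "F \<in> L j'" for F i' j'
    proof -
      obtain u v where a: "u \<in> gr 0" "v \<in> gr 1" "a = u + v" by (rule obtain_parts)
      have "F u \<in> gr j'" "F v \<in> gr (j' + 1)" using Der_gr[OF F a(1)] Der_gr[OF F a(2)] by (simp_all only: add_0_right)
      then show ?thesis
        using a by (cases i'; cases j') (auto simp: twist_add Der_add[OF F] Der_diff[OF F] twist_parts
            twist_homogeneous koszul_def Der_minus[OF F])
    qed
    show "twist i (E a) = koszul (i * j) * E (twist i a)" by (rule gen[OF E])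
    show "twist j (D a) = koszul (i * j) * D (twist j a)"
      using gen[OF D, of j] by (simp only: mult.commute)
  qed
  have tt: "twist i (twist j a) = twist (i + j) a" "twist j (twist i a) = twist (i + j) a"
    using twist_twist[of 1 a] by (cases i; cases j; simp)+
  show "commutator i j D E (a * x) = commutator i j D E a * x + twist (i + j) a * commutator i j D E x"
    unfolding commutator_def
    by (simp only: Der_leibniz_twist[OF D] Der_leibniz_twist[OF E] Der_add[OF D] Der_add[OF E] t tt)
      (simp add: distrib_left distrib_right left_diff_distrib right_diff_distrib koszul_def algebra_simps)
qed (auto simp: commutator_def Der_add[OF D] Der_add[OF E] Der_scale[OF D] Der_scale[OF E] distrib_left
      scale_right_diff_distrib scale_mult_right)

lemma Der_direct: "L 0 \<inter> L 1 = {0}"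
proof -
  have "D = 0" if D: "D \<in> L 0" "D \<in> L 1" for D
  proof
    fix a
    obtain u v where a: "u \<in> gr 0" "v \<in> gr 1" "a = u + v" by (rule obtain_parts)
    have "D u \<in> gr 0 \<inter> gr 1" "D v \<in> gr 0 \<inter> gr 1"
      using Der_gr[OF D(1) a(1)] Der_gr[OF D(2) a(1)] Der_gr[OF D(1) a(2)] Der_gr[OF D(2) a(2)] by auto
    then show "D a = 0 a" using gr_direct unfolding a(3) by (simp add: Der_add[OF D(1)])
  qed
  then show ?thesis using Der_zero_mem by auto
qed

lemma Der_component:
  assumes "D \<in> L 0" "E \<in> L 1"
  shows "component L 0 (D + E) = D" "component L 1 (D + E) = E"
proof -
  have diff: "x - y \<in> L i" if "x \<in> L i" "y \<in> L i" for x y i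
  proof -
    have "x + (\<lambda>a. scale (- 1) (y a)) \<in> L i" by (rule Der_add_mem[OF that(1) Der_scale_mem[OF that(2)]])
    moreover have "x + (\<lambda>a. scale (- 1) (y a)) = x - y" by auto
    ultimately show ?thesis by simp
  qed
  show "component L 0 (D + E) = D"
    by (rule component_eqI[OF diff Der_direct assms(1)]) (use assms in simp_all)
  have "component L 1 (E + D) = E"
    by (rule component_eqI[OF diff Der_direct assms(2)]) (use assms in simp_all)
  then show "component L 1 (D + E) = E" by (simp only: add.commute)
qed

lemma Der_bracket_parts:
  assumes "D \<in> L 0" "D' \<in> L 1" "E \<in> L 0" "E' \<in> L 1"
  shows "Der_bracket scale gr (D + D') (E + E') =
    commutator 0 0 D E + commutator 0 1 D E' + (commutator 1 0 D' E + commutator 1 1 D' E')"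
  proof -
  have "x \<in> {0, 1}" for x :: bit by (cases x) auto
  then have U: "(UNIV :: bit set) = {0, 1}" by blast
  show ?thesis
    unfolding Der_bracket_def Let_def U by (simp add: Der_component assms commutator_def)
qed

lemma commutator_zero: "D \<in> L i \<Longrightarrow> commutator i j D 0 = 0" "E \<in> L j \<Longrightarrow> commutator i j 0 E = 0"
  by (auto simp: commutator_def Der_zero fun_eq_iff)

lemma Der_bracket_homogeneous:
  assumes "D \<in> L i" "E \<in> L j"
  shows "Der_bracket scale gr D E = commutator i j D E"
proof -
  note z = Der_zero_mem[of 0] Der_zero_mem[of 1]
  consider "i = 0" "j = 0" | "i = 0" "j = 1" | "i = 1" "j = 0" | "i = 1" "j = 1" by (cases i; cases j) auto
  then show ?thesis
  proof cases
    case 1 then show ?thesis using Der_bracket_parts[of D 0 E 0] assms z by (simp add: commutator_zero)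
  next
    case 2 then show ?thesis using Der_bracket_parts[of D 0 0 E] assms z by (simp add: commutator_zero)
  next
    case 3 then show ?thesis using Der_bracket_parts[of 0 D E 0] assms z by (simp add: commutator_zero)
  next
    case 4 then show ?thesis using Der_bracket_parts[of 0 D 0 E] assms z by (simp add: commutator_zero)
  qed
qed

lemma graded_sum_DerE:
  assumes "x \<in> graded_sum L"
  obtains D E where "D \<in> L 0" "E \<in> L 1" "x = D + E"
  using assms unfolding graded_sum_def by blast

lemma graded_sum_DerI: "D \<in> L i \<Longrightarrow> D \<in> graded_sum L"
proof -
  assume D: "D \<in> L i"
  have e: "D = D + 0" "D = 0 + D" by simp_all
  show ?thesis
  proof (cases "i = 0")
    case True then show ?thesis unfolding graded_sum_def using D Der_zero_mem e(1) by blast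
  next
    case False
    then have "i = 1" by (cases i) auto
    then show ?thesis unfolding graded_sum_def using D Der_zero_mem e(2) by blast
  qed
qed

sublocale Der_space: vector_space "pointwise_scale scale"
  by unfold_locales (auto simp: pointwise_scale_def fun_eq_iff scale_right_distrib scale_left_distrib)

theorem lie_superalgebra_Der: "lie_superalgebra (pointwise_scale scale) L (Der_bracket scale gr)"
proof
  show "Der_space.subspace (L i)" for i
    by (rule Der_space.subspaceI)
      (auto simp: pointwise_scale_def intro: Der_zero_mem Der_add_mem Der_scale_mem)
  show "L 0 \<inter> L 1 = {0}" by (rule Der_direct)
  show "Der_bracket scale gr (x + y) z = Der_bracket scale gr x z + Der_bracket scale gr y z"
    if xyz: "x \<in> graded_sum L" "y \<in> graded_sum L" "z \<in> graded_sum L" for x y z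
  proof -
    obtain x0 x1 where x: "x0 \<in> L 0" "x1 \<in> L 1" "x = x0 + x1" using xyz(1) by (rule graded_sum_DerE)
    obtain y0 y1 where y: "y0 \<in> L 0" "y1 \<in> L 1" "y = y0 + y1" using xyz(2) by (rule graded_sum_DerE)
    obtain z0 z1 where z: "z0 \<in> L 0" "z1 \<in> L 1" "z = z0 + z1" using xyz(3) by (rule graded_sum_DerE)
    have e: "x + y = (x0 + y0) + (x1 + y1)" using x y by (simp add: ac_simps)
    show ?thesis
      unfolding e z(3) Der_bracket_parts[OF Der_add_mem[OF x(1) y(1)] Der_add_mem[OF x(2) y(2)] z(1,2)]
      unfolding x(3) y(3) Der_bracket_parts[OF x(1,2) z(1,2)] Der_bracket_parts[OF y(1,2) z(1,2)]
      by (auto simp: fun_eq_iff commutator_def Der_add[OF z(1)] Der_add[OF z(2)] algebra_simps)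
  qed
  show "Der_bracket scale gr x (y + z) = Der_bracket scale gr x y + Der_bracket scale gr x z"
    if xyz: "x \<in> graded_sum L" "y \<in> graded_sum L" "z \<in> graded_sum L" for x y z
  proof -
    obtain x0 x1 where x: "x0 \<in> L 0" "x1 \<in> L 1" "x = x0 + x1" using xyz(1) by (rule graded_sum_DerE)
    obtain y0 y1 where y: "y0 \<in> L 0" "y1 \<in> L 1" "y = y0 + y1" using xyz(2) by (rule graded_sum_DerE)
    obtain z0 z1 where z: "z0 \<in> L 0" "z1 \<in> L 1" "z = z0 + z1" using xyz(3) by (rule graded_sum_DerE)
    have e: "y + z = (y0 + z0) + (y1 + z1)" using y z by (simp add: ac_simps)
    show ?thesis
      unfolding e x(3) Der_bracket_parts[OF x(1,2) Der_add_mem[OF y(1) z(1)] Der_add_mem[OF y(2) z(2)]]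
      unfolding y(3) z(3) Der_bracket_parts[OF x(1,2) y(1,2)] Der_bracket_parts[OF x(1,2) z(1,2)]
      by (auto simp: fun_eq_iff commutator_def Der_add[OF x(1)] Der_add[OF x(2)] algebra_simps)
  qed
  show "Der_bracket scale gr (pointwise_scale scale c x) y = pointwise_scale scale c (Der_bracket scale gr x y)"
    "Der_bracket scale gr y (pointwise_scale scale c x) = pointwise_scale scale c (Der_bracket scale gr y x)"
    if xy: "x \<in> graded_sum L" "y \<in> graded_sum L" for x y c
  proof -
    obtain x0 x1 where x: "x0 \<in> L 0" "x1 \<in> L 1" "x = x0 + x1" using xy(1) by (rule graded_sum_DerE)
    obtain y0 y1 where y: "y0 \<in> L 0" "y1 \<in> L 1" "y = y0 + y1" using xy(2) by (rule graded_sum_DerE)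
    have e: "pointwise_scale scale c x = (\<lambda>a. scale c (x0 a)) + (\<lambda>a. scale c (x1 a))"
      unfolding x by (auto simp: pointwise_scale_def scale_right_distrib)
    note s = Der_scale_mem[OF x(1), of c] Der_scale_mem[OF x(2), of c]
    show "Der_bracket scale gr (pointwise_scale scale c x) y = pointwise_scale scale c (Der_bracket scale gr x y)"
      unfolding e Der_bracket_parts[OF s y(1,2)] y(3)
      unfolding x(3) Der_bracket_parts[OF x(1,2) y(1,2)]
      by (auto simp: fun_eq_iff pointwise_scale_def commutator_def Der_scale[OF y(1)] Der_scale[OF y(2)]
          scale_right_distrib scale_right_diff_distrib scale_mult_right)
    show "Der_bracket scale gr y (pointwise_scale scale c x) = pointwise_scale scale c (Der_bracket scale gr y x)"
      unfolding e Der_bracket_parts[OF y(1,2) s] y(3)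
      unfolding x(3) Der_bracket_parts[OF y(1,2) x(1,2)]
      by (auto simp: fun_eq_iff pointwise_scale_def commutator_def Der_scale[OF y(1)] Der_scale[OF y(2)]
          scale_right_distrib scale_right_diff_distrib scale_mult_right)
  qed
  fix x y z i j k
  assume x: "x \<in> L i" and y: "y \<in> L j"
  show "Der_bracket scale gr x y \<in> L (i + j)"
    unfolding Der_bracket_homogeneous[OF x y] by (rule commutator_mem[OF x y])
  show "Der_bracket scale gr x y = - pointwise_scale scale (koszul (i * j)) (Der_bracket scale gr y x)"
    unfolding Der_bracket_homogeneous[OF x y] Der_bracket_homogeneous[OF y x]
    by (auto simp: fun_eq_iff pointwise_scale_def commutator_def koszul_def mult.commute[of j i])
  assume z: "z \<in> L k"
  note br = Der_bracket_homogeneous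
  show "Der_bracket scale gr x (Der_bracket scale gr y z) =
    Der_bracket scale gr (Der_bracket scale gr x y) z +
    pointwise_scale scale (koszul (i * j)) (Der_bracket scale gr y (Der_bracket scale gr x z))"
    unfolding br[OF x y] br[OF y z] br[OF x z] br[OF x commutator_mem[OF y z]]
      br[OF commutator_mem[OF x y] z] br[OF y commutator_mem[OF x z]]
    unfolding fun_eq_iff
  proof
    fix a
    show "commutator i (j + k) x (commutator j k y z) a = (commutator (i + j) k (commutator i j x y) z +
      pointwise_scale scale (koszul (i * j)) (commutator j (i + k) y (commutator i k x z))) a"
      unfolding commutator_def pointwise_scale_def plus_fun_apply
      by (cases i; cases j; cases k)
        (simp_all add: koszul_def Der_diff[OF x] Der_diff[OF y] Der_diff[OF z] Der_minus[OF x] Der_minus[OF y]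
          Der_minus[OF z] Der_add[OF x] Der_add[OF y] Der_add[OF z] algebra_simps)
  qed
qed

end

section \<open>Simplicity\<close>

context char0_superalgebra
begin

lemma prime_superidealD:
  assumes "p \<in> Spec gr"
  shows "twist_ideal p" and "1 \<notin> p" and "a * c \<in> p \<Longrightarrow> a \<in> p \<or> c \<in> p" and "ideal p ring_of_type_algebra"
proof -
  show tp: "twist_ideal p" using assms superideal_twist_ideal unfolding Spec_def by blast
  show "1 \<notin> p" using assms twist_idealD(3)[OF tp, of 1] unfolding Spec_def by auto
  show "a * c \<in> p \<Longrightarrow> a \<in> p \<or> c \<in> p" "ideal p ring_of_type_algebra"
    using assms unfolding Spec_def superideal_def by auto
qed

lemma odd_ideal_subset:
  assumes "ideal p (ring_of_type_algebra :: 'a ring)" "gr 1 \<subseteq> p"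
  shows "odd_ideal gr \<subseteq> p"
proof -
  interpret R: ring "ring_of_type_algebra :: 'a ring" by (rule ring_of_type_algebra_ring_1)
  show ?thesis unfolding odd_ideal_def by (rule R.genideal_minimal[OF assms])
qed

lemma not_zero_divisor:
  assumes "integral_superdomain gr" "odd_ideal gr \<subseteq> p" "a \<notin> p" "c \<noteq> 0"
  shows "a * c \<noteq> 0" "c * a \<noteq> 0"
  using assms unfolding integral_superdomain_def zero_divisor_def by blast+

inductive_set value_span :: "('a \<Rightarrow> 'a) set \<Rightarrow> 'a set" for W where
  of_value: "D \<in> W \<Longrightarrow> D f \<in> value_span W"
| of_sum: "x \<in> value_span W \<Longrightarrow> y \<in> value_span W \<Longrightarrow> x + y \<in> value_span W"

text \<open>
  \<open>D (E f)\<close> is \<open>[D, E] f\<close> plus a value of \<open>E\<close>.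
\<close>

lemma value_span_closed:
  assumes W: "\<And>i j D w. D \<in> L i \<Longrightarrow> w \<in> W \<Longrightarrow> w \<in> L j \<Longrightarrow> commutator i j D w \<in> W"
    and D: "D \<in> L i" and "f \<in> value_span (W \<inter> (L 0 \<union> L 1))"
  shows "D f \<in> value_span (W \<inter> (L 0 \<union> L 1))"
  using assms(3)
proof (induction rule: value_span.induct)
  case (of_value E f)
  then obtain j where j: "E \<in> W" "E \<in> L j" by blast
  have "commutator i j D E \<in> W" "commutator i j D E \<in> L (i + j)"
    by (rule W[OF D j], rule commutator_mem[OF D j(2)])
  moreover have "L (i + j) \<subseteq> L 0 \<union> L 1" by (cases "i + j") auto
  ultimately have "commutator i j D E \<in> W \<inter> (L 0 \<union> L 1)" by (meson IntI subsetD)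
  then have "commutator i j D E f \<in> value_span (W \<inter> (L 0 \<union> L 1))" by (rule value_span.of_value)
  moreover have "E (koszul (i * j) * D f) \<in> value_span (W \<inter> (L 0 \<union> L 1))" by (rule value_span.of_value) (rule of_value)
  ultimately have "commutator i j D E f + E (koszul (i * j) * D f) \<in> value_span (W \<inter> (L 0 \<union> L 1))"
    by (rule value_span.of_sum)
  then show ?case by (simp add: commutator_def Der_koszul[OF j(2)])
next
  case (of_sum x y) then show ?case by (simp add: Der_add[OF D] value_span.of_sum)
qed

end

locale derivation_ideal = char0_superalgebra scale gr
  for scale :: "'k::field_char_0 \<Rightarrow> 'a::ring_1 \<Rightarrow> 'a" and gr :: "bit \<Rightarrow> 'a set" +
  fixes W :: "('a \<Rightarrow> 'a) set"
  assumes ideal_W: "lie_superideal (pointwise_scale scale) L (Der_bracket scale gr) W"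
begin

lemma W_subspace: "Der_space.subspace W" using ideal_W unfolding lie_superideal_def by blast

lemmas W_add = Der_space.subspace_add[OF W_subspace]
  and W_diff = Der_space.subspace_diff[OF W_subspace]
  and W_zero = Der_space.subspace_0[OF W_subspace]

lemma W_scale: "D \<in> W \<Longrightarrow> (\<lambda>b. scale c (D b)) \<in> W"
  using Der_space.subspace_scale[OF W_subspace, of D c] by (simp add: pointwise_scale_def)

lemma W_koszul: "D \<in> W \<Longrightarrow> (\<lambda>b. koszul i * D b) \<in> W"
  using W_scale[of D "koszul i"] by (simp add: koszul_scale)

lemma W_commutator: "D \<in> L i \<Longrightarrow> w \<in> W \<Longrightarrow> w \<in> L j \<Longrightarrow> commutator i j D w \<in> W"
  using ideal_W graded_sum_DerI[of D i] Der_bracket_homogeneous[of D i w j] unfolding lie_superideal_def by metis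

lemma W_commutator': 
  assumes "w \<in> W" "w \<in> L j" "D \<in> L i"
  shows "commutator j i w D \<in> W"
proof -
  have "(\<lambda>b. scale (- 1) (koszul (i * j) * commutator i j D w b)) \<in> W"
    by (rule W_scale[OF W_koszul[OF W_commutator[OF assms(3,1,2)]]])
  moreover have "scale (- 1) (koszul (i * j) * commutator i j D w b) = commutator j i w D b" for b
    by (simp add: commutator_def koszul_def mult.commute[of j i])
  ultimately show ?thesis by simp
qed

lemma W_parts:
  assumes "w \<in> W" obtains x y where "x \<in> W" "x \<in> L 0" "y \<in> W" "y \<in> L 1" "w = x + y"
  using assms ideal_W unfolding lie_superideal_def graded_subset_def by blast

definition coeff_part :: "bit \<Rightarrow> 'a set" where
  "coeff_part i = {a \<in> gr i. \<forall>j. \<forall>E \<in> L j. (\<lambda>b. a * E b) \<in> W}"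

lemma coeff_part_add: "x \<in> coeff_part i \<Longrightarrow> y \<in> coeff_part i \<Longrightarrow> x + y \<in> coeff_part i"
  unfolding coeff_part_def
proof (safe intro!: gr_add)
  fix j E assume *: "\<forall>j. \<forall>E\<in>L j. (\<lambda>b. x * E b) \<in> W" "\<forall>j. \<forall>E\<in>L j. (\<lambda>b. y * E b) \<in> W" "E \<in> L j"
  have "(\<lambda>b. x * E b) + (\<lambda>b. y * E b) \<in> W" by (rule W_add) (use * in blast)+
  then show "(\<lambda>b. (x + y) * E b) \<in> W" by (simp add: plus_fun_def distrib_right)
qed

lemma coeff_part_zero: "0 \<in> coeff_part i"
  unfolding coeff_part_def using gr_zero W_zero by (auto simp: zero_fun_def)

lemma coeff_part_right:
  assumes "x \<in> coeff_part i" "c \<in> gr k" shows "x * c \<in> coeff_part (i + k)"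
  unfolding coeff_part_def
proof (intro CollectI conjI allI ballI)
  show "x * c \<in> gr (i + k)" using assms mult_gr unfolding coeff_part_def by blast
  have x: "(\<lambda>b. x * E b) \<in> W" if "E \<in> L j" for E j using assms(1) that unfolding coeff_part_def by blast
  fix j E assume "E \<in> L j"
  then have "(\<lambda>b. x * (c * E b)) \<in> W" by (rule x[OF Der_module[OF assms(2)]])
  then show "(\<lambda>b. x * c * E b) \<in> W" by (simp add: mult.assoc)
qed

lemma coeff_part_koszul: "x \<in> coeff_part i \<Longrightarrow> koszul k * x \<in> coeff_part i"
  unfolding coeff_part_def using W_koszul gr_scale[of x i "koszul k"] by (auto simp: koszul_scale mult.assoc)

lemma coeff_part_left:
  assumes "x \<in> coeff_part i" "c \<in> gr k" shows "c * x \<in> coeff_part (i + k)"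
proof -
  have "c * x = koszul (k * i) * (x * c)" using assms supercommutative unfolding coeff_part_def by blast
  then show ?thesis using coeff_part_koszul[OF coeff_part_right[OF assms]] by simp
qed

text \<open>
  \<open>D(x) E\<close> differs from \<open>[D, x E]\<close> by \<open>x [D, E]\<close> up to sign, and both lie in \<open>W\<close>.
\<close>

lemma coeff_part_derivation:
  assumes "x \<in> coeff_part i" "D \<in> L k" shows "D x \<in> coeff_part (k + i)"
  unfolding coeff_part_def
proof (intro CollectI conjI allI ballI)
  have x: "x \<in> gr i" "\<And>j E. E \<in> L j \<Longrightarrow> (\<lambda>b. x * E b) \<in> W" using assms(1) unfolding coeff_part_def by auto
  show "D x \<in> gr (k + i)" by (rule Der_gr[OF assms(2) x(1)])
  fix j E assume E: "E \<in> L j"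
  have "commutator k (i + j) D (\<lambda>b. x * E b) \<in> W"
    by (rule W_commutator[OF assms(2) x(2)[OF E] Der_module[OF x(1) E]])
  moreover have "(\<lambda>b. koszul (k * i) * (x * commutator k j D E b)) \<in> W"
    by (rule W_koszul[OF x(2)[OF commutator_mem[OF assms(2) E]]])
  ultimately have "commutator k (i + j) D (\<lambda>b. x * E b) - (\<lambda>b. koszul (k * i) * (x * commutator k j D E b)) \<in> W"
    by (rule W_diff)
  moreover have "commutator k (i + j) D (\<lambda>b. x * E b) - (\<lambda>b. koszul (k * i) * (x * commutator k j D E b)) =
      (\<lambda>b. D x * E b)"
  proof
    fix b
    show "(commutator k (i + j) D (\<lambda>b. x * E b) - (\<lambda>b. koszul (k * i) * (x * commutator k j D E b))) b = D x * E b"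
      unfolding fun_diff_def commutator_def Der_leibniz[OF assms(2) x(1)]
      by (cases k; cases i; cases j) (simp_all add: koszul_def algebra_simps)
  qed
  ultimately show "(\<lambda>b. D x * E b) \<in> W" by simp
qed

definition coeff_ideal :: "'a set" where
  "coeff_ideal = {x + y |x y. x \<in> coeff_part 0 \<and> y \<in> coeff_part 1}"

lemma coeff_idealI: "x \<in> coeff_part 0 \<Longrightarrow> y \<in> coeff_part 1 \<Longrightarrow> x + y \<in> coeff_ideal"
  unfolding coeff_ideal_def by blast

lemma coeff_part_subset: "x \<in> coeff_part i \<Longrightarrow> x \<in> coeff_ideal"
  using coeff_idealI[of x 0] coeff_idealI[of 0 x] coeff_part_zero by (cases i) auto

lemma ideal_coeff_ideal: "ideal coeff_ideal ring_of_type_algebra"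
  unfolding ideal_ring_of_type_algebra_iff
proof (intro conjI ballI allI)
  show "0 \<in> coeff_ideal" using coeff_part_subset coeff_part_zero by blast
  have add: "x + y \<in> coeff_ideal" if xy: "x \<in> coeff_ideal" "y \<in> coeff_ideal" for x y
  proof -
    obtain x0 x1 where x: "x = x0 + x1" "x0 \<in> coeff_part 0" "x1 \<in> coeff_part 1" using xy unfolding coeff_ideal_def by blast
    obtain y0 y1 where y: "y = y0 + y1" "y0 \<in> coeff_part 0" "y1 \<in> coeff_part 1" using xy unfolding coeff_ideal_def by blast
    have "x + y = (x0 + y0) + (x1 + y1)" unfolding x y by (simp add: ac_simps)
    then show ?thesis using coeff_idealI[OF coeff_part_add[OF x(2) y(2)] coeff_part_add[OF x(3) y(3)]] by simp
  qed
  then show "x \<in> coeff_ideal \<Longrightarrow> y \<in> coeff_ideal \<Longrightarrow> x + y \<in> coeff_ideal" for x y by blast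
  fix x a assume "x \<in> coeff_ideal"
  then obtain x0 x1 where x: "x = x0 + x1" "x0 \<in> coeff_part 0" "x1 \<in> coeff_part 1" unfolding coeff_ideal_def by blast
  obtain u v where a: "u \<in> gr 0" "v \<in> gr 1" "a = u + v" by (rule obtain_parts)
  have "a * x = (u * x0 + u * x1) + (v * x0 + v * x1)" unfolding x a by (simp add: algebra_simps)
  also have "\<dots> \<in> coeff_ideal"
    by (intro add coeff_part_subset[OF coeff_part_left[OF x(2) a(1)]] coeff_part_subset[OF coeff_part_left[OF x(3) a(1)]]
        coeff_part_subset[OF coeff_part_left[OF x(2) a(2)]] coeff_part_subset[OF coeff_part_left[OF x(3) a(2)]])
  finally show "a * x \<in> coeff_ideal" .
  have "x * a = (x0 * u + x1 * u) + (x0 * v + x1 * v)" unfolding x a by (simp add: algebra_simps)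
  also have "\<dots> \<in> coeff_ideal"
    by (intro add coeff_part_subset[OF coeff_part_right[OF x(2) a(1)]] coeff_part_subset[OF coeff_part_right[OF x(3) a(1)]]
        coeff_part_subset[OF coeff_part_right[OF x(2) a(2)]] coeff_part_subset[OF coeff_part_right[OF x(3) a(2)]])
  finally show "x * a \<in> coeff_ideal" .
qed

lemma coeff_ideal_derivation:
  assumes "D \<in> L k" "x \<in> coeff_ideal" shows "D x \<in> coeff_ideal"
proof -
  obtain x0 x1 where x: "x = x0 + x1" "x0 \<in> coeff_part 0" "x1 \<in> coeff_part 1"
    using assms(2) unfolding coeff_ideal_def by blast
  have "D x0 \<in> coeff_ideal" "D x1 \<in> coeff_ideal"
    using coeff_part_subset coeff_part_derivation[OF x(2) assms(1)] coeff_part_derivation[OF x(3) assms(1)] by blast+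
  then show ?thesis
    using ideal_coeff_ideal unfolding x(1) Der_add[OF assms(1)] ideal_ring_of_type_algebra_iff by blast
qed

lemma one_in_coeff_ideal: "1 \<in> coeff_ideal \<Longrightarrow> W = graded_sum L"
proof
  assume "1 \<in> coeff_ideal"
  then obtain x y where xy: "1 = x + y" "x \<in> coeff_part 0" "y \<in> coeff_part 1" unfolding coeff_ideal_def by blast
  have "y = 1 - x" using xy(1) by (simp add: algebra_simps)
  then have "y \<in> gr 0" using one_gr xy(2) gr_diff unfolding coeff_part_def by simp
  then have "y = 0" using gr_direct xy(3) unfolding coeff_part_def by blast
  then have one: "1 \<in> coeff_part 0" using xy by simp
  show "graded_sum L \<subseteq> W"
  proof
    fix D assume "D \<in> graded_sum L"
    then obtain D0 D1 where D: "D0 \<in> L 0" "D1 \<in> L 1" "D = D0 + D1" by (rule graded_sum_DerE)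
    have "(\<lambda>b. 1 * D0 b) \<in> W" "(\<lambda>b. 1 * D1 b) \<in> W" using one D unfolding coeff_part_def by blast+
    then show "D \<in> W" using W_add D by simp
  qed
  show "W \<subseteq> graded_sum L" using ideal_W unfolding lie_superideal_def by blast
qed

text \<open>
  Let \<open>\<phi> = D h\<close> and \<open>c = D \<phi>\<close>.  The bracket of \<open>D\<close> with \<open>h D\<close> is \<open>\<phi> D\<close>, so \<open>\<phi> D\<close> is in \<open>W\<close>, and
  \<open>[D, \<phi> g D] - [\<phi> D, g D] = 2 c g D\<close> shows that \<open>W\<close> contains all multiples of \<open>Y = c D\<close>.  Then
  \<open>[Y, f E] - [f Y, E] - E(f) Y = Y(f) E\<close> is in \<open>W\<close> for every \<open>E\<close>.  Only even elements
  stand in front, so no signs occur.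
\<close>

lemma even_element_coefficient:
  assumes D: "D \<in> W" "D \<in> L 0" and h: "h \<in> gr 0" and f: "f \<in> gr 0"
  shows "D (D h) * D f \<in> coeff_part 0"
proof -
  define \<phi> where "\<phi> = D h"
  define c where "c = D \<phi>"
  have \<phi>: "\<phi> \<in> gr 0" and c: "c \<in> gr 0"
    using Der_gr[OF D(2) h] Der_gr[OF D(2), of \<phi> 0] unfolding \<phi>_def c_def by simp_all
  note cent = even_central[OF \<phi>] even_central[OF c] even_central[OF h] even_central[OF f]
  note leib = Der_even_scalar[OF D(2)]
  have hD: "(\<lambda>b. h * D b) \<in> L 0" using Der_module[OF h D(2)] by simp
  have "commutator 0 0 D (\<lambda>b. h * D b) \<in> W" by (rule W_commutator'[OF D hD])
  moreover have "commutator 0 0 D (\<lambda>b. h * D b) = (\<lambda>b. \<phi> * D b)"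
    unfolding commutator_def \<phi>_def by (simp add: leib[OF h] koszul_def)
  ultimately have \<phi>W: "(\<lambda>b. \<phi> * D b) \<in> W" by simp
  have \<phi>L: "(\<lambda>b. \<phi> * D b) \<in> L 0" using Der_module[OF \<phi> D(2)] by simp
  have gX: "(\<lambda>b. c * (g * D b)) \<in> W" if g: "g \<in> gr j" for g j
  proof -
    have gD: "(\<lambda>b. g * D b) \<in> L j" using Der_module[OF g D(2)] by (simp only: add_0_right)
    have \<phi>gD: "(\<lambda>b. \<phi> * (g * D b)) \<in> L j" using Der_module[OF \<phi> gD] by (simp only: add_0_left)
    have "commutator 0 j D (\<lambda>b. \<phi> * (g * D b)) - commutator 0 j (\<lambda>b. \<phi> * D b) (\<lambda>b. g * D b) \<in> W"
      by (rule W_diff[OF W_commutator'[OF D \<phi>gD] W_commutator'[OF \<phi>W \<phi>L gD]])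
    moreover have "commutator 0 j D (\<lambda>b. \<phi> * (g * D b)) - commutator 0 j (\<lambda>b. \<phi> * D b) (\<lambda>b. g * D b) =
       (\<lambda>b. c * (g * D b) + c * (g * D b))"
    proof
      fix b
      have "g * (\<phi> * D (D b)) = \<phi> * (g * D (D b))" using cent(1)[of g] by (simp add: mult.assoc[symmetric])
      moreover have "g * (c * D b) = c * (g * D b)" using cent(2)[of g] by (simp add: mult.assoc[symmetric])
      ultimately show "(commutator 0 j D (\<lambda>b. \<phi> * (g * D b)) - commutator 0 j (\<lambda>b. \<phi> * D b) (\<lambda>b. g * D b)) b =
        c * (g * D b) + c * (g * D b)"
        unfolding fun_diff_def commutator_def c_def
        by (simp add: leib[OF \<phi>] Der_leibniz[OF D(2) g] koszul_def distrib_left)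
    qed
    ultimately have "(\<lambda>b. scale (1/2) (c * (g * D b) + c * (g * D b))) \<in> W" using W_scale by simp
    moreover have "scale (1/2) (z + z) = z" for z :: 'a
    proof -
      have "scale (1/2) (z + z) = scale (1/2 + 1/2) z" by (simp only: scale_left_distrib scale_right_distrib)
      then show ?thesis by simp
    qed
    ultimately show ?thesis by simp
  qed
  define Y where "Y = (\<lambda>b. c * D b)"
  have YL: "Y \<in> L 0" using Der_module[OF c D(2)] unfolding Y_def by simp
  have YW: "Y \<in> W" using gX[OF one_gr] unfolding Y_def by simp
  show ?thesis
    unfolding coeff_part_def \<phi>_def[symmetric] c_def[symmetric]
  proof (intro CollectI conjI allI ballI)
    show "c * D f \<in> gr 0" using mult_gr[OF c Der_gr[OF D(2) f]] by simp
    fix j E assume E: "E \<in> L j"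
    have fE: "(\<lambda>b. f * E b) \<in> L j" using Der_module[OF f E] by (simp only: add_0_left)
    have fY: "(\<lambda>b. f * Y b) \<in> L 0" using Der_module[OF f YL] by simp
    have fYW: "(\<lambda>b. f * Y b) \<in> W"
      using gX[OF f] cent(2)[of f] unfolding Y_def by (simp add: mult.assoc[symmetric])
    have EfY: "(\<lambda>b. c * (E f * D b)) \<in> W" by (rule gX[OF Der_gr[OF E f]])
    have "(commutator 0 j Y (\<lambda>b. f * E b) - commutator 0 j (\<lambda>b. f * Y b) E) - (\<lambda>b. c * (E f * D b)) \<in> W"
      by (rule W_diff[OF W_diff[OF W_commutator'[OF YW YL fE] W_commutator'[OF fYW fY E]] EfY])
    moreover have "(commutator 0 j Y (\<lambda>b. f * E b) - commutator 0 j (\<lambda>b. f * Y b) E) - (\<lambda>b. c * (E f * D b)) =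
      (\<lambda>b. c * D f * E b)"
    proof
      fix b
      have "E f * Y b = c * (E f * D b)"
        unfolding Y_def using cent(2)[of "E f"] by (simp add: mult.assoc[symmetric])
      moreover have "Y f = c * D f" unfolding Y_def ..
      ultimately show "(commutator 0 j Y (\<lambda>b. f * E b) - commutator 0 j (\<lambda>b. f * Y b) E - (\<lambda>b. c * (E f * D b))) b =
         c * D f * E b"
        unfolding fun_diff_def commutator_def
        by (simp add: Der_even_scalar[OF YL f] Der_even_scalar[OF E f] koszul_def)
    qed
    ultimately show "(\<lambda>b. c * D f * E b) \<in> W" by simp
  qed
qed

text \<open>
  Modulo \<open>p\<close> the bracket of an odd \<open>D\<close> with the odd derivation \<open>f E\<close> takes \<open>g\<close> to \<open>D(f) E(g)\<close>,
  because \<open>f\<close> is odd and so lies in \<open>p\<close>.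
\<close>

lemma even_element_from_odd:
  assumes p: "p \<in> Spec gr" "gr 1 \<subseteq> p"
    and E: "E \<in> L 0" "g \<in> gr 0" "E g \<notin> p"
    and D: "D \<in> W" "D \<in> L i" "D f \<notin> p"
  shows "\<exists>D\<in>W \<inter> L 0. \<exists>f\<in>gr 0. D f \<notin> p"
proof -
  note P = prime_superidealD[OF p(1)] and tp = twist_idealD[OF prime_superidealD(1)[OF p(1)]]
  obtain u v where f: "u \<in> gr 0" "v \<in> gr 1" "f = u + v" by (rule obtain_parts)
  have Df: "D f = D u + D v" unfolding f(3) by (rule Der_add[OF D(2)])
  show ?thesis
  proof (cases "i = 0")
    case True
    then have "D v \<in> p" using Der_gr[OF D(2) f(2)] p(2) by auto
    then have "D u \<notin> p" using D(3) Df tp(2) by auto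
    then show ?thesis using D True f by blast
  next
    case False
    then have i: "i = 1" by (cases i) auto
    then have "D u \<in> p" using Der_gr[OF D(2) f(1)] p(2) by auto
    then have Dv: "D v \<notin> p" using D(3) Df tp(2) by auto
    have vE: "(\<lambda>b. v * E b) \<in> L 1" using Der_module[OF f(2) E(1)] by simp
    let ?D = "commutator 1 1 D (\<lambda>b. v * E b)"
    have DL: "D \<in> L 1" using D(2) i by simp
    have "?D \<in> W" by (rule W_commutator'[OF D(1) DL vE])
    moreover have "?D \<in> L 0" using commutator_mem[OF DL vE] by simp
    moreover have "?D g \<notin> p"
    proof
      assume "?D g \<in> p"
      have "?D g = D v * E g + v * (E (D g) - D (E g))"
        unfolding commutator_def by (simp add: Der_leibniz[OF DL f(2)] koszul_def algebra_simps)
      moreover have "v * (E (D g) - D (E g)) \<in> p" using f(2) p(2) tp(4) by blast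
      ultimately have "D v * E g \<in> p"
        using \<open>?D g \<in> p\<close> twist_ideal_diff[OF P(1)] by (metis add_diff_cancel_right')
      then show False using P(3) Dv E(3) by blast
    qed
    ultimately show ?thesis using E(2) by blast
  qed
qed

end

theorem (in closed_superalgebra) Der_simple:
  assumes fg: "finitely_generated_superalgebra scale gr" and dom: "integral_superdomain gr"
    and smooth: "smooth_of_dim gr r s" and r: "r \<ge> 1"
  shows "simple_lie_superalgebra (pointwise_scale scale) L (Der_bracket scale gr)"
proof -
  have point: "\<exists>p. p \<in> Spec gr \<and> I \<subseteq> p \<and> gr 1 \<subseteq> p \<and> odd_ideal gr \<subseteq> p \<and>
      (\<forall>\<Lambda>. \<Lambda> \<subseteq> p \<longrightarrow> (\<forall>i D f. D \<in> L i \<longrightarrow> f \<in> \<Lambda> \<longrightarrow> D f \<in> \<Lambda>) \<longrightarrow> \<Lambda> \<subseteq> {0}) \<and>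
      (\<exists>D\<in>L 0. \<exists>g\<in>gr 0. D g \<notin> p)"
    if I: "ideal I (ring_of_type_algebra :: 'a ring)" "1 \<notin> I" for I
  proof -
    obtain p where p: "closed_point gr p" "I \<subseteq> p" "gr 1 \<subseteq> p" and res: "\<And>a. \<exists>c. a - scale c 1 \<in> p"
      using closed_point_above[OF fg I] by metis
    have spec: "p \<in> Spec gr" and sm: "smooth_point gr p r s"
      using p(1) smooth unfolding closed_point_def smooth_of_dim_def by auto
    note P = prime_superidealD[OF spec]
    have odd: "odd_ideal gr \<subseteq> p" by (rule odd_ideal_subset[OF P(4) p(3)])
    have "f = 0" if \<Lambda>: "\<Lambda> \<subseteq> p" "\<And>i D f. D \<in> L i \<Longrightarrow> f \<in> \<Lambda> \<Longrightarrow> D f \<in> \<Lambda>" "f \<in> \<Lambda>" for \<Lambda> f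
    proof (rule ccontr)
      assume "f \<noteq> 0"
      obtain q where q: "q \<in> p" "f = q * f" using smooth_point_derivations(1)[OF fg spec sm, of \<Lambda> f] res \<Lambda> by blast
      have "1 - q \<notin> p"
      proof
        assume "1 - q \<in> p"
        then have "(1 - q) + q \<in> p" using q(1) twist_idealD(2)[OF P(1)] by blast
        then show False using P(2) by simp
      qed
      then have "(1 - q) * f \<noteq> 0" using not_zero_divisor(1)[OF dom odd _ \<open>f \<noteq> 0\<close>] by blast
      moreover have "(1 - q) * f = f - q * f" by (simp add: left_diff_distrib)
      ultimately show False using q(2) by simp
    qed
    moreover have "\<exists>D\<in>L 0. \<exists>g\<in>gr 0. D g \<notin> p" using smooth_point_derivations(2)[OF fg spec sm] res r by blast
    ultimately show ?thesis using spec p(2,3) odd by (intro exI[of _ p] conjI allI impI) (assumption | blast)+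
  qed
  have "(1 :: 'a) \<noteq> 0"
  proof
    assume "(1 :: 'a) = 0"
    then have z: "x = 0" for x :: 'a by (metis mult_1_left mult_zero_left)
    have "0 \<in> odd_ideal gr"
    proof -
      interpret R: ring "ring_of_type_algebra :: 'a ring" by (rule ring_of_type_algebra_ring_1)
      show ?thesis unfolding odd_ideal_def
        using R.genideal_self[of "gr 1"] gr_zero[of 1] by (auto simp: ring_of_type_algebra_simps)
    qed
    then show False using dom z unfolding integral_superdomain_def by (metis DiffE all_not_in_conv)
  qed
  then have zero_ideal: "ideal {0 :: 'a} ring_of_type_algebra" "1 \<notin> {0 :: 'a}"
    unfolding ideal_ring_of_type_algebra_iff by auto
  obtain p E g where spec: "p \<in> Spec gr" and odd: "gr 1 \<subseteq> p" "odd_ideal gr \<subseteq> p"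
    and small: "\<And>\<Lambda>. \<Lambda> \<subseteq> p \<Longrightarrow> (\<And>i D f. D \<in> L i \<Longrightarrow> f \<in> \<Lambda> \<Longrightarrow> D f \<in> \<Lambda>) \<Longrightarrow> \<Lambda> \<subseteq> {0}"
    and E: "E \<in> L 0" "g \<in> gr 0" "E g \<notin> p"
    using point[OF zero_ideal] by metis
  note P = prime_superidealD[OF spec]
  have nonabelian: "\<not> (\<forall>x \<in> graded_sum L. \<forall>y \<in> graded_sum L. Der_bracket scale gr x y = 0)"
  proof
    assume ab: "\<forall>x \<in> graded_sum L. \<forall>y \<in> graded_sum L. Der_bracket scale gr x y = 0"
    have gE: "(\<lambda>b. g * E b) \<in> L 0" using Der_module[OF E(2,1)] by simp
    have "Der_bracket scale gr E (\<lambda>b. g * E b) = 0" using ab graded_sum_DerI[OF E(1)] graded_sum_DerI[OF gE] by blast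
    then have "commutator 0 0 E (\<lambda>b. g * E b) = 0" unfolding Der_bracket_homogeneous[OF E(1) gE] .
    then have "commutator 0 0 E (\<lambda>b. g * E b) g = 0" by simp
    then have "E g * E g = 0" by (simp add: commutator_def Der_even_scalar[OF E(1,2)] koszul_def)
    then show False using P(3)[of "E g" "E g"] E(3) twist_idealD(1)[OF P(1)] by auto
  qed
  have "W = {0} \<or> W = graded_sum L"
    if W: "lie_superideal (pointwise_scale scale) L (Der_bracket scale gr) W" for W
  proof (rule disjCI)
    assume "W \<noteq> graded_sum L"
    interpret derivation_ideal scale gr W by unfold_locales (rule W)
    have one: "1 \<notin> coeff_ideal" using one_in_coeff_ideal \<open>W \<noteq> graded_sum L\<close> by blast
    have "coeff_ideal \<subseteq> {0}"
    proof -
      obtain q where q: "coeff_ideal \<subseteq> q"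
        and small': "\<And>\<Lambda>. \<Lambda> \<subseteq> q \<Longrightarrow> (\<And>i D f. D \<in> L i \<Longrightarrow> f \<in> \<Lambda> \<Longrightarrow> D f \<in> \<Lambda>) \<Longrightarrow> \<Lambda> \<subseteq> {0}"
        using point[OF ideal_coeff_ideal one] by (elim exE conjE) meson
      show ?thesis by (rule small'[OF q]) (rule coeff_ideal_derivation)
    qed
    then have coeff0: "x = 0" if "x \<in> coeff_part i" for x i using coeff_part_subset that by blast
    have even_p: "D f \<in> p" if D: "D \<in> W" "D \<in> L 0" and f: "f \<in> gr 0" for D f
    proof (rule ccontr)
      assume Df: "D f \<notin> p"
      have "D (D h) = 0" if h: "h \<in> gr 0" for h
      proof (rule ccontr)
        assume "D (D h) \<noteq> 0"
        then have "D (D h) * D f \<noteq> 0" by (rule not_zero_divisor(2)[OF dom odd(2) Df])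
        then show False using coeff0[OF even_element_coefficient[OF D h f]] by blast
      qed
      note sq = this
      have ff: "f * f \<in> gr 0" using mult_gr[OF f f] by simp
      have Dfe: "D f \<in> gr 0" using Der_gr[OF D(2) f] by simp
      note leib = Der_even_scalar[OF D(2)]
      \<comment> \<open>with \<open>D (D f) = 0\<close> this is \<open>2 (D f)\<^sup>2\<close>\<close>
      have "D (D (f * f)) = D f * D f + D f * D f"
        using sq[OF f] by (simp add: leib[OF f] leib[OF Dfe] Der_add[OF D(2)])
      then have "D f * D f + D f * D f = 0" using sq[OF ff] by simp
      then have "D f * D f = 0" by (rule double_eq_zero)
      then show False using P(3)[of "D f" "D f"] Df twist_idealD(1)[OF P(1)] by auto
    qed
    have hom_p: "D f \<in> p" if "D \<in> W" "D \<in> L i" for D f i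
      using even_element_from_odd[OF spec odd(1) E that] even_p by blast
    have span_p: "value_span (W \<inter> (L 0 \<union> L 1)) \<subseteq> p"
    proof
      fix x assume "x \<in> value_span (W \<inter> (L 0 \<union> L 1))"
      then show "x \<in> p"
        by (induction rule: value_span.induct) (use hom_p twist_idealD(2)[OF P(1)] in auto)
    qed
    have "value_span (W \<inter> (L 0 \<union> L 1)) \<subseteq> {0}"
      by (rule small[OF span_p]) (rule value_span_closed[OF W_commutator])
    then have zero: "D f = 0" if "D \<in> W" "D \<in> L 0 \<union> L 1" for D f using value_span.of_value[of D "W \<inter> (L 0 \<union> L 1)" f] that by blast
    have "w = 0" if w: "w \<in> W" for w
    proof -
      obtain x y where "x \<in> W" "x \<in> L 0" "y \<in> W" "y \<in> L 1" "w = x + y" by (rule W_parts[OF w])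
      then show ?thesis using zero[of x] zero[of y] by (auto simp: fun_eq_iff)
    qed
    then show "W = {0}" using W_zero by blast
  qed
  then show ?thesis unfolding simple_lie_superalgebra_def using lie_superalgebra_Der nonabelian by blast
qed

theorem theorem2p8:
  fixes scale :: "'k::{alg_closed_field, field_char_0} \<Rightarrow> 'a::ring_1 \<Rightarrow> 'a"
    and gr :: "bit \<Rightarrow> 'a set"
    and r s :: nat
  assumes "superalgebra scale gr"
    and "finitely_generated_superalgebra scale gr"
    and "integral_superdomain gr"
    and "smooth_of_dim gr r s"
    and "r \<ge> 1"
  shows "simple_lie_superalgebra (pointwise_scale scale) (Der scale gr) (Der_bracket scale gr)"
proof -
  interpret superalgebra scale gr by fact
  interpret closed_superalgebra scale gr by unfold_locales
  show ?thesis by (rule Der_simple[OF assms(2-5)])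
qed

end
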